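(* For each $n\in\mathbb N$ let $A_n^*$ be the operator $A_n^*\phi=\kappa_n\sigma\phi''$ in $L^1(S)$ with domain composed of the functions $\phi\in W^{2,1}(S)$ satisfying $\kappa_n\phi'(L_i)=F_{L,i}\phi$ and $\kappa_n\phi'(R_i)=F_{R,i}\phi$ for all $i\in\mathcal N$. Then $$\lim_{n\to+\infty}e^{tA_n^*}\phi=e^{tQ}P\phi,\qquad \phi\in L^1(S),\ t>0,$$ in $L^1(S)$, and the convergence is uniform (in $t$) on compact subsets of $(0,\infty)$. If $\phi\in L^1_0(S)$, then the formula holds also for $t=0$, and the convergence is uniform on compact subsets of $[0,+\infty)$.
   Context: Graph. Let $\mathcal G=(\mathcal V,\mathcal E)$ be a finite directed geometric graph in $\mathbb R^3$ without loops: $\mathcal V$ is the finite set of vertices and the edges $E_1,\dots,E_N$ are $C^1$ curves of finite lengths $d_i>0$ connecting vertices; put $\mathcal N=\{1,\dots,N\}$, $\mathbb N=\{1,2,\dots\}$. The initial and terminal vertices of $E_i$ are denoted $L_i$ (left endpoint) and $R_i$ (right endpoint); $L_i\ne R_i$ as vertices. $S$ is the disjoint union of the edges. Each $E_i$ is identified with $[0,d_i]$ by arc length, $L_i$ corresponding to $0$ and $R_i$ to $d_i$. A function $\phi$ on $S$ is identified with $(\phi_i)_{i\in\mathcal N}$, $\phi_i$ a function on $[0,d_i]$; $\phi(L_i)=\phi_i(0)$, $\phi(R_i)=\phi_i(d_i)$, $\phi'(L_i)=\phi_i'(0)$, $\phi'(R_i)=\phi_i'(d_i)$. Coefficients. $\sigma_i>0$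 ($i\in\mathcal N$) are given and $\sigma$ is the function on $S$ equal to $\sigma_i$ on $E_i$. $l_i,r_i\ge 0$ and, for $i\neq j$, $l_{ij},r_{ij}\ge 0$ are real numbers with $\sum_{j\ne i}l_{ij}\le l_i$, $\sum_{j\neq i}r_{ij}\le r_i$; $l_{ij}=0$ if $E_j$ is not incident with the vertex $L_i$, and $r_{ij}=0$ if $E_j$ is not incident with the vertex $R_i$. $(\kappa_n)_{n\in\mathbb N}$ is a nondecreasing sequence of positive numbers converging to $+\infty$. Spaces and functionals. $L^1(S)=\{\phi=(\phi_i)_{i\in\mathcal N}:\phi_i\in L^1(0,d_i)\}$ (real functions), $\|\phi\|_{L^1(S)}=\sum_i\|\phi_i\|_{L^1(0,d_i)}$. $W^{2,1}(S)$ is the set of $\phi\in L^1(S)$ such that $\phi,\phi'$ are weakly differentiable (on each edge) with $\phi',\phi''\in L^1(S)$. Functionals $F_{L,i},F_{R,i}$ on $W^{2,1}(S)$ are defined by $$\sigma_iF_{L,i}\phi=\sigma_il_i\phi(L_i)-\sum_{j\neq i:\,L_j=L_i}\sigma_jl_{ji}\phi(L_j)-\sum_{j\ne i:\,R_j=L_i}\sigma_jr_{ji}\phi(R_j),$$ $$\sigma_iF_{R,i}\phi=\sum_{j\neq i:\,L_j=R_i}\sigma_jl_{ji}\phi(L_j)+\sum_{j\ne i:\,R_j=R_i}\sigma_jr_{ji}\phi(R_j)-\sigma_ir_i\phi(R_i),$$ where equalities under the sums are equalities of vertices in $\mathcal V$. Each $A_n^*$ generates a strongly continuous semigroup $\{e^{tA_n^*}\}_{t\ge0}$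 in $L^1(S)$. Limit objects. $L^1_0(S)\subset L^1(S)$ is the closed subspace of functions constant on each edge. $P$ is the projection of $L^1(S)$ onto $L^1_0(S)$ given by $P\phi=\bigl(d_i^{-1}\int_{E_i}\phi_i\bigr)_{i\in\mathcal N}$. $Q$ is the (bounded) operator in $L^1_0(S)$ given, for $\phi=(\phi_i)_{i\in\mathcal N}$ with $\phi_i$ the constant value on $E_i$, by $Q\phi=\bigl(\sum_{j\ne i}q_{ij}\phi_j+q_{ii}\phi_i\bigr)_{i\in\mathcal N}$, where $q_{ij}=\sigma_jd_i^{-1}(l_{ji}+r_{ji})$ for $i\neq j$ and $q_{ii}=-\sigma_id_i^{-1}(l_i+r_i)$. *)

theory Defs
  imports "HOL-Analysis.Analysis" "Graph_Theory.Digraph"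
begin

text \<open>
  Edge \<open>i\<close> of the graph is the arc \<open>i \<in> {1..N}\<close> of a finite loop-free digraph whose vertices are
  points of three-dimensional space; its left endpoint is \<open>tail G i\<close> and its right endpoint is
  \<open>head G i\<close>. The curve \<open>\<gamma> i\<close> is the edge in its arc-length parametrisation, so that \<open>d i\<close> is its
  length. Parallel edges are allowed; the curves are not required to be disjoint, since functions
  live on the disjoint union of the edges.
\<close>

locale geometric_graph = fin_digraph G + loopfree_digraph G
  for G :: "(real ^ 3, nat) pre_digraph" +
  fixes N :: nat and d :: "nat \<Rightarrow> real" and \<gamma> :: "nat \<Rightarrow> real \<Rightarrow> real ^ 3"
  assumes arcs_eq: "arcs G = {1..N}"
    and length_pos: "\<And>i. i \<in> {1..N} \<Longrightarrow> 0 < d i"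
    and C1_unit_speed: "\<And>i. i \<in> {1..N} \<Longrightarrow>
          \<exists>\<gamma>'. continuous_on {0..d i} \<gamma>' \<and>
            (\<forall>s\<in>{0..d i}. (\<gamma> i has_vector_derivative \<gamma>' s) (at s within {0..d i}) \<and> norm (\<gamma>' s) = 1)"
    and left_endpoint: "\<And>i. i \<in> {1..N} \<Longrightarrow> \<gamma> i 0 = tail G i"
    and right_endpoint: "\<And>i. i \<in> {1..N} \<Longrightarrow> \<gamma> i (d i) = head G i"

definition incident :: "(real ^ 3, nat) pre_digraph \<Rightarrow> nat \<Rightarrow> real ^ 3 \<Rightarrow> bool" where
  "incident G j v \<longleftrightarrow> tail G j = v \<or> head G j = v"

text \<open>
  \<open>l i\<close>, \<open>r i\<close> are the numbers with one index, \<open>lt i j\<close>, \<open>rt i j\<close> (used for \<open>i \<noteq> j\<close> only) those with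
  two indices.
\<close>

locale graph_diffusion = geometric_graph +
  fixes \<sigma> l r :: "nat \<Rightarrow> real" and lt rt :: "nat \<Rightarrow> nat \<Rightarrow> real"
  assumes sigma_pos: "\<And>i. i \<in> {1..N} \<Longrightarrow> 0 < \<sigma> i"
    and l_nonneg: "\<And>i. i \<in> {1..N} \<Longrightarrow> 0 \<le> l i"
    and r_nonneg: "\<And>i. i \<in> {1..N} \<Longrightarrow> 0 \<le> r i"
    and lt_nonneg: "\<And>i j. i \<in> {1..N} \<Longrightarrow> j \<in> {1..N} \<Longrightarrow> i \<noteq> j \<Longrightarrow> 0 \<le> lt i j"
    and rt_nonneg: "\<And>i j. i \<in> {1..N} \<Longrightarrow> j \<in> {1..N} \<Longrightarrow> i \<noteq> j \<Longrightarrow> 0 \<le> rt i j"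
    and lt_sum: "\<And>i. i \<in> {1..N} \<Longrightarrow> (\<Sum>j\<in>{1..N} - {i}. lt i j) \<le> l i"
    and rt_sum: "\<And>i. i \<in> {1..N} \<Longrightarrow> (\<Sum>j\<in>{1..N} - {i}. rt i j) \<le> r i"
    and lt_incident: "\<And>i j. i \<in> {1..N} \<Longrightarrow> j \<in> {1..N} \<Longrightarrow> i \<noteq> j \<Longrightarrow>
          \<not> incident G j (tail G i) \<Longrightarrow> lt i j = 0"
    and rt_incident: "\<And>i j. i \<in> {1..N} \<Longrightarrow> j \<in> {1..N} \<Longrightarrow> i \<noteq> j \<Longrightarrow>
          \<not> incident G j (head G i) \<Longrightarrow> rt i j = 0"


section \<open>The space of integrable functions on the disjoint union of the edges\<close>

text \<open>
  Elements of \<open>L\<^sup>1(S)\<close> are represented by functions; only the values \<open>\<phi> i x\<close> with \<open>i \<in> {1..N}\<close> and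
  \<open>x \<in> {0..d i}\<close> matter, and \<open>L1_eq\<close> is equality of classes.
\<close>

type_synonym edge_fun = "nat \<Rightarrow> real \<Rightarrow> real"

definition L1S :: "nat \<Rightarrow> (nat \<Rightarrow> real) \<Rightarrow> edge_fun set" where
  "L1S N d = {\<phi>. \<forall>i\<in>{1..N}. \<phi> i absolutely_integrable_on {0..d i}}"

definition L1_norm :: "nat \<Rightarrow> (nat \<Rightarrow> real) \<Rightarrow> edge_fun \<Rightarrow> real" where
  "L1_norm N d \<phi> = (\<Sum>i=1..N. LINT x:{0..d i}|lebesgue. \<bar>\<phi> i x\<bar>)"

definition L1_dist :: "nat \<Rightarrow> (nat \<Rightarrow> real) \<Rightarrow> edge_fun \<Rightarrow> edge_fun \<Rightarrow> real" where
  "L1_dist N d \<phi> \<psi> = L1_norm N d (\<lambda>i x. \<phi> i x - \<psi> i x)"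

definition ae_eq_on :: "real \<Rightarrow> real \<Rightarrow> (real \<Rightarrow> real) \<Rightarrow> (real \<Rightarrow> real) \<Rightarrow> bool" where
  "ae_eq_on a b f g \<longleftrightarrow> (AE x in lebesgue. x \<in> {a..b} \<longrightarrow> f x = g x)"

definition L1_eq :: "nat \<Rightarrow> (nat \<Rightarrow> real) \<Rightarrow> edge_fun \<Rightarrow> edge_fun \<Rightarrow> bool" where
  "L1_eq N d \<phi> \<psi> \<longleftrightarrow> (\<forall>i\<in>{1..N}. ae_eq_on 0 (d i) (\<phi> i) (\<psi> i))"


section \<open>Strongly continuous semigroups and their generators\<close>

definition bounded_operator_L1 :: "nat \<Rightarrow> (nat \<Rightarrow> real) \<Rightarrow> (edge_fun \<Rightarrow> edge_fun) \<Rightarrow> bool" where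
  "bounded_operator_L1 N d B \<longleftrightarrow>
     (\<forall>\<phi>\<in>L1S N d. B \<phi> \<in> L1S N d) \<and>
     (\<forall>\<phi>\<in>L1S N d. \<forall>\<psi>\<in>L1S N d. \<forall>a b.
        L1_eq N d (B (\<lambda>i x. a * \<phi> i x + b * \<psi> i x)) (\<lambda>i x. a * B \<phi> i x + b * B \<psi> i x)) \<and>
     (\<exists>C. \<forall>\<phi>\<in>L1S N d. L1_norm N d (B \<phi>) \<le> C * L1_norm N d \<phi>)"

definition C0_semigroup :: "nat \<Rightarrow> (nat \<Rightarrow> real) \<Rightarrow> (real \<Rightarrow> edge_fun \<Rightarrow> edge_fun) \<Rightarrow> bool" where
  "C0_semigroup N d T \<longleftrightarrow>
     (\<forall>t\<ge>0. bounded_operator_L1 N d (T t)) \<and>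
     (\<forall>\<phi>\<in>L1S N d. L1_eq N d (T 0 \<phi>) \<phi>) \<and>
     (\<forall>s\<ge>0. \<forall>t\<ge>0. \<forall>\<phi>\<in>L1S N d. L1_eq N d (T (s + t) \<phi>) (T s (T t \<phi>))) \<and>
     (\<forall>\<phi>\<in>L1S N d. ((\<lambda>t. L1_dist N d (T t \<phi>) \<phi>) \<longlongrightarrow> 0) (at_right 0))"

definition has_generator_value ::
    "nat \<Rightarrow> (nat \<Rightarrow> real) \<Rightarrow> (real \<Rightarrow> edge_fun \<Rightarrow> edge_fun) \<Rightarrow> edge_fun \<Rightarrow> edge_fun \<Rightarrow> bool" where
  "has_generator_value N d T \<phi> \<psi> \<longleftrightarrow>
     \<psi> \<in> L1S N d \<and>
     ((\<lambda>t. L1_dist N d (\<lambda>i x. (T t \<phi> i x - \<phi> i x) / t) \<psi>) \<longlongrightarrow> 0) (at_right 0)"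

text \<open>
  \<open>generates N d D A T\<close>: the operator \<open>A\<close> with domain \<open>D\<close> is the generator of the strongly continuous
  semigroup \<open>T\<close>, including equality of the domains. As an operator determines the semigroup it
  generates, this says that \<open>T t\<close> is the operator written \<open>exp (t A)\<close>.
\<close>

definition generates ::
    "nat \<Rightarrow> (nat \<Rightarrow> real) \<Rightarrow> edge_fun set \<Rightarrow> (edge_fun \<Rightarrow> edge_fun) \<Rightarrow>
     (real \<Rightarrow> edge_fun \<Rightarrow> edge_fun) \<Rightarrow> bool" where
  "generates N d D A T \<longleftrightarrow>
     C0_semigroup N d T \<and>
     D = {\<phi> \<in> L1S N d. \<exists>\<psi>. has_generator_value N d T \<phi> \<psi>} \<and>
     (\<forall>\<phi>\<in>D. has_generator_value N d T \<phi> (A \<phi>))"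


section \<open>Weak derivatives and the Sobolev space \<open>W\<^sup>2\<^sup>,\<^sup>1(S)\<close>\<close>

definition test_function :: "real \<Rightarrow> real \<Rightarrow> (real \<Rightarrow> real) \<Rightarrow> (real \<Rightarrow> real) \<Rightarrow> bool" where
  "test_function a b \<zeta> \<zeta>' \<longleftrightarrow>
     (\<forall>x. (\<zeta> has_real_derivative \<zeta>' x) (at x)) \<and> continuous_on UNIV \<zeta>' \<and>
     (\<exists>K. compact K \<and> K \<subseteq> {a<..<b} \<and> (\<forall>x. x \<notin> K \<longrightarrow> \<zeta> x = 0))"

text \<open>
  \<open>f\<close> and its weak derivative \<open>g\<close> are both required to be integrable. Test functions are compactly
  supported and continuously differentiable; for integrable \<open>g\<close> this is the same as using smooth ones.
\<close>

definition has_weak_derivative :: "real \<Rightarrow> real \<Rightarrow> (real \<Rightarrow> real) \<Rightarrow> (real \<Rightarrow> real) \<Rightarrow> bool" where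
  "has_weak_derivative a b f g \<longleftrightarrow>
     f absolutely_integrable_on {a..b} \<and> g absolutely_integrable_on {a..b} \<and>
     (\<forall>\<zeta> \<zeta>'. test_function a b \<zeta> \<zeta>' \<longrightarrow>
        (LINT x:{a..b}|lebesgue. f x * \<zeta>' x) = - (LINT x:{a..b}|lebesgue. g x * \<zeta> x))"

text \<open>The choice determines the weak derivative up to a null set, hence its class uniquely.\<close>

definition wderiv :: "(nat \<Rightarrow> real) \<Rightarrow> edge_fun \<Rightarrow> edge_fun" where
  "wderiv d \<phi> = (\<lambda>i. SOME g. has_weak_derivative 0 (d i) (\<phi> i) g)"

definition W21 :: "nat \<Rightarrow> (nat \<Rightarrow> real) \<Rightarrow> edge_fun set" where
  "W21 N d = {\<phi> \<in> L1S N d. \<forall>i\<in>{1..N}.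
     (\<exists>g. has_weak_derivative 0 (d i) (\<phi> i) g) \<and>
     (\<exists>h. has_weak_derivative 0 (d i) (wderiv d \<phi> i) h)}"

text \<open>
  Point values are those of the continuous version, which on \<open>{0..d i}\<close> is unique whenever it exists.
  It exists for every integrable function with integrable weak derivative, in particular for \<open>\<phi>\<close> and
  \<open>wderiv d \<phi>\<close> with \<open>\<phi> \<in> W21 N d\<close>.
\<close>

definition continuous_version :: "real \<Rightarrow> real \<Rightarrow> (real \<Rightarrow> real) \<Rightarrow> real \<Rightarrow> real" where
  "continuous_version a b f = (SOME g. continuous_on {a..b} g \<and> ae_eq_on a b g f)"

definition at_left_end :: "(nat \<Rightarrow> real) \<Rightarrow> edge_fun \<Rightarrow> nat \<Rightarrow> real" where
  "at_left_end d \<phi> i = continuous_version 0 (d i) (\<phi> i) 0"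

definition at_right_end :: "(nat \<Rightarrow> real) \<Rightarrow> edge_fun \<Rightarrow> nat \<Rightarrow> real" where
  "at_right_end d \<phi> i = continuous_version 0 (d i) (\<phi> i) (d i)"


section \<open>The operators with transmission conditions\<close>

definition F_L ::
    "(real ^ 3, nat) pre_digraph \<Rightarrow> nat \<Rightarrow> (nat \<Rightarrow> real) \<Rightarrow> (nat \<Rightarrow> real) \<Rightarrow> (nat \<Rightarrow> real) \<Rightarrow>
     (nat \<Rightarrow> nat \<Rightarrow> real) \<Rightarrow> (nat \<Rightarrow> nat \<Rightarrow> real) \<Rightarrow> nat \<Rightarrow> edge_fun \<Rightarrow> real" where
  "F_L G N d \<sigma> l lt rt i \<phi> =
     (\<sigma> i * l i * at_left_end d \<phi> i
      - (\<Sum>j\<in>{j\<in>{1..N}. j \<noteq> i \<and> tail G j = tail G i}. \<sigma> j * lt j i * at_left_end d \<phi> j)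
      - (\<Sum>j\<in>{j\<in>{1..N}. j \<noteq> i \<and> head G j = tail G i}. \<sigma> j * rt j i * at_right_end d \<phi> j)) / \<sigma> i"

definition F_R ::
    "(real ^ 3, nat) pre_digraph \<Rightarrow> nat \<Rightarrow> (nat \<Rightarrow> real) \<Rightarrow> (nat \<Rightarrow> real) \<Rightarrow> (nat \<Rightarrow> real) \<Rightarrow>
     (nat \<Rightarrow> nat \<Rightarrow> real) \<Rightarrow> (nat \<Rightarrow> nat \<Rightarrow> real) \<Rightarrow> nat \<Rightarrow> edge_fun \<Rightarrow> real" where
  "F_R G N d \<sigma> r lt rt i \<phi> =
     ((\<Sum>j\<in>{j\<in>{1..N}. j \<noteq> i \<and> tail G j = head G i}. \<sigma> j * lt j i * at_left_end d \<phi> j)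
      + (\<Sum>j\<in>{j\<in>{1..N}. j \<noteq> i \<and> head G j = head G i}. \<sigma> j * rt j i * at_right_end d \<phi> j)
      - \<sigma> i * r i * at_right_end d \<phi> i) / \<sigma> i"

definition A_star_dom ::
    "(real ^ 3, nat) pre_digraph \<Rightarrow> nat \<Rightarrow> (nat \<Rightarrow> real) \<Rightarrow> (nat \<Rightarrow> real) \<Rightarrow> (nat \<Rightarrow> real) \<Rightarrow>
     (nat \<Rightarrow> real) \<Rightarrow> (nat \<Rightarrow> nat \<Rightarrow> real) \<Rightarrow> (nat \<Rightarrow> nat \<Rightarrow> real) \<Rightarrow> real \<Rightarrow> edge_fun set" where
  "A_star_dom G N d \<sigma> l r lt rt k = {\<phi> \<in> W21 N d. \<forall>i\<in>{1..N}.
     k * at_left_end d (wderiv d \<phi>) i = F_L G N d \<sigma> l lt rt i \<phi> \<and>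
     k * at_right_end d (wderiv d \<phi>) i = F_R G N d \<sigma> r lt rt i \<phi>}"

definition A_star :: "(nat \<Rightarrow> real) \<Rightarrow> (nat \<Rightarrow> real) \<Rightarrow> real \<Rightarrow> edge_fun \<Rightarrow> edge_fun" where
  "A_star d \<sigma> k \<phi> = (\<lambda>i x. k * \<sigma> i * wderiv d (wderiv d \<phi>) i x)"


section \<open>The limit semigroup\<close>

text \<open>
  An element of \<open>L\<^sup>1\<^sub>0(S)\<close> is identified with the vector \<open>c\<close> of its values on the edges, and
  \<open>edge_const c\<close> is the corresponding function. \<open>avg\<close> is the projection \<open>P\<close> in this identification.
\<close>

definition edge_const :: "(nat \<Rightarrow> real) \<Rightarrow> edge_fun" where
  "edge_const c = (\<lambda>i x. c i)"

definition L10 :: "nat \<Rightarrow> (nat \<Rightarrow> real) \<Rightarrow> edge_fun set" where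
  "L10 N d = {\<phi> \<in> L1S N d. \<exists>c. L1_eq N d \<phi> (edge_const c)}"

definition avg :: "(nat \<Rightarrow> real) \<Rightarrow> edge_fun \<Rightarrow> nat \<Rightarrow> real" where
  "avg d \<phi> i = (1 / d i) * (LINT x:{0..d i}|lebesgue. \<phi> i x)"

definition q_coeff ::
    "(nat \<Rightarrow> real) \<Rightarrow> (nat \<Rightarrow> real) \<Rightarrow> (nat \<Rightarrow> real) \<Rightarrow> (nat \<Rightarrow> real) \<Rightarrow>
     (nat \<Rightarrow> nat \<Rightarrow> real) \<Rightarrow> (nat \<Rightarrow> nat \<Rightarrow> real) \<Rightarrow> nat \<Rightarrow> nat \<Rightarrow> real" where
  "q_coeff d \<sigma> l r lt rt i j =
     (if i = j then - \<sigma> i * (1 / d i) * (l i + r i) else \<sigma> j * (1 / d i) * (lt j i + rt j i))"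

definition Q_op :: "nat \<Rightarrow> (nat \<Rightarrow> nat \<Rightarrow> real) \<Rightarrow> (nat \<Rightarrow> real) \<Rightarrow> nat \<Rightarrow> real" where
  "Q_op N q c i = (\<Sum>j\<in>{1..N} - {i}. q i j * c j) + q i i * c i"

text \<open>The exponential series of the bounded operator \<open>t Q\<close>, taken componentwise.\<close>

definition exp_Q :: "nat \<Rightarrow> (nat \<Rightarrow> nat \<Rightarrow> real) \<Rightarrow> real \<Rightarrow> (nat \<Rightarrow> real) \<Rightarrow> nat \<Rightarrow> real" where
  "exp_Q N q t c i = (\<Sum>k. t ^ k / fact k * (Q_op N q ^^ k) c i)"

lemma exp_Q_summable:
  assumes i: "i \<in> {1..N}"
  shows "summable (\<lambda>k. t ^ k / fact k * (Q_op N q ^^ k) c i)"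
proof -
  define B where "B = (\<Sum>i\<in>{1..N}. \<Sum>j\<in>{1..N}. \<bar>q i j\<bar>)"
  define M where "M = (\<Sum>i\<in>{1..N}. \<bar>c i\<bar>)"
  have bd: "\<bar>(Q_op N q ^^ k) c i\<bar> \<le> B ^ k * M" if "i \<in> {1..N}" for k i
    using that
  proof (induction k arbitrary: i)
    case 0
    then show ?case
      unfolding M_def by (auto intro: member_le_sum)
  next
    case (Suc k)
    have "(Q_op N q ^^ Suc k) c i = (\<Sum>j\<in>{1..N}. q i j * (Q_op N q ^^ k) c j)"
      unfolding funpow.simps o_def Q_op_def
      using sum.remove[of "{1..N}" i "\<lambda>j. q i j * (Q_op N q ^^ k) c j"] Suc.prems
      by (simp add: Q_op_def[abs_def] add.commute)
    then have "\<bar>(Q_op N q ^^ Suc k) c i\<bar> \<le> (\<Sum>j\<in>{1..N}. \<bar>q i j * (Q_op N q ^^ k) c j\<bar>)"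
      by (simp only: sum_abs)
    also have "\<dots> \<le> (\<Sum>j\<in>{1..N}. \<bar>q i j\<bar> * (B ^ k * M))"
      by (intro sum_mono) (auto simp: abs_mult intro!: mult_left_mono Suc.IH)
    also have "\<dots> = (\<Sum>j\<in>{1..N}. \<bar>q i j\<bar>) * (B ^ k * M)"
      by (simp add: sum_distrib_right)
    also have "\<dots> \<le> B * (B ^ k * M)"
    proof (rule mult_right_mono)
      show "(\<Sum>j\<in>{1..N}. \<bar>q i j\<bar>) \<le> B"
        unfolding B_def using Suc.prems
        by (intro member_le_sum[where f = "\<lambda>i. \<Sum>j\<in>{1..N}. \<bar>q i j\<bar>"]) (auto intro: sum_nonneg)
      have "0 \<le> B" "0 \<le> M" unfolding B_def M_def by (auto intro!: sum_nonneg)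
      then show "0 \<le> B ^ k * M" by simp
    qed
    finally show ?case by (simp add: mult.assoc)
  qed
  have "summable (\<lambda>k. M * (inverse (fact k) * (\<bar>t\<bar> * B) ^ k))"
    by (intro summable_mult summable_exp)
  then show ?thesis
  proof (rule summable_comparison_test')
    fix k
    have "norm (t ^ k / fact k * (Q_op N q ^^ k) c i) = \<bar>t\<bar> ^ k / fact k * \<bar>(Q_op N q ^^ k) c i\<bar>"
      by (simp add: abs_mult power_abs)
    also have "\<dots> \<le> \<bar>t\<bar> ^ k / fact k * (B ^ k * M)"
      by (intro mult_left_mono bd i) auto
    also have "\<dots> = M * (inverse (fact k) * (\<bar>t\<bar> * B) ^ k)"
      by (simp add: power_mult_distrib field_simps)
    finally show "norm (t ^ k / fact k * (Q_op N q ^^ k) c i) \<le> M * (inverse (fact k) * (\<bar>t\<bar> * B) ^ k)" .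
  qed
qed

end

theory Submission
  imports Defs
begin

text \<open>
  Integrating \<open>\<phi>''\<close> against a smooth approximation of the sign of \<open>\<phi>\<close> shows that each \<open>A\<^sub>n\<^sup>*\<close> is dissipative
  in \<open>L\<^sup>1(S)\<close>, because the mass entering an edge through a vertex has left another edge; hence the
  semigroups are contractions. Convergence on \<open>L\<^sup>1\<^sub>0(S)\<close> then needs no resolvents: a constant function \<open>c\<close>
  is perturbed by terms of order \<open>1 / \<kappa>\<^sub>n\<close> to an element \<open>\<psi>\<close> of the domain for which \<open>A\<^sub>n\<^sup>* \<psi>\<close> is within
  order \<open>1 / \<kappa>\<^sub>n\<close> of \<open>Q c\<close>, and contractivity controls the accumulated error of the resulting
  approximate solution of the evolution equation. In the same way the Neumann eigenfunctions
  \<open>cos (m \<pi> x / d\<^sub>i)\<close>, \<open>m \<ge> 1\<close>, become approximate eigenfunctions with eigenvalue of order \<open>- \<kappa>\<^sub>n\<close>, so their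
  orbits tend to \<open>0\<close> uniformly away from \<open>t = 0\<close>; they span a dense subspace of the functions with mean
  zero on each edge.
\<close>

section \<open>Integrals over a compact interval\<close>

text \<open>\<open>C0_semigroup\<close> bounds each operator separately, with no uniformity in time,
  and \<open>generates\<close> speaks only of difference quotients at time 0. Every estimate along
  an orbit therefore rests on local boundedness in time, that is, on the uniform boundedness
  principle and the completeness of L^1(S). Q arises as a solvability condition: the corrector of a
  constant \<open>c\<close> has constant second derivative on each edge, and its integral over edge
  i has to equal the difference of the end slopes that the transmission conditions impose; this
  difference is \<open>d i / \<sigma> i\<close> times the i-th entry of Q c. The two approximations
  differ in quality. For constants the residual is of order 1 / \<kappa>_n. For cosines it is merely
  bounded, because a slope correction of order 1 / \<kappa>_n is multiplied by the diffusion
  coefficient; but it decays together with the approximate orbit at a rate proportional to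
  \<kappa>_n, so its accumulated effect is again of order 1 / \<kappa>_n. The frequency m = 0 is not
  damped: it is the part on which Q acts.\<close>

lemma absolutely_integrable_iff:
  fixes f :: "real \<Rightarrow> real"
  shows "f absolutely_integrable_on {a..b} \<longleftrightarrow> integrable (lebesgue_on {a..b}) f"
  by (simp add: set_integrable_def integrable_restrict_space)

lemma LINT_eq:
  fixes f :: "real \<Rightarrow> real"
  shows "(LINT x:{a..b}|lebesgue. f x) = integral\<^sup>L (lebesgue_on {a..b}) f"
  by (simp add: set_lebesgue_integral_def integral_restrict_space)

lemma ae_eq_on_iff: "ae_eq_on a b f g \<longleftrightarrow> (AE x in lebesgue_on {a..b}. f x = g x)"
  by (simp add: ae_eq_on_def AE_restrict_space_iff)

lemma finite_measure_interval: "finite_measure (lebesgue_on {a..b::real})"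
  by (rule finite_measure_lebesgue_on) auto

lemma measure_interval: "measure (lebesgue_on {a..b}) (space (lebesgue_on {a..b})) = max 0 (b - a)" for a b :: real
  by (simp add: measure_restrict_space)

lemma integrable_continuous_interval_lebesgue:
  fixes f :: "real \<Rightarrow> real"
  assumes "continuous_on {a..b} f"
  shows "integrable (lebesgue_on {a..b}) f"
  using absolutely_integrable_continuous_real[OF assms] by (simp add: absolutely_integrable_iff)

lemma continuous_interval_bounded:
  fixes g :: "real \<Rightarrow> real"
  assumes "continuous_on {a..b} g"
  obtains B where "0 \<le> B" "\<And>x. x \<in> {a..b} \<Longrightarrow> \<bar>g x\<bar> \<le> B"
proof -
  have "bounded (g ` {a..b})"
    by (rule compact_imp_bounded[OF compact_continuous_image[OF assms compact_Icc]])
  then obtain B where "\<forall>y\<in>g ` {a..b}. norm y \<le> B" unfolding bounded_iff by blast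
  then have "\<bar>g x\<bar> \<le> max 0 B" if "x \<in> {a..b}" for x using that by force
  then show ?thesis using that[of "max 0 B"] by simp
qed

lemma integrable_mult_continuous:
  fixes f g :: "real \<Rightarrow> real"
  assumes f: "integrable (lebesgue_on {a..b}) f" and g: "continuous_on {a..b} g"
  shows "integrable (lebesgue_on {a..b}) (\<lambda>x. f x * g x)"
proof -
  obtain B where B: "0 \<le> B" "\<And>x. x \<in> {a..b} \<Longrightarrow> \<bar>g x\<bar> \<le> B"
    by (rule continuous_interval_bounded[OF g]) blast
  have gm[measurable]: "g \<in> borel_measurable (lebesgue_on {a..b})"
    using integrable_continuous_interval_lebesgue[OF g] by auto
  have fm[measurable]: "f \<in> borel_measurable (lebesgue_on {a..b})" using f by auto
  show ?thesis
  proof (rule Bochner_Integration.integrable_bound)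
    show "integrable (lebesgue_on {a..b}) (\<lambda>x. B * f x)" using f by simp
    show "AE x in lebesgue_on {a..b}. norm (f x * g x) \<le> norm (B * f x)"
    proof (rule AE_I2)
      fix x assume "x \<in> space (lebesgue_on {a..b})"
      then have "\<bar>g x\<bar> \<le> \<bar>B\<bar>" using B by simp
      then have "\<bar>f x\<bar> * \<bar>g x\<bar> \<le> \<bar>f x\<bar> * \<bar>B\<bar>" by (intro mult_left_mono) auto
      then show "norm (f x * g x) \<le> norm (B * f x)" by (simp add: abs_mult mult.commute)
    qed
  qed measurable
qed

lemma abs_integral_mult_le:
  fixes f g :: "real \<Rightarrow> real"
  assumes f: "integrable (lebesgue_on {a..b}) f" and g: "continuous_on {a..b} g"
    and B: "\<And>x. x \<in> {a..b} \<Longrightarrow> \<bar>g x\<bar> \<le> B"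
  shows "\<bar>\<integral>x. f x * g x \<partial>lebesgue_on {a..b}\<bar> \<le> B * (\<integral>x. \<bar>f x\<bar> \<partial>lebesgue_on {a..b})"
proof -
  have "\<bar>\<integral>x. f x * g x \<partial>lebesgue_on {a..b}\<bar> \<le> (\<integral>x. \<bar>f x * g x\<bar> \<partial>lebesgue_on {a..b})"
    by (rule integral_abs_bound)
  also have "\<dots> \<le> (\<integral>x. B * \<bar>f x\<bar> \<partial>lebesgue_on {a..b})"
  proof (rule integral_mono)
    show "integrable (lebesgue_on {a..b}) (\<lambda>x. \<bar>f x * g x\<bar>)"
      using integrable_mult_continuous[OF f g] by simp
    show "integrable (lebesgue_on {a..b}) (\<lambda>x. B * \<bar>f x\<bar>)" using f by simp
    show "\<bar>f x * g x\<bar> \<le> B * \<bar>f x\<bar>" if "x \<in> space (lebesgue_on {a..b})" for x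
      using mult_right_mono[OF B[of x], of "\<bar>f x\<bar>"] that by (simp add: abs_mult mult.commute)
  qed
  finally show ?thesis by simp
qed

lemma integral_abs_le_bound:
  fixes f :: "real \<Rightarrow> real"
  assumes "a \<le> b" and f: "integrable (lebesgue_on {a..b}) f"
    and B: "\<And>x. x \<in> {a..b} \<Longrightarrow> \<bar>f x\<bar> \<le> B"
  shows "(\<integral>x. \<bar>f x\<bar> \<partial>lebesgue_on {a..b}) \<le> B * (b - a)"
proof -
  interpret finite_measure "lebesgue_on {a..b}" by (rule finite_measure_interval)
  have "(\<integral>x. \<bar>f x\<bar> \<partial>lebesgue_on {a..b}) \<le> (\<integral>x. B \<partial>lebesgue_on {a..b})"
    using f B by (intro integral_mono) auto
  also have "\<dots> = B * (b - a)"
    using assms(1) measure_interval[of a b] by simp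
  finally show ?thesis .
qed

section \<open>Density of continuous functions in L^1\<close>

lemma dominated_approximation:
  fixes f :: "'a \<Rightarrow> real" and s :: "nat \<Rightarrow> 'a \<Rightarrow> real"
  assumes [measurable]: "f \<in> borel_measurable M" "\<And>n. s n \<in> borel_measurable M" and w: "integrable M w"
    and lim: "AE x in M. (\<lambda>n. s n x) \<longlonglongrightarrow> f x"
    and bd: "\<And>n. AE x in M. \<bar>s n x\<bar> \<le> w x"
    and bf: "AE x in M. \<bar>f x\<bar> \<le> w x"
    and e: "0 < e"
  shows "\<exists>n. (\<integral>x. \<bar>f x - s n x\<bar> \<partial>M) < e"
proof -
  have "(\<lambda>n. \<integral>x. \<bar>f x - s n x\<bar> \<partial>M) \<longlonglongrightarrow> (\<integral>x. 0 \<partial>M)"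
  proof (rule integral_dominated_convergence[where w="\<lambda>x. 2 * w x"])
    show "integrable M (\<lambda>x. 2 * w x)" using w by simp
    show "AE x in M. (\<lambda>n. \<bar>f x - s n x\<bar>) \<longlonglongrightarrow> 0"
      using lim
    proof eventually_elim
      case (elim x)
      then have "(\<lambda>n. f x - s n x) \<longlonglongrightarrow> f x - f x" by (intro tendsto_intros)
      then show ?case using tendsto_rabs_zero by fastforce
    qed
    show "AE x in M. norm \<bar>f x - s n x\<bar> \<le> 2 * w x" for n
      using bd[of n] bf by eventually_elim auto
  qed auto
  then have "eventually (\<lambda>n. (\<integral>x. \<bar>f x - s n x\<bar> \<partial>M) < e) sequentially"
    using e by (auto dest: order_tendstoD)
  then show ?thesis by (auto simp: eventually_sequentially)
qed

text \<open>Clamping at a large height \<open>n\<close> reduces to bounded functions. A bounded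
  measurable function is an almost everywhere limit of continuous ones, by definition of
  \<open>measurable_on\<close>, and clamping these at the same height supplies a constant dominating
  function without spoiling continuity.\<close>

lemma continuous_dense_L1:
  fixes f :: "real \<Rightarrow> real"
  assumes f: "integrable (lebesgue_on {a..b}) f" and e: "0 < e"
  obtains g where "continuous_on UNIV g" "(\<integral>x. \<bar>f x - g x\<bar> \<partial>lebesgue_on {a..b}) < e"
proof -
  let ?L = "lebesgue_on {a..b}"
  interpret finite_measure ?L by (rule finite_measure_interval)
  define cl :: "real \<Rightarrow> real \<Rightarrow> real" where "cl M y = max (- M) (min M y)" for M y
  have [measurable]: "f \<in> borel_measurable ?L" using f by auto
  have clm[measurable]: "cl M \<in> borel_measurable borel" for M unfolding cl_def[abs_def] by measurable
  have "\<exists>n. (\<integral>x. \<bar>f x - cl (real n) (f x)\<bar> \<partial>?L) < e/2"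
  proof (rule dominated_approximation[where w="\<lambda>x. \<bar>f x\<bar>"])
    show "AE x in ?L. (\<lambda>n. cl (real n) (f x)) \<longlonglongrightarrow> f x"
    proof (rule AE_I2)
      fix x
      obtain m where m: "\<bar>f x\<bar> \<le> real m" using real_arch_simple by blast
      have "eventually (\<lambda>n. cl (real n) (f x) = f x) sequentially"
        using eventually_ge_at_top[of m] by eventually_elim (use m in \<open>auto simp: cl_def\<close>)
      then show "(\<lambda>n. cl (real n) (f x)) \<longlonglongrightarrow> f x" by (rule tendsto_eventually)
    qed
  qed (use f e in \<open>auto simp: cl_def\<close>)
  then obtain n where n: "(\<integral>x. \<bar>f x - cl (real n) (f x)\<bar> \<partial>?L) < e/2" by blast
  define h where "h = (\<lambda>x. cl (real n) (f x))"
  have hm[measurable]: "h \<in> borel_measurable ?L" unfolding h_def by measurable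
  have hb: "\<bar>h x\<bar> \<le> real n" for x by (auto simp: h_def cl_def)
  have hi: "integrable ?L h"
    by (rule integrable_const_bound[where B="real n"]) (use hb in auto)
  from hm have "h measurable_on {a..b}" by (simp add: measurable_on_iff_borel_measurable)
  then obtain Z g where Z: "negligible Z" and g: "\<And>k. continuous_on UNIV (g k)"
    and lim: "\<And>x. x \<notin> Z \<Longrightarrow> (\<lambda>k. g k x) \<longlonglongrightarrow> (if x \<in> {a..b} then h x else 0)"
    unfolding measurable_on_def by blast
  have gc: "continuous_on UNIV (\<lambda>x. cl (real n) (g k x))" for k
    unfolding cl_def by (intro continuous_intros g)
  have gm: "(\<lambda>x. cl (real n) (g k x)) \<in> borel_measurable ?L" for k
    using integrable_continuous_interval_lebesgue[OF continuous_on_subset[OF gc], of a b] by auto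
  have "\<exists>k. (\<integral>x. \<bar>h x - cl (real n) (g k x)\<bar> \<partial>?L) < e/2"
  proof (rule dominated_approximation[where w="\<lambda>x. real n"])
    have "AE x in lebesgue. x \<notin> Z"
      by (rule AE_not_in) (use Z in \<open>simp add: negligible_iff_null_sets\<close>)
    then have "AE x in ?L. x \<notin> Z" by (auto simp: AE_restrict_space_iff)
    then show "AE x in ?L. (\<lambda>k. cl (real n) (g k x)) \<longlonglongrightarrow> h x"
      using AE_space
    proof eventually_elim
      case (elim x)
      then have "(\<lambda>k. g k x) \<longlonglongrightarrow> h x" using lim[of x] by simp
      then have "(\<lambda>k. cl (real n) (g k x)) \<longlonglongrightarrow> cl (real n) (h x)"
        unfolding cl_def by (intro tendsto_intros)
      also have "cl (real n) (h x) = h x" using hb[of x] by (auto simp: cl_def)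
      finally show ?case .
    qed
  qed (use e gm hb in \<open>auto simp: cl_def\<close>)
  then obtain k where k: "(\<integral>x. \<bar>h x - cl (real n) (g k x)\<bar> \<partial>?L) < e/2" by blast
  have gi: "integrable ?L (\<lambda>x. cl (real n) (g k x))"
    by (rule integrable_continuous_interval_lebesgue[OF continuous_on_subset[OF gc]]) auto
  have "(\<integral>x. \<bar>f x - cl (real n) (g k x)\<bar> \<partial>?L) \<le> (\<integral>x. \<bar>f x - h x\<bar> + \<bar>h x - cl (real n) (g k x)\<bar> \<partial>?L)"
    using f gi hi by (intro integral_mono) auto
  also have "\<dots> = (\<integral>x. \<bar>f x - h x\<bar> \<partial>?L) + (\<integral>x. \<bar>h x - cl (real n) (g k x)\<bar> \<partial>?L)"
    using f gi hi by (intro Bochner_Integration.integral_add) auto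
  also have "\<dots> < e" using n k by (simp add: h_def)
  finally show ?thesis using that[OF gc] by blast
qed

section \<open>Primitives of integrable functions and integration by parts\<close>

lemma primitive_continuous:
  fixes h :: "real \<Rightarrow> real"
  assumes "integrable (lebesgue_on {a..b}) h"
  shows "h integrable_on {a..b}" "continuous_on {a..b} (\<lambda>x. integral {a..x} h)"
    "integral\<^sup>L (lebesgue_on {a..b}) h = integral {a..b} h"
proof -
  have "h absolutely_integrable_on {a..b}" using assms by (simp add: absolutely_integrable_iff)
  then show *: "h integrable_on {a..b}" using absolutely_integrable_on_def by blast
  show "continuous_on {a..b} (\<lambda>x. integral {a..x} h)" by (rule indefinite_integral_continuous_1[OF *])
  show "integral\<^sup>L (lebesgue_on {a..b}) h = integral {a..b} h"
    by (rule lebesgue_integral_eq_integral[OF assms]) simp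
qed

lemma integrable_lebesgue_subinterval:
  fixes h :: "real \<Rightarrow> real"
  assumes "integrable (lebesgue_on {a..b}) h" "{c..e} \<subseteq> {a..b}"
  shows "integrable (lebesgue_on {c..e}) h"
  using absolutely_integrable_on_subinterval[OF _ assms(2), of h] assms(1) by (simp add: absolutely_integrable_iff)

lemma primitive_bound:
  fixes h :: "real \<Rightarrow> real"
  assumes h: "integrable (lebesgue_on {a..b}) h" and x: "x \<in> {a..b}"
  shows "\<bar>integral {a..x} h\<bar> \<le> (\<integral>x. \<bar>h x\<bar> \<partial>lebesgue_on {a..b})"
proof -
  have hx: "integrable (lebesgue_on {a..x}) h" using integrable_lebesgue_subinterval[OF h] x by auto
  have "\<bar>integral {a..x} h\<bar> \<le> (\<integral>y. \<bar>h y\<bar> \<partial>lebesgue_on {a..x})"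
    using primitive_continuous(3)[OF hx] integral_abs_bound[of "lebesgue_on {a..x}" h] by simp
  also have "\<dots> = integral {a..x} (\<lambda>y. \<bar>h y\<bar>)"
    using hx by (intro primitive_continuous(3)) auto
  also have "\<dots> \<le> integral {a..b} (\<lambda>y. \<bar>h y\<bar>)"
    using h hx x by (intro integral_subset_le primitive_continuous(1)) auto
  also have "\<dots> = (\<integral>x. \<bar>h x\<bar> \<partial>lebesgue_on {a..b})"
    using h by (intro primitive_continuous(3)[symmetric]) auto
  finally show ?thesis .
qed

text \<open>Both sides are continuous in \<open>h\<close> for the \<open>L\<^sup>1\<close> norm, so continuous \<open>h\<close> suffices.\<close>

lemma integration_by_parts_primitive:
  fixes h \<theta> \<theta>' :: "real \<Rightarrow> real"
  assumes ab: "a \<le> b" and h: "integrable (lebesgue_on {a..b}) h"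
    and der: "\<And>x. x \<in> {a..b} \<Longrightarrow> (\<theta> has_real_derivative \<theta>' x) (at x within {a..b})"
    and cont: "continuous_on {a..b} \<theta>'"
  shows "(\<integral>x. h x * \<theta> x \<partial>lebesgue_on {a..b}) =
    integral {a..b} h * \<theta> b - (\<integral>x. integral {a..x} h * \<theta>' x \<partial>lebesgue_on {a..b})"
proof -
  let ?L = "lebesgue_on {a..b}"
  have ct: "continuous_on {a..b} \<theta>"
    using der by (intro DERIV_continuous_on) auto
  obtain B where B0: "0 \<le> B" and B: "\<And>x. x \<in> {a..b} \<Longrightarrow> \<bar>\<theta> x\<bar> \<le> B"
    by (rule continuous_interval_bounded[OF ct]) blast
  obtain B' where B'0: "0 \<le> B'" and B': "\<And>x. x \<in> {a..b} \<Longrightarrow> \<bar>\<theta>' x\<bar> \<le> B'"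
    by (rule continuous_interval_bounded[OF cont]) blast
  \<comment> \<open>\<open>\<Phi> h\<close> is the defect of the formula. It is linear in
    \<open>h\<close>, bounded by \<open>K\<close> times the L^1 norm, and zero for continuous
    \<open>h\<close>. In \<open>K\<close> the sup of \<theta> occurs twice, for the integral and for
    the boundary term, and the sup of \<theta>' is multiplied by the length.\<close>
  define \<Phi> where "\<Phi> h = (\<integral>x. h x * \<theta> x \<partial>?L) - (integral {a..b} h * \<theta> b - (\<integral>x. integral {a..x} h * \<theta>' x \<partial>?L))" for h
  define K where "K = B + B + B' * (b - a)"
  have bound: "\<bar>\<Phi> h\<bar> \<le> K * (\<integral>x. \<bar>h x\<bar> \<partial>?L)" if h: "integrable ?L h" for h
  proof -
    let ?n = "\<integral>x. \<bar>h x\<bar> \<partial>?L"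
    have 1: "\<bar>\<integral>x. h x * \<theta> x \<partial>?L\<bar> \<le> B * ?n" by (rule abs_integral_mult_le[OF h ct B])
    have 2: "\<bar>integral {a..b} h * \<theta> b\<bar> \<le> ?n * B"
      unfolding abs_mult using primitive_bound[OF h, of b] B[of b] ab by (intro mult_mono) auto
    have "\<bar>\<integral>x. integral {a..x} h * \<theta>' x \<partial>?L\<bar> \<le> B' * (\<integral>x. \<bar>integral {a..x} h\<bar> \<partial>?L)"
      by (rule abs_integral_mult_le[OF integrable_continuous_interval_lebesgue[OF primitive_continuous(2)[OF h]] cont B'])
    also have "\<dots> \<le> B' * (?n * (b - a))"
      by (intro mult_left_mono integral_abs_le_bound ab primitive_bound[OF h] B'0
           integrable_continuous_interval_lebesgue primitive_continuous(2)[OF h])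
    finally show ?thesis using 1 2 unfolding \<Phi>_def K_def by (simp add: algebra_simps)
  qed
  have zero: "\<Phi> g = 0" if g: "continuous_on {a..b} g" for g
  proof -
    let ?G = "\<lambda>x. integral {a..x} g"
    have G: "(?G has_vector_derivative g x) (at x within {a..b})" if "x \<in> {a..b}" for x
      by (rule integral_has_vector_derivative[OF g that])
    have cG: "continuous_on {a..b} ?G"
      using primitive_continuous(2)[OF integrable_continuous_interval_lebesgue[OF g]] .
    have 1: "((\<lambda>x. g x * \<theta> x + ?G x * \<theta>' x) has_integral (?G b * \<theta> b - ?G a * \<theta> a)) {a..b}"
    proof (rule fundamental_theorem_of_calculus[OF ab])
      fix x assume x: "x \<in> {a..b}"
      show "((\<lambda>x. ?G x * \<theta> x) has_vector_derivative g x * \<theta> x + ?G x * \<theta>' x) (at x within {a..b})"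
        using G[OF x] der[OF x]
        unfolding has_real_derivative_iff_has_vector_derivative[symmetric]
        by (auto intro!: derivative_eq_intros)
    qed
    have i: "integrable ?L (\<lambda>x. g x * \<theta> x)" "integrable ?L (\<lambda>x. ?G x * \<theta>' x)"
      by (intro integrable_continuous_interval_lebesgue continuous_intros g ct cont cG)+
    have "integral {a..b} (\<lambda>x. g x * \<theta> x) + integral {a..b} (\<lambda>x. ?G x * \<theta>' x) = ?G b * \<theta> b"
      using integral_unique[OF 1] Henstock_Kurzweil_Integration.integral_add[OF i[THEN primitive_continuous(1)]] by simp
    then show ?thesis unfolding \<Phi>_def using i[THEN primitive_continuous(3)] by simp
  qed
  have "\<bar>\<Phi> h\<bar> \<le> 0 + e" if e: "0 < e" for e
  proof -
    have K0: "0 \<le> K" unfolding K_def using B0 B'0 ab by auto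
    obtain g where g: "continuous_on UNIV g" "(\<integral>x. \<bar>h x - g x\<bar> \<partial>?L) < e / (K + 1)"
      using continuous_dense_L1[OF h, of "e / (K+1)"] e K0 by auto
    have g': "continuous_on {a..b} g" using g(1) continuous_on_subset by blast
    note gi = integrable_continuous_interval_lebesgue[OF g']
    have ix: "integral {a..x} (\<lambda>x. h x - g x) = integral {a..x} h - integral {a..x} g" if "x \<in> {a..b}" for x
    proof (rule Henstock_Kurzweil_Integration.integral_diff)
      show "h integrable_on {a..x}" "g integrable_on {a..x}"
        using integrable_lebesgue_subinterval[OF h, of a x] integrable_lebesgue_subinterval[OF gi, of a x] that
        by (auto intro: primitive_continuous(1))
    qed
    have "(\<integral>x. integral {a..x} (\<lambda>x. h x - g x) * \<theta>' x \<partial>?L) = (\<integral>x. integral {a..x} h * \<theta>' x - integral {a..x} g * \<theta>' x \<partial>?L)"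
      by (rule Bochner_Integration.integral_cong) (auto simp: ix algebra_simps)
    also have "\<dots> = (\<integral>x. integral {a..x} h * \<theta>' x \<partial>?L) - (\<integral>x. integral {a..x} g * \<theta>' x \<partial>?L)"
      by (intro Bochner_Integration.integral_diff integrable_mult_continuous[OF _ cont]
          integrable_continuous_interval_lebesgue primitive_continuous(2) h gi)
    finally have "\<Phi> (\<lambda>x. h x - g x) = \<Phi> h - \<Phi> g"
      unfolding \<Phi>_def using ab ix[of b]
        Bochner_Integration.integral_diff[OF integrable_mult_continuous[OF h ct] integrable_mult_continuous[OF gi ct]]
      by (simp add: left_diff_distrib)
    then have "\<bar>\<Phi> h\<bar> \<le> K * (\<integral>x. \<bar>h x - g x\<bar> \<partial>?L)"
      using bound[of "\<lambda>x. h x - g x"] zero[OF g'] h gi by simp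
    also have "\<dots> \<le> K * (e / (K+1))" using g(2) K0 by (intro mult_left_mono) auto
    also have "\<dots> \<le> e" using K0 e by (simp add: field_simps)
    finally show ?thesis by simp
  qed
  then have "\<bar>\<Phi> h\<bar> \<le> 0" by (rule field_le_epsilon)
  then show ?thesis unfolding \<Phi>_def by simp
qed

section \<open>Weak derivatives\<close>

lemma real_polynomial_has_derivative:
  assumes "real_polynomial_function p"
  obtains p' where "real_polynomial_function p'" "\<And>x. (p has_real_derivative p' x) (at x)"
  using has_real_derivative_polynomial_function[OF assms] by blast

lemma continuous_on_real_polynomial: "real_polynomial_function p \<Longrightarrow> continuous_on S p"
  using continuous_on_polymonial_function[of p S] by (simp add: real_polynomial_function_eq)

text \<open>Testing with the smoothed sign \<open>g / (|g| + \<epsilon>)\<close> of a continuous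
  approximation \<open>g\<close> of \<open>w\<close> recovers the L^1 norm of \<open>w\<close> up to
  a multiple of \<epsilon>, and by Stone-Weierstrass this sign may be replaced by a polynomial.
  Polynomials serve as test functions because they are uniformly dense and closed under
  differentiation.\<close>

lemma fundamental_lemma:
  fixes w :: "real \<Rightarrow> real"
  assumes ab: "a \<le> b" and w: "integrable (lebesgue_on {a..b}) w"
    and orth: "\<And>p. real_polynomial_function p \<Longrightarrow> (\<integral>x. w x * p x \<partial>lebesgue_on {a..b}) = 0"
  shows "AE x in lebesgue_on {a..b}. w x = 0"
proof -
  let ?L = "lebesgue_on {a..b}"
  let ?n = "\<lambda>f. \<integral>x. \<bar>f x\<bar> \<partial>?L"
  interpret finite_measure ?L by (rule finite_measure_interval)
  define K where "K = 2 + (b - a) + ?n w"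
  have n0: "0 \<le> ?n w" by simp
  have "?n w \<le> 0 + e" if e: "0 < e" for e
  proof -
    define \<epsilon> where "\<epsilon> = e / K"
    have K: "0 < K" unfolding K_def using n0 ab by linarith
    have \<epsilon>: "0 < \<epsilon>" using e K by (simp add: \<epsilon>_def)
    obtain g where g: "continuous_on UNIV g" "?n (\<lambda>x. w x - g x) < \<epsilon>"
      using continuous_dense_L1[OF w \<epsilon>] by blast
    have g': "continuous_on {a..b} g" using g(1) continuous_on_subset by blast
    note gi = integrable_continuous_interval_lebesgue[OF g']
    define \<theta> where "\<theta> x = g x / (\<bar>g x\<bar> + \<epsilon>)" for x
    have ct: "continuous_on {a..b} \<theta>"
      unfolding \<theta>_def using \<epsilon> by (intro continuous_intros g') (auto simp: add_nonneg_eq_0_iff)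
    have t1: "\<bar>\<theta> x\<bar> \<le> 1" for x
    proof -
      have "\<bar>g x\<bar> + \<epsilon> > 0" using \<epsilon> by (simp add: add_nonneg_pos)
      then show ?thesis using \<epsilon> by (simp add: \<theta>_def abs_divide divide_le_eq_1)
    qed
    have t2: "\<bar>g x\<bar> \<le> g x * \<theta> x + \<epsilon>" for x
    proof -
      have p: "\<bar>g x\<bar> + \<epsilon> > 0" using \<epsilon> by (simp add: add_nonneg_pos)
      have "\<bar>g x\<bar> - g x * \<theta> x = \<bar>g x\<bar> * \<epsilon> / (\<bar>g x\<bar> + \<epsilon>)"
        using p by (simp add: \<theta>_def field_simps)
      also have "\<dots> \<le> \<epsilon>" using p \<epsilon> by (simp add: field_simps)
      finally show ?thesis by simp
    qed
    obtain q where q: "real_polynomial_function q" "\<And>x. x \<in> {a..b} \<Longrightarrow> \<bar>\<theta> x - q x\<bar> < \<epsilon>"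
      using Stone_Weierstrass_real_polynomial_function[OF compact_Icc ct \<epsilon>] by blast
    have cq: "continuous_on {a..b} q" by (rule continuous_on_real_polynomial[OF q(1)])
    have "(\<integral>x. w x * \<theta> x \<partial>?L) = (\<integral>x. w x * (\<theta> x - q x) + w x * q x \<partial>?L)" by (simp add: algebra_simps)
    also have "\<dots> = (\<integral>x. w x * (\<theta> x - q x) \<partial>?L) + (\<integral>x. w x * q x \<partial>?L)"
      by (intro Bochner_Integration.integral_add integrable_mult_continuous w continuous_intros ct cq)
    also have "\<dots> \<le> \<epsilon> * ?n w"
      using abs_integral_mult_le[OF w continuous_on_diff[OF ct cq], of \<epsilon>] q(2) orth[OF q(1)]
      by (auto simp: less_imp_le)
    finally have A: "(\<integral>x. w x * \<theta> x \<partial>?L) \<le> \<epsilon> * ?n w" .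
    have "?n w \<le> (\<integral>x. \<bar>w x - g x\<bar> + \<bar>w x - g x\<bar> + \<epsilon> + w x * \<theta> x \<partial>?L)"
    proof (rule integral_mono)
      show "integrable ?L (\<lambda>x. \<bar>w x - g x\<bar> + \<bar>w x - g x\<bar> + \<epsilon> + w x * \<theta> x)"
        using w gi integrable_mult_continuous[OF w ct] by auto
      fix x
      have "(g x - w x) * \<theta> x \<le> \<bar>g x - w x\<bar> * \<bar>\<theta> x\<bar>" by (simp flip: abs_mult)
      also have "\<dots> \<le> \<bar>g x - w x\<bar> * 1" by (intro mult_left_mono t1) auto
      finally have "g x * \<theta> x \<le> w x * \<theta> x + \<bar>w x - g x\<bar>" by (simp add: algebra_simps)
      then show "\<bar>w x\<bar> \<le> \<bar>w x - g x\<bar> + \<bar>w x - g x\<bar> + \<epsilon> + w x * \<theta> x"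
        using t2[of x] by linarith
    qed (use w in auto)
    also have "\<dots> = 2 * ?n (\<lambda>x. w x - g x) + \<epsilon> * (b - a) + (\<integral>x. w x * \<theta> x \<partial>?L)"
      using w gi integrable_mult_continuous[OF w ct] measure_interval[of a b] ab by simp
    also have "\<dots> \<le> 2 * \<epsilon> + \<epsilon> * (b - a) + \<epsilon> * ?n w" using g(2) A by linarith
    also have "\<dots> = \<epsilon> * K" by (simp add: K_def algebra_simps)
    also have "\<dots> = e" using K by (simp add: \<epsilon>_def)
    finally show ?thesis by simp
  qed
  then have "?n w \<le> 0" by (rule field_le_epsilon)
  then have "?n w = 0" using n0 by linarith
  then show ?thesis using integral_nonneg_eq_0_iff_AE[of ?L "\<lambda>x. \<bar>w x\<bar>"] w by simp
qed

text \<open>Left of the support the primitive is 0 because nothing has been integrated yet; right of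
  the support its value is the full integral, which is 0 by assumption.\<close>

lemma test_function_primitive:
  fixes k :: "real \<Rightarrow> real"
  assumes k: "continuous_on UNIV k" and K: "a < a'" "b' < b" and supp: "\<And>x. x \<notin> {a'..b'} \<Longrightarrow> k x = 0"
    and mean: "integral {a..b} k = 0"
  shows "test_function a b (\<lambda>x. integral {a..x} k) k"
proof -
  have ki: "k integrable_on {c..e}" for c e
    using continuous_on_subset[OF k] by (intro integrable_continuous_interval) auto
  have low: "integral {a..x} k = 0" if "x < a'" for x
  proof -
    have "integral {a..x} k = integral {a..x} (\<lambda>_. 0)"
      using that supp by (intro integral_cong) auto
    then show ?thesis by simp
  qed
  have der: "((\<lambda>x. integral {a..x} k) has_real_derivative k x) (at x)" for x
  proof (cases "x < a'")
    case True
    \<comment> \<open>For x below \<open>a\<close> the interval \<open>{a..x}\<close> is empty, so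
      the fundamental theorem does not apply there; local constancy covers this case.\<close>
    have "((\<lambda>x. 0) has_real_derivative k x) (at x)" using supp[of x] True by simp
    then show ?thesis
      by (rule has_field_derivative_transform_within_open[of _ _ _ "{..<a'}"]) (use True low in auto)
  next
    case False
    then have x: "x \<in> {a<..<x+1}" using K by auto
    have "((\<lambda>x. integral {a..x} k) has_real_derivative k x) (at x within {a..x+1})"
      using continuous_on_subset[OF k] x by (intro integral_has_real_derivative) auto
    then show ?thesis using x by (simp add: at_within_Icc_at)
  qed
  have high: "integral {a..x} k = 0" if "b' < x" for x
  proof (cases "x < a")
    case True
    then show ?thesis by simp
  next
    case False
    have z: "integral {c..e} k = 0" if "b' < c" for c e
    proof -
      have "integral {c..e} k = integral {c..e} (\<lambda>_. 0)"
        using that supp by (intro integral_cong) auto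
      then show ?thesis by simp
    qed
    show ?thesis
    proof (cases "x \<le> b")
      case True
      have "integral {a..x} k + integral {x..b} k = integral {a..b} k"
        using True False by (intro Henstock_Kurzweil_Integration.integral_combine ki) auto
      then show ?thesis using z[OF that] mean by simp
    next
      case False
      show ?thesis
      proof (cases "a \<le> b")
        case True
        have "integral {a..b} k + integral {b..x} k = integral {a..x} k"
          using True False by (intro Henstock_Kurzweil_Integration.integral_combine ki) auto
        then show ?thesis using z[OF K(2)] mean by simp
      next
        case False
        then show ?thesis using z[of a x] K by simp
      qed
    qed
  qed
  show ?thesis
    unfolding test_function_def
  proof (intro conjI allI exI[of _ "{a'..b'}"] impI)
    show "continuous_on UNIV k" by (rule k)
    show "{a'..b'} \<subseteq> {a<..<b}" using K by auto
    show "integral {a..x} k = 0" if "x \<notin> {a'..b'}" for x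
      using that low[of x] high[of x] by force
  qed (use der in auto)
qed

text \<open>The lemma of du Bois-Reymond. The difference \<open>u\<close> of \<open>f\<close> and
  the primitive of \<open>g\<close> is orthogonal to every continuous function of mean zero
  supported inside the interval. Subtracting from \<open>p * cut j\<close> a multiple of a fixed
  bump \<open>k0\<close> of integral 1 produces such functions, so \<open>u - c\<close> is
  orthogonal to \<open>p * cut j\<close> for \<open>c\<close> the integral of \<open>u * k0\<close>;
  dominated convergence removes the cutoff.\<close>

lemma weak_derivative_primitive:
  assumes ab: "a < b" and weak: "has_weak_derivative a b f g"
  obtains c where "AE x in lebesgue_on {a..b}. f x = c + integral {a..x} g"
proof -
  let ?L = "lebesgue_on {a..b}"
  interpret finite_measure ?L by (rule finite_measure_interval)
  have f: "integrable ?L f" and g: "integrable ?L g"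
    using weak by (auto simp: has_weak_derivative_def absolutely_integrable_iff)
  define G where "G x = integral {a..x} g" for x
  have cG: "continuous_on {a..b} G" unfolding G_def by (rule primitive_continuous(2)[OF g])
  define u where "u x = f x - G x" for x
  have u: "integrable ?L u"
    unfolding u_def using f integrable_continuous_interval_lebesgue[OF cG] by simp
  have *: "(\<integral>x. u x * k x \<partial>?L) = 0"
    if k: "continuous_on UNIV k" "a < a'" "b' < b" "\<And>x. x \<notin> {a'..b'} \<Longrightarrow> k x = 0"
      and m: "(\<integral>x. k x \<partial>?L) = 0" for k a' b'
  proof -
    have k': "continuous_on {a..b} k" using k(1) continuous_on_subset by blast
    note ki = integrable_continuous_interval_lebesgue[OF k']
    define \<zeta> where "\<zeta> x = integral {a..x} k" for x
    have m': "integral {a..b} k = 0" using m primitive_continuous(3)[OF ki] by simp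
    have tf: "test_function a b \<zeta> k"
      unfolding \<zeta>_def by (rule test_function_primitive[OF k m'])
    have "(\<integral>x. g x * \<zeta> x \<partial>?L) = G b * \<zeta> b - (\<integral>x. G x * k x \<partial>?L)"
      unfolding G_def
    proof (rule integration_by_parts_primitive)
      show "(\<zeta> has_real_derivative k x) (at x within {a..b})" for x
        using tf by (auto simp: test_function_def intro: has_field_derivative_at_within)
    qed (use ab g k' in auto)
    moreover have "(\<integral>x. f x * k x \<partial>?L) = - (\<integral>x. g x * \<zeta> x \<partial>?L)"
      using weak tf unfolding has_weak_derivative_def LINT_eq by blast
    moreover have "\<zeta> b = 0" using m' by (simp add: \<zeta>_def)
    moreover have "(\<integral>x. u x * k x \<partial>?L) = (\<integral>x. f x * k x \<partial>?L) - (\<integral>x. G x * k x \<partial>?L)"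
      unfolding u_def left_diff_distrib
      by (intro Bochner_Integration.integral_diff integrable_mult_continuous f k'
          integrable_continuous_interval_lebesgue[OF cG])
    ultimately show ?thesis by simp
  qed
  \<comment> \<open>A piecewise linear cutoff: for j > 0 it is 0 up to distance 1 / j from the
    endpoints and 1 from distance 2 / j on; \<open>cut 0\<close> is identically 0.\<close>
  define cut where "cut j x = max 0 (min 1 (real j * min (x - a) (b - x) - 1))" for j x
  have cutc: "continuous_on S (cut j)" for S j unfolding cut_def by (intro continuous_intros)
  have cut1: "\<bar>cut j x\<bar> \<le> 1" for j x by (auto simp: cut_def)
  have cut0: "cut j x = 0" if "j \<le> m" "0 < m" "x \<notin> {a + 1 / real m .. b - 1 / real m}" for j m x
  proof -
    have "min (x - a) (b - x) < 1 / real m" using that by auto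
    moreover have "real j * y - 1 \<le> 0" if y: "y < 1 / real m" for y :: real
    proof (cases "y \<le> 0")
      case True
      then show ?thesis by (smt (verit) mult_nonneg_nonpos of_nat_0_le_iff)
    next
      case False
      have "real j * y \<le> real m * y" using \<open>j \<le> m\<close> False by (intro mult_right_mono) auto
      also have "\<dots> < 1" using y \<open>0 < m\<close> by (simp add: field_simps)
      finally show ?thesis by simp
    qed
    ultimately have "real j * min (x - a) (b - x) - 1 \<le> 0" by blast
    then show ?thesis unfolding cut_def by linarith
  qed
  have cutlim: "AE x in ?L. (\<lambda>j. cut j x) \<longlonglongrightarrow> 1"
  proof -
    have "AE x in lebesgue. x \<notin> {a, b}"
      by (rule AE_not_in) (simp flip: negligible_iff_null_sets)
    then have "AE x in ?L. x \<notin> {a, b}" by (auto simp: AE_restrict_space_iff)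
    then show ?thesis using AE_space
    proof eventually_elim
      case (elim x)
      define y where "y = min (x - a) (b - x)"
      have y: "0 < y" using elim by (auto simp: y_def)
      obtain m where m: "2 / y \<le> real m" using real_arch_simple by blast
      have "eventually (\<lambda>j. cut j x = 1) sequentially"
        using eventually_ge_at_top[of m]
      proof eventually_elim
        case (elim j)
        have "2 \<le> real m * y" using m y by (simp add: field_simps)
        also have "\<dots> \<le> real j * y" using elim y by (intro mult_right_mono) auto
        finally show ?case by (simp add: cut_def flip: y_def)
      qed
      then show ?case by (rule tendsto_eventually)
    qed
  qed
  have lim: "(\<lambda>j. \<integral>x. v x * cut j x \<partial>?L) \<longlonglongrightarrow> (\<integral>x. v x \<partial>?L)" if v: "integrable ?L v" for v
  proof (rule integral_dominated_convergence[where w="\<lambda>x. \<bar>v x\<bar>"])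
    show "AE x in ?L. (\<lambda>j. v x * cut j x) \<longlonglongrightarrow> v x"
      using cutlim
    proof eventually_elim
      case (elim x)
      show ?case using tendsto_mult_left[OF elim, of "v x"] by simp
    qed
    show "AE x in ?L. norm (v x * cut j x) \<le> \<bar>v x\<bar>" for j
      using cut1 by (auto simp: abs_mult intro!: mult_left_le)
    show "(\<lambda>x. v x * cut j x) \<in> borel_measurable ?L" for j
      using integrable_mult_continuous[OF v cutc] by auto
  qed (use v in auto)
  \<comment> \<open>The integrals of the cutoffs tend to the positive length of the interval, so one
    of them can be normalised to the bump \<open>k0\<close>.\<close>
  have "(\<lambda>j. \<integral>x. 1 * cut j x \<partial>?L) \<longlonglongrightarrow> (\<integral>x. 1 \<partial>?L)" by (rule lim) simp
  moreover have "(\<integral>x. 1 \<partial>?L) = b - a" using measure_interval[of a b] ab by simp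
  ultimately have "eventually (\<lambda>j. 0 < (\<integral>x. cut j x \<partial>?L)) sequentially"
    using order_tendstoD(1)[of "\<lambda>j. \<integral>x. 1 * cut j x \<partial>?L" "b - a" sequentially 0] ab by simp
  then obtain J where J: "0 < (\<integral>x. cut J x \<partial>?L)" by (auto simp: eventually_sequentially)
  define k0 where "k0 x = cut J x / (\<integral>x. cut J x \<partial>?L)" for x
  have k0c: "continuous_on S k0" for S unfolding k0_def using J by (intro continuous_intros cutc) auto
  have k0i: "(\<integral>x. k0 x \<partial>?L) = 1" unfolding k0_def using J by simp
  define c where "c = (\<integral>x. u x * k0 x \<partial>?L)"
  have orth: "(\<integral>x. (u x - c) * p x \<partial>?L) = 0" if "real_polynomial_function p" for p
  proof -
    have pc: "continuous_on S p" for S by (rule continuous_on_real_polynomial[OF that])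
    have "(\<integral>x. ((u x - c) * p x) * cut j x \<partial>?L) = 0" for j
    proof -
      define I where "I = (\<integral>x. p x * cut j x \<partial>?L)"
      define k where "k x = p x * cut j x - I * k0 x" for x
      have pj: "continuous_on {a..b} (\<lambda>x. p x * cut j x)" by (intro continuous_intros pc cutc)
      note i1 = integrable_continuous_interval_lebesgue[OF pj] 
      have i2: "integrable ?L (\<lambda>x. I * k0 x)"
        by (intro integrable_continuous_interval_lebesgue continuous_intros k0c)
      have mk: "(\<integral>x. k x \<partial>?L) = 0"
        unfolding k_def using Bochner_Integration.integral_diff[OF i1 i2] k0i by (simp add: I_def)
      \<comment> \<open>One index for which the supports of \<open>cut j\<close> and of
        \<open>k0\<close> lie in the same compact interval; the 1 keeps the reciprocal
        positive.\<close>
      define m where "m = max 1 (max j J)"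
      have "(\<integral>x. u x * k x \<partial>?L) = 0"
      proof (rule *[of k "a + 1 / real m" "b - 1 / real m"])
        show "continuous_on UNIV k" unfolding k_def by (intro continuous_intros pc cutc k0c)
        show "k x = 0" if "x \<notin> {a + 1 / real m .. b - 1 / real m}" for x
          using cut0[of j m x] cut0[of J m x] that by (simp add: k_def k0_def m_def)
        show "a < a + 1 / real m" "b - 1 / real m < b" by (auto simp: m_def)
      qed (rule mk)
      moreover have "(\<integral>x. u x * k x \<partial>?L) = (\<integral>x. u x * (p x * cut j x) \<partial>?L) - I * c"
      proof -
        have "(\<integral>x. u x * k x \<partial>?L) = (\<integral>x. u x * (p x * cut j x) - I * (u x * k0 x) \<partial>?L)"
          by (rule Bochner_Integration.integral_cong) (auto simp: k_def algebra_simps)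
        also have "\<dots> = (\<integral>x. u x * (p x * cut j x) \<partial>?L) - (\<integral>x. I * (u x * k0 x) \<partial>?L)"
          by (intro Bochner_Integration.integral_diff integrable_mult_right integrable_mult_continuous u pj k0c)
        finally show ?thesis by (simp add: c_def)
      qed
      moreover have "(\<integral>x. ((u x - c) * p x) * cut j x \<partial>?L) = (\<integral>x. u x * (p x * cut j x) \<partial>?L) - c * I"
      proof -
        have "(\<integral>x. ((u x - c) * p x) * cut j x \<partial>?L) = (\<integral>x. u x * (p x * cut j x) - c * (p x * cut j x) \<partial>?L)"
          by (rule Bochner_Integration.integral_cong) (auto simp: algebra_simps)
        also have "\<dots> = (\<integral>x. u x * (p x * cut j x) \<partial>?L) - (\<integral>x. c * (p x * cut j x) \<partial>?L)"
          by (intro Bochner_Integration.integral_diff integrable_mult_right integrable_mult_continuous[OF u pj] i1)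
        finally show ?thesis by (simp add: I_def)
      qed
      ultimately show ?thesis by simp
    qed
    moreover have "integrable ?L (\<lambda>x. (u x - c) * p x)"
      using u by (intro integrable_mult_continuous pc) auto
    ultimately have "(\<lambda>j. 0) \<longlonglongrightarrow> (\<integral>x. (u x - c) * p x \<partial>?L)"
      using lim[of "\<lambda>x. (u x - c) * p x"] by simp
    then show ?thesis by (simp add: LIMSEQ_const_iff)
  qed
  have "AE x in ?L. u x - c = 0"
    using ab u by (intro fundamental_lemma orth) auto
  then have "AE x in ?L. f x = c + integral {a..x} g"
    by eventually_elim (simp add: u_def G_def)
  then show ?thesis by (rule that)
qed

lemma continuous_ae_eq_imp_eq:
  fixes f g :: "real \<Rightarrow> real"
  assumes ab: "a < b" and f: "continuous_on {a..b} f" and g: "continuous_on {a..b} g"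
    and eq: "AE x in lebesgue_on {a..b}. f x = g x" and x: "x \<in> {a..b}"
  shows "f x = g x"
proof -
  have c: "continuous_on {a..b} (\<lambda>x. \<bar>f x - g x\<bar>)" by (intro continuous_intros f g)
  have "integral {a..b} (\<lambda>x. \<bar>f x - g x\<bar>) = (\<integral>x. \<bar>f x - g x\<bar> \<partial>lebesgue_on {a..b})"
    by (rule primitive_continuous(3)[OF integrable_continuous_interval_lebesgue[OF c], symmetric])
  also have "\<dots> = 0" using eq by (intro integral_eq_zero_AE) (auto elim: eventually_mono)
  finally have "\<forall>x\<in>{a..b}. \<bar>f x - g x\<bar> = 0"
    using integral_eq_0_iff[OF c ab] by auto
  then show ?thesis using x by auto
qed

text \<open>Evaluates the choice in \<open>continuous_version\<close>: continuous functions that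
  agree almost everywhere on a nondegenerate interval agree at every point, the ends
  included.\<close>

lemma continuous_version_eq:
  assumes ab: "a < b" and g: "continuous_on {a..b} g" and eq: "AE x in lebesgue_on {a..b}. f x = g x"
    and x: "x \<in> {a..b}"
  shows "continuous_version a b f x = g x"
proof -
  let ?h = "continuous_version a b f"
  have "continuous_on {a..b} ?h \<and> ae_eq_on a b ?h f"
    unfolding continuous_version_def
    by (rule someI[of _ g]) (use g eq in \<open>auto simp: ae_eq_on_iff elim: eventually_mono\<close>)
  then have "continuous_on {a..b} ?h" "AE x in lebesgue_on {a..b}. ?h x = f x"
    by (auto simp: ae_eq_on_iff)
  moreover have "AE x in lebesgue_on {a..b}. ?h x = g x"
    using calculation(2) eq by eventually_elim simp
  ultimately show ?thesis using continuous_ae_eq_imp_eq[OF ab _ g] x by blast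
qed

text \<open>Both primitives represent \<open>f\<close> up to a constant, and at the left end the
  constants agree; hence the primitive of \<open>g - h\<close> vanishes identically. Integration by
  parts against polynomials turns this into the hypothesis of
  \<open>fundamental_lemma\<close>.\<close>

lemma weak_derivative_unique:
  assumes ab: "a < b" and 1: "has_weak_derivative a b f g" and 2: "has_weak_derivative a b f h"
  shows "AE x in lebesgue_on {a..b}. g x = h x"
proof -
  let ?L = "lebesgue_on {a..b}"
  have g: "integrable ?L g" and h: "integrable ?L h"
    using 1 2 by (auto simp: has_weak_derivative_def absolutely_integrable_iff)
  obtain c where c: "AE x in ?L. f x = c + integral {a..x} g" by (rule weak_derivative_primitive[OF ab 1])
  obtain e where e: "AE x in ?L. f x = e + integral {a..x} h" by (rule weak_derivative_primitive[OF ab 2])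
  have eq: "c + integral {a..x} g = e + integral {a..x} h" if "x \<in> {a..b}" for x
  proof (rule continuous_ae_eq_imp_eq[OF ab _ _ _ that])
    show "AE x in ?L. c + integral {a..x} g = e + integral {a..x} h"
      using c e by eventually_elim simp
  qed (intro continuous_intros primitive_continuous(2) g h)+
  have ce: "c = e" using eq[of a] ab by simp
  have zero: "integral {a..x} (\<lambda>x. g x - h x) = 0" if x: "x \<in> {a..b}" for x
  proof -
    have "g integrable_on {a..x}" "h integrable_on {a..x}"
      using integrable_lebesgue_subinterval[OF g, of a x] integrable_lebesgue_subinterval[OF h, of a x] x
      by (auto intro: primitive_continuous(1))
    then show ?thesis using eq[OF x] ce by (simp add: Henstock_Kurzweil_Integration.integral_diff)
  qed
  have "AE x in ?L. g x - h x = 0"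
  proof (rule fundamental_lemma)
    fix p :: "real \<Rightarrow> real" assume "real_polynomial_function p"
    then obtain p' where p': "real_polynomial_function p'" "\<And>x. (p has_real_derivative p' x) (at x)"
      using real_polynomial_has_derivative by blast
    have "(\<integral>x. (g x - h x) * p x \<partial>?L) = integral {a..b} (\<lambda>x. g x - h x) * p b -
        (\<integral>x. integral {a..x} (\<lambda>x. g x - h x) * p' x \<partial>?L)"
      using ab g h p' by (intro integration_by_parts_primitive)
        (auto intro: has_field_derivative_at_within continuous_on_real_polynomial)
    also have "(\<integral>x. integral {a..x} (\<lambda>x. g x - h x) * p' x \<partial>?L) = (\<integral>x. 0 \<partial>?L)"
      by (rule Bochner_Integration.integral_cong) (auto simp: zero)
    finally show "(\<integral>x. (g x - h x) * p x \<partial>?L) = 0" using zero[of b] ab by simp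
  qed (use ab g h in auto)
  then show ?thesis by eventually_elim simp
qed

text \<open>Here the derivative of the test function is the factor that is integrated, and
  \<open>f\<close> is the differentiable factor in
  \<open>integration_by_parts_primitive\<close>.\<close>

lemma C1_has_weak_derivative:
  assumes ab: "a < b" and der: "\<And>x. x \<in> {a..b} \<Longrightarrow> (f has_real_derivative f' x) (at x within {a..b})"
    and cont: "continuous_on {a..b} f'"
  shows "has_weak_derivative a b f f'"
proof -
  let ?L = "lebesgue_on {a..b}"
  have cf: "continuous_on {a..b} f" using der by (intro DERIV_continuous_on) auto
  show ?thesis
    unfolding has_weak_derivative_def absolutely_integrable_iff LINT_eq
  proof (intro conjI allI impI)
    fix \<zeta> \<zeta>' assume tf: "test_function a b \<zeta> \<zeta>'"
    then have d\<zeta>: "(\<zeta> has_real_derivative \<zeta>' x) (at x within S)" for x S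
      by (auto simp: test_function_def intro: has_field_derivative_at_within)
    have c': "continuous_on {a..b} \<zeta>'" using tf continuous_on_subset by (auto simp: test_function_def)
    have z: "\<zeta> a = 0" "\<zeta> b = 0" using tf by (auto simp: test_function_def)
    have prim: "integral {a..x} \<zeta>' = \<zeta> x" if "x \<in> {a..b}" for x
    proof -
      have "(\<zeta>' has_integral \<zeta> x - \<zeta> a) {a..x}"
        using that d\<zeta> by (intro fundamental_theorem_of_calculus)
          (auto simp: has_real_derivative_iff_has_vector_derivative)
      then show ?thesis using z by auto
    qed
    have "(\<integral>x. \<zeta>' x * f x \<partial>?L) = integral {a..b} \<zeta>' * f b - (\<integral>x. integral {a..x} \<zeta>' * f' x \<partial>?L)"
      using ab by (intro integration_by_parts_primitive der cont integrable_continuous_interval_lebesgue c') auto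
    also have "(\<integral>x. integral {a..x} \<zeta>' * f' x \<partial>?L) = (\<integral>x. \<zeta> x * f' x \<partial>?L)"
      by (rule Bochner_Integration.integral_cong) (auto simp: prim)
    finally show "(\<integral>x. f x * \<zeta>' x \<partial>?L) = - (\<integral>x. f' x * \<zeta> x \<partial>?L)"
      using prim[of b] z ab by (simp add: mult.commute)
  qed (intro integrable_continuous_interval_lebesgue cf cont)+
qed

text \<open>\<open>wderiv\<close> picks an arbitrary representative of the first derivative; the
  second derivative is computed from a smooth representative and transferred by this rule.\<close>

lemma has_weak_derivative_cong:
  assumes "AE x in lebesgue_on {a..b}. f x = f2 x" "f2 \<in> borel_measurable (lebesgue_on {a..b})"
    and weak: "has_weak_derivative a b f g"
  shows "has_weak_derivative a b f2 g"
proof -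
  let ?L = "lebesgue_on {a..b}"
  have f: "integrable ?L f" and g: "integrable ?L g"
    using weak by (auto simp: has_weak_derivative_def absolutely_integrable_iff)
  have f2: "integrable ?L f2"
    using f integrable_cong_AE[OF _ assms(2,1)] by auto
  have eq: "(\<integral>x. f2 x * \<zeta>' x \<partial>?L) = (\<integral>x. f x * \<zeta>' x \<partial>?L)" if "continuous_on UNIV \<zeta>'" for \<zeta>'
  proof (rule integral_cong_AE)
    have c: "continuous_on {a..b} \<zeta>'" using that continuous_on_subset by blast
    show "(\<lambda>x. f2 x * \<zeta>' x) \<in> borel_measurable ?L" "(\<lambda>x. f x * \<zeta>' x) \<in> borel_measurable ?L"
      using integrable_mult_continuous[OF f c] integrable_mult_continuous[OF f2 c] by auto
    show "AE x in ?L. f2 x * \<zeta>' x = f x * \<zeta>' x" using assms(1) by eventually_elim simp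
  qed
  show ?thesis
    unfolding has_weak_derivative_def absolutely_integrable_iff LINT_eq
  proof (intro conjI allI impI f2 g)
    fix \<zeta> \<zeta>' assume tf: "test_function a b \<zeta> \<zeta>'"
    then have "continuous_on UNIV \<zeta>'" by (simp add: test_function_def)
    moreover have "(\<integral>x. f x * \<zeta>' x \<partial>?L) = - (\<integral>x. g x * \<zeta> x \<partial>?L)"
      using weak tf unfolding has_weak_derivative_def LINT_eq by blast
    ultimately show "(\<integral>x. f2 x * \<zeta>' x \<partial>?L) = - (\<integral>x. g x * \<zeta> x \<partial>?L)"
      using eq by simp
  qed
qed

section \<open>The seminormed space of integrable functions on the edges\<close>

lemma L1S_iff: "\<phi> \<in> L1S N d \<longleftrightarrow> (\<forall>i\<in>{1..N}. integrable (lebesgue_on {0..d i}) (\<phi> i))"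
  unfolding L1S_def absolutely_integrable_iff by simp

lemma L1_norm_eq: "L1_norm N d \<phi> = (\<Sum>i=1..N. \<integral>x. \<bar>\<phi> i x\<bar> \<partial>lebesgue_on {0..d i})"
  unfolding L1_norm_def LINT_eq ..

lemma L1S_lincomb: "\<phi> \<in> L1S N d \<Longrightarrow> \<psi> \<in> L1S N d \<Longrightarrow> (\<lambda>i x. a * \<phi> i x + b * \<psi> i x) \<in> L1S N d"
  by (simp add: L1S_iff)

lemma L1S_scale: "\<phi> \<in> L1S N d \<Longrightarrow> (\<lambda>i x. a * \<phi> i x) \<in> L1S N d"
  by (simp add: L1S_iff)

lemma L1S_divide: "\<phi> \<in> L1S N d \<Longrightarrow> (\<lambda>i x. \<phi> i x / a) \<in> L1S N d"
  by (simp add: L1S_iff)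

lemma L1S_add: "\<phi> \<in> L1S N d \<Longrightarrow> \<psi> \<in> L1S N d \<Longrightarrow> (\<lambda>i x. \<phi> i x + \<psi> i x) \<in> L1S N d"
  by (simp add: L1S_iff)

lemma L1S_diff: "\<phi> \<in> L1S N d \<Longrightarrow> \<psi> \<in> L1S N d \<Longrightarrow> (\<lambda>i x. \<phi> i x - \<psi> i x) \<in> L1S N d"
  by (simp add: L1S_iff)

lemma L1S_sum: "(\<And>k. k \<in> I \<Longrightarrow> \<phi> k \<in> L1S N d) \<Longrightarrow> (\<lambda>i x. \<Sum>k\<in>I. \<phi> k i x) \<in> L1S N d"
  by (simp add: L1S_iff)

lemma L1S_zero: "(\<lambda>i x. 0) \<in> L1S N d"
  by (simp add: L1S_iff)

lemmas L1S_intros = L1S_lincomb L1S_scale L1S_divide L1S_add L1S_diff L1S_sum L1S_zero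

lemma L1_norm_nonneg: "0 \<le> L1_norm N d \<phi>"
  by (simp add: L1_norm_eq sum_nonneg)

lemma L1_norm_zero: "L1_norm N d (\<lambda>i x. 0) = 0"
  by (simp add: L1_norm_eq)

lemma L1_norm_scale: "L1_norm N d (\<lambda>i x. a * \<phi> i x) = \<bar>a\<bar> * L1_norm N d \<phi>"
  by (simp add: L1_norm_eq abs_mult sum_distrib_left)

lemma L1_norm_add_le:
  assumes "\<phi> \<in> L1S N d" "\<psi> \<in> L1S N d"
  shows "L1_norm N d (\<lambda>i x. \<phi> i x + \<psi> i x) \<le> L1_norm N d \<phi> + L1_norm N d \<psi>"
  unfolding L1_norm_eq sum.distrib[symmetric]
proof (rule sum_mono)
  fix i assume i: "i \<in> {1..N}"
  then have int: "integrable (lebesgue_on {0..d i}) (\<phi> i)" "integrable (lebesgue_on {0..d i}) (\<psi> i)"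
    using assms by (auto simp: L1S_iff)
  have "(\<integral>x. \<bar>\<phi> i x + \<psi> i x\<bar> \<partial>lebesgue_on {0..d i}) \<le> (\<integral>x. \<bar>\<phi> i x\<bar> + \<bar>\<psi> i x\<bar> \<partial>lebesgue_on {0..d i})"
    using int by (intro integral_mono) auto
  also have "\<dots> = (\<integral>x. \<bar>\<phi> i x\<bar> \<partial>lebesgue_on {0..d i}) + (\<integral>x. \<bar>\<psi> i x\<bar> \<partial>lebesgue_on {0..d i})"
    using int by (intro Bochner_Integration.integral_add) auto
  finally show "(\<integral>x. \<bar>\<phi> i x + \<psi> i x\<bar> \<partial>lebesgue_on {0..d i}) \<le>
    (\<integral>x. \<bar>\<phi> i x\<bar> \<partial>lebesgue_on {0..d i}) + (\<integral>x. \<bar>\<psi> i x\<bar> \<partial>lebesgue_on {0..d i})" .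
qed

lemma L1_norm_sum_le:
  assumes "finite I" "\<And>k. k \<in> I \<Longrightarrow> \<phi> k \<in> L1S N d"
  shows "L1_norm N d (\<lambda>i x. \<Sum>k\<in>I. c k * \<phi> k i x) \<le> (\<Sum>k\<in>I. \<bar>c k\<bar> * L1_norm N d (\<phi> k))"
  using assms
proof (induction I)
  case empty
  then show ?case by (simp add: L1_norm_zero)
next
  case (insert k I)
  have "L1_norm N d (\<lambda>i x. c k * \<phi> k i x + (\<Sum>k\<in>I. c k * \<phi> k i x)) \<le>
    L1_norm N d (\<lambda>i x. c k * \<phi> k i x) + L1_norm N d (\<lambda>i x. \<Sum>k\<in>I. c k * \<phi> k i x)"
    using insert by (intro L1_norm_add_le L1S_intros) auto
  then show ?case using insert by (simp add: L1_norm_scale)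
qed

lemma L1_dist_nonneg: "0 \<le> L1_dist N d \<phi> \<psi>"
  unfolding L1_dist_def by (rule L1_norm_nonneg)

lemma L1_dist_commute: "L1_dist N d \<phi> \<psi> = L1_dist N d \<psi> \<phi>"
  unfolding L1_dist_def L1_norm_eq by (simp add: abs_minus_commute)

lemma L1_dist_self: "L1_dist N d \<phi> \<phi> = 0"
  by (simp add: L1_dist_def L1_norm_zero)

lemma L1_dist_zero_right: "L1_dist N d \<phi> (\<lambda>i x. 0) = L1_norm N d \<phi>"
  by (simp add: L1_dist_def)

lemma L1_dist_triangle:
  assumes "\<phi> \<in> L1S N d" "\<psi> \<in> L1S N d" "\<eta> \<in> L1S N d"
  shows "L1_dist N d \<phi> \<eta> \<le> L1_dist N d \<phi> \<psi> + L1_dist N d \<psi> \<eta>"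
  using L1_norm_add_le[OF L1S_diff[OF assms(1,2)] L1S_diff[OF assms(2,3)]]
  by (simp add: L1_dist_def)

lemma L1_norm_le_dist:
  assumes "\<phi> \<in> L1S N d" "\<psi> \<in> L1S N d"
  shows "L1_norm N d \<phi> \<le> L1_norm N d \<psi> + L1_dist N d \<phi> \<psi>"
  using L1_dist_triangle[OF assms L1S_zero] by (simp add: L1_dist_zero_right)

text \<open>From here on, equality of classes is handled as distance zero, so that triangle
  inequalities do the work of congruence rules.\<close>

lemma L1_eq_iff_dist:
  assumes "\<phi> \<in> L1S N d" "\<psi> \<in> L1S N d"
  shows "L1_eq N d \<phi> \<psi> \<longleftrightarrow> L1_dist N d \<phi> \<psi> = 0"
proof -
  have "(\<integral>x. \<bar>\<phi> i x - \<psi> i x\<bar> \<partial>lebesgue_on {0..d i}) = 0 \<longleftrightarrow> ae_eq_on 0 (d i) (\<phi> i) (\<psi> i)" if "i \<in> {1..N}" for i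
    unfolding ae_eq_on_iff using assms that
    by (subst integral_nonneg_eq_0_iff_AE) (auto simp: L1S_iff)
  then show ?thesis
    unfolding L1_eq_def L1_dist_def L1_norm_eq by (subst sum_nonneg_eq_0_iff) auto
qed

lemma L1_dist_cong:
  assumes "L1_dist N d \<phi> \<phi>' = 0" "L1_dist N d \<psi> \<psi>' = 0"
    and "\<phi> \<in> L1S N d" "\<phi>' \<in> L1S N d" "\<psi> \<in> L1S N d" "\<psi>' \<in> L1S N d"
  shows "L1_dist N d \<phi> \<psi> = L1_dist N d \<phi>' \<psi>'"
  using L1_dist_triangle[of \<phi> N d \<phi>' \<psi>'] L1_dist_triangle[of \<phi> N d \<psi>' \<psi>]
    L1_dist_triangle[of \<phi>' N d \<phi> \<psi>] L1_dist_triangle[of \<phi>' N d \<psi> \<psi>'] assms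
    L1_dist_commute[of N d \<phi> \<phi>'] L1_dist_commute[of N d \<psi> \<psi>'] by linarith

lemma L1_norm_cong:
  assumes "L1_dist N d \<phi> \<phi>' = 0" "\<phi> \<in> L1S N d" "\<phi>' \<in> L1S N d"
  shows "L1_norm N d \<phi> = L1_norm N d \<phi>'"
  using L1_dist_cong[OF assms(1) L1_dist_self assms(2,3) L1S_zero L1S_zero]
  by (simp add: L1_dist_zero_right)

text \<open>By Tonelli a finite sum of norms forces absolute convergence almost everywhere; the
  remainder after \<open>n\<close> terms is then dominated pointwise by the series of the absolute
  values of the remaining terms.\<close>

lemma integrable_series:
  fixes f :: "nat \<Rightarrow> 'a \<Rightarrow> real"
  assumes f: "\<And>k. integrable M (f k)" and s: "summable (\<lambda>k. \<integral>x. \<bar>f k x\<bar> \<partial>M)"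
  shows "integrable M (\<lambda>x. \<Sum>k. f k x)"
    and "(\<integral>x. \<bar>(\<Sum>k. f k x) - (\<Sum>k<n. f k x)\<bar> \<partial>M) \<le> (\<Sum>k. \<integral>x. \<bar>f (k + n) x\<bar> \<partial>M)"
proof -
  have [measurable]: "f k \<in> borel_measurable M" for k using f by auto
  have "(\<integral>\<^sup>+x. (\<Sum>k. ennreal \<bar>f k x\<bar>) \<partial>M) = (\<Sum>k. \<integral>\<^sup>+x. ennreal \<bar>f k x\<bar> \<partial>M)"
    by (intro nn_integral_suminf) auto
  also have "\<dots> = (\<Sum>k. ennreal (\<integral>x. \<bar>f k x\<bar> \<partial>M))"
    using f by (intro suminf_cong nn_integral_eq_integral) auto
  also have "\<dots> = ennreal (\<Sum>k. \<integral>x. \<bar>f k x\<bar> \<partial>M)"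
    using s by (intro suminf_ennreal2) auto
  finally have "(\<integral>\<^sup>+x. (\<Sum>k. ennreal \<bar>f k x\<bar>) \<partial>M) \<noteq> \<infinity>" by simp
  then have "AE x in M. (\<Sum>k. ennreal \<bar>f k x\<bar>) \<noteq> \<infinity>"
    by (intro nn_integral_PInf_AE) auto
  then have ae: "AE x in M. summable (\<lambda>k. \<bar>f k x\<bar>)"
    by eventually_elim (auto intro: summable_suminf_not_top)
  show 1: "integrable M (\<lambda>x. \<Sum>k. f k x)"
    by (rule integrable_suminf[OF f]) (use ae s in auto)
  have s': "summable (\<lambda>k. \<integral>x. \<bar>f (k + n) x\<bar> \<partial>M)" by (rule summable_ignore_initial_segment[OF s])
  have ae': "AE x in M. summable (\<lambda>k. \<bar>f (k + n) x\<bar>)"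
    using ae by eventually_elim (rule summable_ignore_initial_segment)
  have 2: "integrable M (\<lambda>x. \<Sum>k. \<bar>f (k + n) x\<bar>)"
    by (rule integrable_suminf) (use f ae' s' in auto)
  have "(\<lambda>k. \<integral>x. \<bar>f (k + n) x\<bar> \<partial>M) sums (\<integral>x. (\<Sum>k. \<bar>f (k + n) x\<bar>) \<partial>M)"
    by (rule sums_integral) (use f ae' s' in auto)
  then have 3: "(\<integral>x. (\<Sum>k. \<bar>f (k + n) x\<bar>) \<partial>M) = (\<Sum>k. \<integral>x. \<bar>f (k + n) x\<bar> \<partial>M)"
    by (rule sums_unique)
  have "(\<integral>x. \<bar>(\<Sum>k. f k x) - (\<Sum>k<n. f k x)\<bar> \<partial>M) \<le> (\<integral>x. (\<Sum>k. \<bar>f (k + n) x\<bar>) \<partial>M)"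
  proof (rule integral_mono_AE)
    show "integrable M (\<lambda>x. \<bar>(\<Sum>k. f k x) - (\<Sum>k<n. f k x)\<bar>)" using 1 f by auto
    show "AE x in M. \<bar>(\<Sum>k. f k x) - (\<Sum>k<n. f k x)\<bar> \<le> (\<Sum>k. \<bar>f (k + n) x\<bar>)"
      using ae ae'
    proof eventually_elim
      case (elim x)
      have "(\<Sum>k. f k x) - (\<Sum>k<n. f k x) = (\<Sum>k. f (k + n) x)"
        using suminf_split_initial_segment[OF summable_rabs_cancel[OF elim(1)], of n] by simp
      then show ?case using summable_rabs[OF elim(2)] by simp
    qed
  qed (rule 2)
  then show "(\<integral>x. \<bar>(\<Sum>k. f k x) - (\<Sum>k<n. f k x)\<bar> \<partial>M) \<le> (\<Sum>k. \<integral>x. \<bar>f (k + n) x\<bar> \<partial>M)"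
    using 3 by simp
qed

text \<open>Completeness in the quantitative form that the gliding hump requires. The series is
  formed edge by edge, and exchanging the sum over edges with the series gives the remainder bound
  for the total norm.\<close>

lemma L1S_complete:
  assumes y: "\<And>k. y k \<in> L1S N d" and r: "summable r" "\<And>k. L1_norm N d (y k) \<le> r k"
  obtains x where "x \<in> L1S N d" "\<And>n. L1_dist N d x (\<lambda>i t. \<Sum>k<n. y k i t) \<le> (\<Sum>k. r (k + n))"
proof -
  define e where "e i k = (\<integral>x. \<bar>y k i x\<bar> \<partial>lebesgue_on {0..d i})" for i k
  have e0: "0 \<le> e i k" for i k by (simp add: e_def)
  have er: "(\<Sum>i=1..N. e i k) \<le> r k" for k using r(2)[of k] by (simp add: L1_norm_eq e_def)
  have "e i k \<le> r k" if "i \<in> {1..N}" for i k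
    using member_le_sum[of i "{1..N}" "\<lambda>i. e i k"] that er[of k] e0 by auto
  then have se: "summable (e i)" if "i \<in> {1..N}" for i
    using that e0 by (intro summable_comparison_test'[OF r(1)]) auto
  have yi: "integrable (lebesgue_on {0..d i}) (y k i)" if "i \<in> {1..N}" for i k
    using y[of k] that by (auto simp: L1S_iff)
  define x where "x i t = (\<Sum>k. y k i t)" for i t
  have "x \<in> L1S N d"
    unfolding x_def L1S_iff using integrable_series(1)[OF yi se[unfolded e_def]] by blast
  moreover have "L1_dist N d x (\<lambda>i t. \<Sum>k<n. y k i t) \<le> (\<Sum>k. r (k + n))" for n
  proof -
    have "L1_dist N d x (\<lambda>i t. \<Sum>k<n. y k i t) \<le> (\<Sum>i=1..N. \<Sum>k. e i (k + n))"
      unfolding L1_dist_def L1_norm_eq x_def e_def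
      using integrable_series(2)[OF yi se[unfolded e_def]] by (intro sum_mono) blast
    also have "\<dots> = (\<Sum>k. \<Sum>i=1..N. e i (k + n))"
      by (intro suminf_sum[symmetric] summable_ignore_initial_segment se)
    also have "\<dots> \<le> (\<Sum>k. r (k + n))"
      by (intro suminf_le summable_sum summable_ignore_initial_segment se r er) auto
    finally show ?thesis .
  qed
  ultimately show ?thesis by (rule that)
qed

section \<open>Strongly continuous semigroups\<close>

lemma bounded_operator_closed: "bounded_operator_L1 N d B \<Longrightarrow> \<phi> \<in> L1S N d \<Longrightarrow> B \<phi> \<in> L1S N d"
  by (simp add: bounded_operator_L1_def)

lemma bounded_operator_lincomb:
  assumes B: "bounded_operator_L1 N d B" and "\<phi> \<in> L1S N d" "\<psi> \<in> L1S N d"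
  shows "L1_dist N d (B (\<lambda>i x. a * \<phi> i x + b * \<psi> i x)) (\<lambda>i x. a * B \<phi> i x + b * B \<psi> i x) = 0"
proof -
  have "L1_eq N d (B (\<lambda>i x. a * \<phi> i x + b * \<psi> i x)) (\<lambda>i x. a * B \<phi> i x + b * B \<psi> i x)"
    using assms unfolding bounded_operator_L1_def by blast
  then show ?thesis
    using assms by (subst (asm) L1_eq_iff_dist) (auto intro!: L1S_intros bounded_operator_closed[OF B])
qed

lemma bounded_operator_diff:
  assumes B: "bounded_operator_L1 N d B" and "\<phi> \<in> L1S N d" "\<psi> \<in> L1S N d"
  shows "L1_norm N d (B (\<lambda>i x. \<phi> i x - \<psi> i x)) = L1_dist N d (B \<phi>) (B \<psi>)"
proof -
  have "L1_dist N d (B (\<lambda>i x. \<phi> i x - \<psi> i x)) (\<lambda>i x. B \<phi> i x - B \<psi> i x) = 0"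
    using bounded_operator_lincomb[OF assms, of 1 "-1"] by simp
  from L1_norm_cong[OF this] show ?thesis
    using assms by (simp add: L1_dist_def L1S_intros bounded_operator_closed[OF B])
qed

lemma bounded_operator_scale:
  assumes B: "bounded_operator_L1 N d B" and "\<phi> \<in> L1S N d"
  shows "L1_norm N d (B (\<lambda>i x. a * \<phi> i x)) = \<bar>a\<bar> * L1_norm N d (B \<phi>)"
proof -
  have "L1_dist N d (B (\<lambda>i x. a * \<phi> i x)) (\<lambda>i x. a * B \<phi> i x) = 0"
    using bounded_operator_lincomb[OF assms assms(2), of a 0] by simp
  from L1_norm_cong[OF this] show ?thesis
    using assms by (simp add: L1_norm_scale L1S_intros bounded_operator_closed[OF B])
qed

lemma C0_semigroup_bounded: "C0_semigroup N d T \<Longrightarrow> 0 \<le> t \<Longrightarrow> bounded_operator_L1 N d (T t)"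
  by (simp add: C0_semigroup_def)

lemma C0_semigroup_closed: "C0_semigroup N d T \<Longrightarrow> 0 \<le> t \<Longrightarrow> \<phi> \<in> L1S N d \<Longrightarrow> T t \<phi> \<in> L1S N d"
  using C0_semigroup_bounded bounded_operator_closed by blast

lemma C0_semigroup_zero:
  assumes "C0_semigroup N d T" "\<phi> \<in> L1S N d"
  shows "L1_dist N d (T 0 \<phi>) \<phi> = 0"
  using assms C0_semigroup_closed[OF assms(1) order_refl assms(2)]
  by (simp add: C0_semigroup_def flip: L1_eq_iff_dist)

lemma C0_semigroup_add:
  assumes "C0_semigroup N d T" "\<phi> \<in> L1S N d" "0 \<le> s" "0 \<le> t"
  shows "L1_dist N d (T (s + t) \<phi>) (T s (T t \<phi>)) = 0"
  using assms C0_semigroup_closed[OF assms(1)]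
  by (subst L1_eq_iff_dist[symmetric]) (auto simp: C0_semigroup_def)

lemma C0_semigroup_tendsto: "C0_semigroup N d T \<Longrightarrow> \<phi> \<in> L1S N d \<Longrightarrow> ((\<lambda>t. L1_dist N d (T t \<phi>) \<phi>) \<longlongrightarrow> 0) (at_right 0)"
  by (simp add: C0_semigroup_def)

text \<open>A substitute for the operator norm. Starting from some admissible bound, multiply by 2/3
  until the bound first fails: the last admissible value \<open>C\<close> is exceeded up to the
  factor 2/3 by some vector. Since \<open>M\<close> is not admissible and bounds are upward closed,
  \<open>C\<close> lies above \<open>M\<close>.\<close>

lemma almost_optimal_bound:
  assumes B: "bounded_operator_L1 N d B" and M: "0 < M"
    and not: "\<not> (\<forall>\<phi>\<in>L1S N d. L1_norm N d (B \<phi>) \<le> M * L1_norm N d \<phi>)"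
  obtains C \<xi> where "M < C" "\<And>\<phi>. \<phi> \<in> L1S N d \<Longrightarrow> L1_norm N d (B \<phi>) \<le> C * L1_norm N d \<phi>"
    "\<xi> \<in> L1S N d" "L1_norm N d \<xi> = 1" "2/3 * C < L1_norm N d (B \<xi>)"
proof -
  define bd where "bd C \<longleftrightarrow> (\<forall>\<phi>\<in>L1S N d. L1_norm N d (B \<phi>) \<le> C * L1_norm N d \<phi>)" for C
  have mono: "bd C'" if "bd C" "C \<le> C'" for C C'
    using that mult_right_mono[OF that(2) L1_norm_nonneg] unfolding bd_def by (blast intro: order_trans)
  obtain C0 where C0: "bd C0" using B unfolding bounded_operator_L1_def bd_def by blast
  have nM: "\<not> bd M" using not by (simp add: bd_def)
  have "(\<lambda>m. C0 * (2/3) ^ m) \<longlonglongrightarrow> C0 * 0"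
    by (intro tendsto_mult_left LIMSEQ_realpow_zero) auto
  then have "eventually (\<lambda>m. C0 * (2/3) ^ m < M) sequentially"
    using M by (auto dest: order_tendstoD)
  then obtain m where "C0 * (2/3) ^ m < M" by (auto simp: eventually_sequentially)
  then have ex: "\<not> bd (C0 * (2/3) ^ m)" using mono nM by fastforce
  define m where "m = (LEAST m. \<not> bd (C0 * (2/3) ^ m))"
  have m: "\<not> bd (C0 * (2/3) ^ m)" unfolding m_def by (rule LeastI[of "\<lambda>m. \<not> bd (C0 * (2/3) ^ m)", OF ex])
  then have "m \<noteq> 0" using C0 by (cases m) auto
  then obtain m' where m': "m = Suc m'" using not0_implies_Suc by blast
  define C where "C = C0 * (2/3) ^ m'"
  have C: "bd C" using not_less_Least[of m' "\<lambda>m. \<not> bd (C0 * (2/3) ^ m)"] m' unfolding C_def m_def by auto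
  have "\<not> bd (2/3 * C)" using m by (simp add: m' C_def mult.commute mult.left_commute)
  then obtain \<xi> where xi: "\<xi> \<in> L1S N d" "2/3 * C * L1_norm N d \<xi> < L1_norm N d (B \<xi>)"
    by (auto simp: bd_def not_le)
  have "L1_norm N d \<xi> \<noteq> 0" using xi C unfolding bd_def by fastforce
  then have pos: "0 < L1_norm N d \<xi>" using L1_norm_nonneg[of N d \<xi>] by linarith
  define \<eta> where "\<eta> = (\<lambda>i x. (1 / L1_norm N d \<xi>) * \<xi> i x)"
  show ?thesis
  proof (rule that)
    show "M < C" using mono[OF C, of M] nM by (cases "C \<le> M") auto
    show "\<eta> \<in> L1S N d" unfolding \<eta>_def by (intro L1S_intros xi)
    show "L1_norm N d \<eta> = 1" unfolding \<eta>_def using pos by (simp only: L1_norm_scale) simp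
    show "2/3 * C < L1_norm N d (B \<eta>)"
      unfolding \<eta>_def bounded_operator_scale[OF B xi(1)] using xi(2) pos by (simp add: field_simps)
  qed (use C in \<open>auto simp: bd_def\<close>)
qed

text \<open>One of \<open>x + r\<xi>\<close>, \<open>x - r\<xi>\<close> has a large image, since the images differ by \<open>2 r B \<xi>\<close>.\<close>

lemma large_image_nearby:
  assumes B: "bounded_operator_L1 N d B" and x: "x \<in> L1S N d" and xi: "\<xi> \<in> L1S N d" "L1_norm N d \<xi> = 1"
    and r: "0 \<le> r"
  obtains y where "y \<in> L1S N d" "L1_norm N d y = r"
    "r * L1_norm N d (B \<xi>) \<le> L1_norm N d (B (\<lambda>i t. x i t + y i t))"
proof -
  define u where "u s = (\<lambda>i t. s * r * \<xi> i t)" for s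
  define z where "z s = (\<lambda>i t. x i t + u s i t)" for s
  have uL: "u s \<in> L1S N d" for s unfolding u_def by (intro L1S_intros xi)
  have zL: "z s \<in> L1S N d" for s unfolding z_def by (intro L1S_intros x uL)
  note BL = bounded_operator_closed[OF B]
  have "2 * r * L1_norm N d (B \<xi>) = L1_norm N d (B (\<lambda>i t. (2 * r) * \<xi> i t))"
    using bounded_operator_scale[OF B xi(1), of "2*r"] r by simp
  also have "(\<lambda>i t. (2 * r) * \<xi> i t) = (\<lambda>i t. z 1 i t - z (-1) i t)" by (simp add: z_def u_def fun_eq_iff)
  also have "L1_norm N d (B \<dots>) = L1_dist N d (B (z 1)) (B (z (-1)))"
    by (rule bounded_operator_diff[OF B zL zL])
  also have "\<dots> \<le> L1_norm N d (B (z 1)) + L1_norm N d (B (z (-1)))"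
    using L1_dist_triangle[OF BL[OF zL] L1S_zero BL[OF zL], of 1 "-1"] L1_dist_commute[of N d "\<lambda>i x. 0"]
    by (simp add: L1_dist_zero_right)
  finally have "\<exists>s\<in>{1, -1}. r * L1_norm N d (B \<xi>) \<le> L1_norm N d (B (z s))" by auto
  then obtain s where s: "s \<in> {1, -1}" "r * L1_norm N d (B \<xi>) \<le> L1_norm N d (B (z s))" by blast
  have "L1_norm N d (u s) = r" unfolding u_def using L1_norm_scale[of N d "s * r" \<xi>] s(1) xi r by auto
  then show ?thesis using that[OF uL] s(2) by (simp add: z_def)
qed

text \<open>The gliding hump proof of the uniform boundedness principle: failing bounds at times tending to
  \<open>0\<close> would produce one orbit that is unbounded near \<open>0\<close>.\<close>

lemma C0_semigroup_locally_bounded: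
  assumes T: "C0_semigroup N d T"
  obtains \<delta> M where "0 < \<delta>" "\<And>t \<phi>. 0 \<le> t \<Longrightarrow> t \<le> \<delta> \<Longrightarrow> \<phi> \<in> L1S N d \<Longrightarrow> L1_norm N d (T t \<phi>) \<le> M * L1_norm N d \<phi>"
proof (rule ccontr)
  assume neg: "\<not> thesis"
  \<comment> \<open>At time \<open>t k\<close> the increment of norm 4^-k yields at least 2/3 of
    \<open>C k\<close> times its norm, and all later increments together destroy at most 1/3 of
    \<open>C k\<close> times that norm. The net gain exceeds
    \<open>K k * 4^-k / 3 = k + 1\<close>.\<close>
  define K where "K k = 4 ^ k * 3 * (real k + 1)" for k :: nat
  have K0: "0 < K k" for k by (simp add: K_def)
  have "\<exists>t C \<xi>. 0 \<le> t \<and> t \<le> 1 / (real k + 1) \<and> K k < C \<and>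
      (\<forall>\<phi>\<in>L1S N d. L1_norm N d (T t \<phi>) \<le> C * L1_norm N d \<phi>) \<and>
      \<xi> \<in> L1S N d \<and> L1_norm N d \<xi> = 1 \<and> 2/3 * C < L1_norm N d (T t \<xi>)" for k :: nat
  proof -
    have "\<exists>t\<ge>0. t \<le> 1 / (real k + 1) \<and> \<not> (\<forall>\<phi>\<in>L1S N d. L1_norm N d (T t \<phi>) \<le> K k * L1_norm N d \<phi>)"
    proof (rule ccontr)
      assume "\<not> ?thesis"
      then show False using neg that[of "1 / (real k + 1)" "K k"] by fastforce
    qed
    then obtain t where t: "0 \<le> t" "t \<le> 1 / (real k + 1)"
      "\<not> (\<forall>\<phi>\<in>L1S N d. L1_norm N d (T t \<phi>) \<le> K k * L1_norm N d \<phi>)" by blast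
    show ?thesis
      by (rule almost_optimal_bound[OF C0_semigroup_bounded[OF T t(1)] K0 t(3)]) (use t in blast)
  qed
  then obtain t C \<xi> where t: "\<And>k. 0 \<le> t k" "\<And>k. t k \<le> 1 / (real k + 1)" and KC: "\<And>k. K k < C k"
    and C: "\<And>k \<phi>. \<phi> \<in> L1S N d \<Longrightarrow> L1_norm N d (T (t k) \<phi>) \<le> C k * L1_norm N d \<phi>"
    and xi: "\<And>k. \<xi> k \<in> L1S N d" "\<And>k. L1_norm N d (\<xi> k) = 1" "\<And>k. 2/3 * C k < L1_norm N d (T (t k) (\<xi> k))"
    by metis
  note TB = C0_semigroup_bounded[OF T t(1)]
  \<comment> \<open>The ratio 1/4 makes the increments after the k-th sum to \<open>r k / 3\<close>,
    half of the guaranteed 2/3.\<close>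
  define r where "r k = (1/4::real) ^ k" for k
  have r0: "0 \<le> r k" for k by (simp add: r_def)
  define step where "step k x y \<longleftrightarrow> y \<in> L1S N d \<and> L1_norm N d y = r k \<and>
    r k * L1_norm N d (T (t k) (\<xi> k)) \<le> L1_norm N d (T (t k) (\<lambda>i s. x i s + y i s))" for k x y
  have ex: "\<exists>y. step k x y" if "x \<in> L1S N d" for k x
    using large_image_nearby[OF TB that xi(1,2) r0] unfolding step_def by metis
  define pick where "pick k x = (SOME y. step k x y)" for k x
  have pick: "step k x (pick k x)" if "x \<in> L1S N d" for k x
    unfolding pick_def by (rule someI_ex[OF ex[OF that]])
  \<comment> \<open>The increments are chosen recursively, since the sign of the k-th one depends on
    the partial sum already built.\<close>
  define X where "X = rec_nat (\<lambda>i s. 0) (\<lambda>k x. (\<lambda>i s. x i s + pick k x i s))"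
  have X0: "X 0 = (\<lambda>i s. 0)" and XS: "X (Suc k) = (\<lambda>i s. X k i s + pick k (X k) i s)" for k
    by (auto simp: X_def)
  have XL: "X k \<in> L1S N d" for k
  proof (induction k)
    case (Suc k)
    then show ?case using pick[OF Suc, of k] unfolding XS step_def by (blast intro: L1S_intros)
  qed (simp add: X0 L1S_zero)
  define y where "y k = pick k (X k)" for k
  have y: "y k \<in> L1S N d" "L1_norm N d (y k) = r k"
      "r k * L1_norm N d (T (t k) (\<xi> k)) \<le> L1_norm N d (T (t k) (X (Suc k)))" for k
    using pick[OF XL, of k k] unfolding step_def y_def XS by auto
  have Xsum: "X n = (\<lambda>i s. \<Sum>k<n. y k i s)" for n
    by (induction n) (auto simp: X0 XS y_def)
  have "summable r" unfolding r_def by (intro summable_geometric) auto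
  then obtain x where x: "x \<in> L1S N d" "\<And>n. L1_dist N d x (X n) \<le> (\<Sum>k. r (k + n))"
    unfolding Xsum using L1S_complete[of y N d r, OF y(1)] y(2) by auto
  have tail: "(\<Sum>k. r (k + Suc n)) = r n / 3" for n
  proof -
    have "(\<lambda>k. r (Suc n) * (1/4::real) ^ k) sums (r (Suc n) * (1 / (1 - 1/4)))"
      by (intro sums_mult geometric_sums) auto
    then have "(\<lambda>k. r (k + Suc n)) sums (r (Suc n) * (1 / (1 - 1/4)))"
      by (simp add: r_def power_add mult.commute)
    then show ?thesis by (simp add: sums_iff r_def)
  qed
  have big: "real k + 1 < L1_norm N d (T (t k) x)" for k
  proof -
    note TL = bounded_operator_closed[OF TB]
    have "L1_dist N d (T (t k) (X (Suc k))) (T (t k) x) = L1_norm N d (T (t k) (\<lambda>i s. X (Suc k) i s - x i s))"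
      by (rule bounded_operator_diff[OF TB XL x(1), symmetric])
    also have "\<dots> \<le> C k * L1_norm N d (\<lambda>i s. X (Suc k) i s - x i s)" by (intro C L1S_intros XL x)
    also have "\<dots> \<le> C k * (r k / 3)"
      using x(2)[of "Suc k"] KC[of k] K0[of k] L1_dist_commute[of N d x] tail[of k]
      by (intro mult_left_mono) (auto simp: L1_dist_def)
    finally have 1: "L1_dist N d (T (t k) (X (Suc k))) (T (t k) x) \<le> C k * (r k / 3)" .
    have "r k * (2/3 * C k) \<le> L1_norm N d (T (t k) (X (Suc k)))"
      using mult_left_mono[OF less_imp_le[OF xi(3)[of k]] r0[of k]] y(3)[of k] by linarith
    also have "\<dots> \<le> L1_norm N d (T (t k) x) + C k * (r k / 3)"
      using L1_norm_le_dist[OF TL[OF XL] TL[OF x(1)]] 1 by (meson add_left_mono order_trans)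
    finally have "C k * (r k / 3) \<le> L1_norm N d (T (t k) x)" by (simp add: algebra_simps)
    moreover have "K k * (r k / 3) < C k * (r k / 3)"
      using KC[of k] by (intro mult_strict_right_mono) (auto simp: r_def)
    moreover have "K k * (r k / 3) = real k + 1" by (simp add: K_def r_def power_divide)
    ultimately show ?thesis by simp
  qed
  \<comment> \<open>The contradiction: near time 0 the orbit of the limit \<open>x\<close> stays
    within distance 1 of \<open>x\<close>, while the times \<open>t k\<close> tend to 0 and the
    norms there exceed k + 1.\<close>
  have "eventually (\<lambda>s. L1_dist N d (T s x) x < 1) (at_right 0)"
    using C0_semigroup_tendsto[OF T x(1)] by (rule order_tendstoD) simp
  then obtain b where b: "0 < b" "\<And>s. 0 < s \<Longrightarrow> s < b \<Longrightarrow> L1_dist N d (T s x) x < 1"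
    by (auto simp: eventually_at_right_field)
  obtain k where k: "max (1 / b) (L1_norm N d x + 1) < real k" using reals_Archimedean2 by blast
  have "1 / (real k + 1) < b" using k b(1) by (simp add: field_simps)
  then have "t k < b" using t(2)[of k] by linarith
  then have "L1_dist N d (T (t k) x) x < 1"
    using b(2)[of "t k"] C0_semigroup_zero[OF T x(1)] t(1)[of k] by (cases "t k = 0") auto
  then have "L1_norm N d (T (t k) x) < L1_norm N d x + 1"
    using L1_norm_le_dist[OF bounded_operator_closed[OF TB x(1)] x(1), of k] by linarith
  then show False using big[of k] k by simp
qed

text \<open>The semigroup law propagates the bound on a short interval: each further step of length
  \<delta> costs one more factor.\<close>

lemma C0_semigroup_bounded_on:
  assumes T: "C0_semigroup N d T"
  obtains M where "0 < M" "\<And>t \<phi>. 0 \<le> t \<Longrightarrow> t \<le> \<tau> \<Longrightarrow> \<phi> \<in> L1S N d \<Longrightarrow> L1_norm N d (T t \<phi>) \<le> M * L1_norm N d \<phi>"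
proof -
  obtain \<delta> M where \<delta>: "0 < \<delta>"
    and M: "\<And>t \<phi>. 0 \<le> t \<Longrightarrow> t \<le> \<delta> \<Longrightarrow> \<phi> \<in> L1S N d \<Longrightarrow> L1_norm N d (T t \<phi>) \<le> M * L1_norm N d \<phi>"
    by (rule C0_semigroup_locally_bounded[OF T]) blast
  \<comment> \<open>With a base of at least 1 the powers increase, so short times satisfy the bound
    with every positive exponent.\<close>
  define L where "L = max 1 M"
  have L: "L1_norm N d (T t \<phi>) \<le> L * L1_norm N d \<phi>" if "0 \<le> t" "t \<le> \<delta>" "\<phi> \<in> L1S N d" for t \<phi>
    using M[OF that] mult_right_mono[OF max.cobounded2[of M 1] L1_norm_nonneg[of N d \<phi>]]
    by (simp add: L_def max.commute)
  have "L1_norm N d (T t \<phi>) \<le> L ^ n * L1_norm N d \<phi>" if "0 \<le> t" "t \<le> real n * \<delta>" "\<phi> \<in> L1S N d" for t \<phi> n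
    using that
  proof (induction n arbitrary: t)
    case 0
    then have "t = 0" by simp
    then show ?case
      using L1_norm_cong[OF C0_semigroup_zero[OF T 0(3)] C0_semigroup_closed[OF T _ 0(3)] 0(3)] by simp
  next
    case (Suc n)
    have L1: "1 \<le> L" by (simp add: L_def)
    show ?case
    proof (cases "t \<le> \<delta>")
      case True
      have "L * L1_norm N d \<phi> \<le> L ^ Suc n * L1_norm N d \<phi>"
        using L1 one_le_power[OF L1, of n] by (intro mult_right_mono L1_norm_nonneg) auto
      then show ?thesis using L[OF _ True] Suc.prems by force
    next
      case False
      note TL = C0_semigroup_closed[OF T]
      have t: "0 \<le> t - \<delta>" "t - \<delta> \<le> real n * \<delta>" using False Suc.prems by (auto simp: algebra_simps)
      have "L1_norm N d (T t \<phi>) = L1_norm N d (T \<delta> (T (t - \<delta>) \<phi>))"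
        using C0_semigroup_add[OF T Suc.prems(3), of \<delta> "t - \<delta>"] \<delta> t Suc.prems
        by (intro L1_norm_cong TL) auto
      also have "\<dots> \<le> L * L1_norm N d (T (t - \<delta>) \<phi>)"
        using \<delta> t Suc.prems by (intro L TL) auto
      also have "\<dots> \<le> L * (L ^ n * L1_norm N d \<phi>)"
        using Suc.IH[OF t Suc.prems(3)] L1 by (intro mult_left_mono) auto
      finally show ?thesis by simp
    qed
  qed
  moreover obtain n where "\<tau> / \<delta> \<le> real n" using real_arch_simple by blast
  then have "\<tau> \<le> real n * \<delta>" using \<delta> by (simp add: field_simps)
  ultimately show ?thesis using that[of "L ^ n"] by (fastforce simp: L_def)
qed

text \<open>For \<epsilon> > 0 the set of s at which \<open>f s - \<epsilon> * s\<close> does not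
  exceed its initial value is compact and has a greatest element; if that were below
  \<open>b\<close>, the one-sided estimate would produce a larger one.\<close>

lemma nonincreasing_of_upper_right_derivative:
  fixes f :: "real \<Rightarrow> real"
  assumes ab: "a \<le> b" and f: "continuous_on {a..b} f"
    and step: "\<And>s e. a \<le> s \<Longrightarrow> s < b \<Longrightarrow> 0 < e \<Longrightarrow>
      eventually (\<lambda>h. s + h \<le> b \<longrightarrow> f (s + h) \<le> f s + e * h) (at_right 0)"
  shows "f b \<le> f a"
proof -
  have "f b \<le> f a + e" if e: "0 < e" for e
  proof -
    define \<epsilon> where "\<epsilon> = e / (b - a + 1)"
    have \<epsilon>: "0 < \<epsilon>" using e ab by (simp add: \<epsilon>_def)
    define S where "S = {s \<in> {a..b}. f s - \<epsilon> * s \<le> f a - \<epsilon> * a}"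
    have c: "continuous_on {a..b} (\<lambda>s. f s - \<epsilon> * s)" by (intro continuous_intros f)
    have "S = {a..b} \<inter> (\<lambda>s. f s - \<epsilon> * s) -` {..f a - \<epsilon> * a}"
      by (auto simp: S_def)
    then have "closed S"
      using continuous_closed_preimage[OF c closed_atLeastAtMost closed_atMost] by simp
    moreover have "bounded S" by (rule bounded_subset[of "{a..b}"]) (auto simp: S_def)
    moreover have "a \<in> S" using ab by (simp add: S_def)
    ultimately obtain s where s: "s \<in> S" "\<And>s'. s' \<in> S \<Longrightarrow> s' \<le> s"
      using compact_attains_sup[of S] compact_eq_bounded_closed by blast
    have "s = b"
    proof (rule ccontr)
      assume "s \<noteq> b"
      then have sb: "a \<le> s" "s < b" using s(1) by (auto simp: S_def)
      have "eventually (\<lambda>h. h < b - s) (at_right 0)"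
        using sb by (auto simp: eventually_at_right_field intro!: exI[of _ "b - s"])
      moreover have "eventually (\<lambda>h::real. 0 < h) (at_right 0)" by (rule eventually_at_right_less)
      moreover note step[OF sb \<epsilon>]
      ultimately have "eventually (\<lambda>h. s + h \<in> S \<and> 0 < h) (at_right 0)"
      proof eventually_elim
        case (elim h)
        then show ?case using s(1) by (auto simp: S_def algebra_simps)
      qed
      then obtain h where "s + h \<in> S" "0 < h"
        using eventually_happens'[OF trivial_limit_at_right_real] by blast
      then show False using s(2) by fastforce
    qed
    then have "f b \<le> f a + \<epsilon> * (b - a)" using s(1) by (simp add: S_def algebra_simps)
    also have "\<epsilon> * (b - a) \<le> e" using e ab by (simp add: \<epsilon>_def field_simps)
    finally show ?thesis by simp
  qed
  then show ?thesis by (rule field_le_epsilon)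
qed

lemma tendsto_zero_dominated:
  fixes f g :: "'a \<Rightarrow> real"
  assumes "(g \<longlongrightarrow> z) F" "eventually (\<lambda>t. f t \<le> g t) F" "z = 0" "\<And>t. 0 \<le> f t"
  shows "(f \<longlongrightarrow> 0) F"
  by (rule tendsto_sandwich[OF _ assms(2) tendsto_const]) (use assms in auto)

text \<open>For s < s' the difference of \<open>T s' \<phi>\<close> and \<open>T s \<phi>\<close> is
  the image under \<open>T s\<close> of \<open>T (s' - s) \<phi> - \<phi>\<close>. Boundedness up to
  time t + 1 therefore turns right continuity at 0 into continuity from both sides.\<close>

lemma C0_semigroup_orbit_continuous:
  assumes T: "C0_semigroup N d T" and \<phi>: "\<phi> \<in> L1S N d" and t: "0 \<le> t" and e: "0 < e"
  obtains \<delta> where "0 < \<delta>" "\<And>s. 0 \<le> s \<Longrightarrow> \<bar>s - t\<bar> < \<delta> \<Longrightarrow> L1_dist N d (T s \<phi>) (T t \<phi>) < e"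
proof -
  note TL = C0_semigroup_closed[OF T]
  obtain M where M: "0 < M"
    "\<And>s \<phi>. 0 \<le> s \<Longrightarrow> s \<le> t + 1 \<Longrightarrow> \<phi> \<in> L1S N d \<Longrightarrow> L1_norm N d (T s \<phi>) \<le> M * L1_norm N d \<phi>"
    by (rule C0_semigroup_bounded_on[OF T]) blast
  have "eventually (\<lambda>s. L1_dist N d (T s \<phi>) \<phi> < e / M) (at_right 0)"
    using C0_semigroup_tendsto[OF T \<phi>] by (rule order_tendstoD) (use e M in simp)
  then obtain b where b: "0 < b" "\<And>s. 0 < s \<Longrightarrow> s < b \<Longrightarrow> L1_dist N d (T s \<phi>) \<phi> < e / M"
    by (auto simp: eventually_at_right_field)
  have less: "L1_dist N d (T s' \<phi>) (T s \<phi>) < e" if "0 \<le> s" "s < s'" "s' - s < b" "s \<le> t + 1" for s s'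
  proof -
    have "L1_dist N d (T s' \<phi>) (T s \<phi>) = L1_dist N d (T s (T (s' - s) \<phi>)) (T s \<phi>)"
      using C0_semigroup_add[OF T \<phi>, of s "s' - s"] that \<phi> by (intro L1_dist_cong L1_dist_self TL) auto
    also have "\<dots> = L1_norm N d (T s (\<lambda>i x. T (s' - s) \<phi> i x - \<phi> i x))"
      using that \<phi> by (intro bounded_operator_diff[symmetric] C0_semigroup_bounded[OF T] TL) auto
    also have "\<dots> \<le> M * L1_dist N d (T (s' - s) \<phi>) \<phi>"
      unfolding L1_dist_def using that \<phi> by (intro M L1S_intros TL) auto
    also have "\<dots> < M * (e / M)" using b(2)[of "s' - s"] that M(1) by (intro mult_strict_left_mono) auto
    finally show ?thesis using M(1) by simp
  qed
  show ?thesis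
  proof (rule that[of "min b 1"])
    fix s assume s: "0 \<le> s" "\<bar>s - t\<bar> < min b 1"
    show "L1_dist N d (T s \<phi>) (T t \<phi>) < e"
      using less[of s t] less[of t s] s t e L1_dist_commute[of N d "T s \<phi>"]
      by (cases s t rule: linorder_cases) (auto simp: L1_dist_self)
  qed (use b in auto)
qed

section \<open>Generator values along orbits and on linear combinations\<close>

lemma has_generator_value_unique:
  assumes T: "C0_semigroup N d T" and \<phi>: "\<phi> \<in> L1S N d"
    and 1: "has_generator_value N d T \<phi> \<psi>" and 2: "has_generator_value N d T \<phi> \<psi>'"
  shows "L1_dist N d \<psi> \<psi>' = 0"
proof -
  let ?q = "\<lambda>t i x. (T t \<phi> i x - \<phi> i x) / t"
  have "((\<lambda>t. L1_dist N d (?q t) \<psi> + L1_dist N d (?q t) \<psi>') \<longlongrightarrow> 0 + 0) (at_right 0)"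
    using 1 2 by (intro tendsto_add) (auto simp: has_generator_value_def)
  moreover have "eventually (\<lambda>t. L1_dist N d \<psi> \<psi>' \<le> L1_dist N d (?q t) \<psi> + L1_dist N d (?q t) \<psi>') (at_right 0)"
    using eventually_at_right_less
  proof eventually_elim
    case (elim t)
    have "?q t \<in> L1S N d" using elim by (intro L1S_intros C0_semigroup_closed[OF T] \<phi>) auto
    then show ?case
      using L1_dist_triangle[of \<psi> N d "?q t" \<psi>'] 1 2 L1_dist_commute[of N d \<psi>]
      by (auto simp: has_generator_value_def)
  qed
  ultimately have "L1_dist N d \<psi> \<psi>' \<le> 0 + 0"
    by (rule tendsto_lowerbound) simp
  then show ?thesis using L1_dist_nonneg[of N d \<psi> \<psi>'] by simp
qed

text \<open>Up to null sets the difference quotient of \<open>T r \<phi>\<close> is the image under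
  \<open>T r\<close> of the difference quotient of \<phi>, and \<open>T r\<close> is
  bounded.\<close>

lemma has_generator_value_semigroup:
  assumes T: "C0_semigroup N d T" and \<phi>: "\<phi> \<in> L1S N d" and g: "has_generator_value N d T \<phi> \<psi>" and r: "0 \<le> r"
  shows "has_generator_value N d T (T r \<phi>) (T r \<psi>)"
proof -
  note TL = C0_semigroup_closed[OF T]
  have \<psi>: "\<psi> \<in> L1S N d" using g by (simp add: has_generator_value_def)
  obtain C where C: "\<And>\<phi>. \<phi> \<in> L1S N d \<Longrightarrow> L1_norm N d (T r \<phi>) \<le> C * L1_norm N d \<phi>"
    using C0_semigroup_bounded[OF T r] unfolding bounded_operator_L1_def by blast
  let ?q = "\<lambda>t i x. (T t \<phi> i x - \<phi> i x) / t"
  let ?p = "\<lambda>t i x. (T t (T r \<phi>) i x - T r \<phi> i x) / t"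
  have "((\<lambda>t. C * L1_dist N d (?q t) \<psi>) \<longlongrightarrow> C * 0) (at_right 0)"
    using g by (intro tendsto_mult_left) (auto simp: has_generator_value_def)
  moreover have "eventually (\<lambda>t. L1_dist N d (?p t) (T r \<psi>) \<le> C * L1_dist N d (?q t) \<psi>) (at_right 0)"
    using eventually_at_right_less
  proof eventually_elim
    case (elim t)
    have qL: "?q t \<in> L1S N d" using elim by (intro L1S_intros TL \<phi>) auto
    have "L1_dist N d (T r (T t \<phi>)) (T (r + t) \<phi>) = 0"
      using C0_semigroup_add[OF T \<phi> r, of t] elim by (simp add: L1_dist_commute)
    also have "L1_dist N d (T r (T t \<phi>)) (T (r + t) \<phi>) = L1_dist N d (T r (T t \<phi>)) (T t (T r \<phi>))"
      using C0_semigroup_add[OF T \<phi>, of t r] elim r \<phi>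
      by (intro L1_dist_cong L1_dist_self TL) (auto simp: add.commute)
    finally have comm: "L1_dist N d (T r (T t \<phi>)) (T t (T r \<phi>)) = 0" .
    have "L1_dist N d (?p t) (T r (?q t)) = 0"
    proof -
      have 1: "L1_dist N d (T r (?q t)) (\<lambda>i x. 1/t * T r (T t \<phi>) i x + (-1/t) * T r \<phi> i x) = 0"
        using bounded_operator_lincomb[OF C0_semigroup_bounded[OF T r] TL[OF less_imp_le \<phi>] \<phi>, of t "1/t" "-1/t"] elim
        by (simp add: diff_divide_distrib)
      have "L1_dist N d (?p t) (\<lambda>i x. 1/t * T r (T t \<phi>) i x + (-1/t) * T r \<phi> i x) =
        L1_norm N d (\<lambda>i x. 1/t * (T t (T r \<phi>) i x - T r (T t \<phi>) i x))"
        unfolding L1_dist_def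
        by (rule arg_cong[where f="L1_norm N d"]) (simp add: fun_eq_iff diff_divide_distrib)
      also have "\<dots> = 0" unfolding L1_norm_scale using comm by (simp add: L1_dist_commute flip: L1_dist_def)
      finally show ?thesis
        using L1_dist_cong[OF L1_dist_self 1, of "?p t"] elim r \<phi> qL by (simp add: L1S_intros TL)
    qed
    then have "L1_dist N d (?p t) (T r \<psi>) = L1_dist N d (T r (?q t)) (T r \<psi>)"
      using elim r \<phi> \<psi> qL by (intro L1_dist_cong L1_dist_self L1S_intros TL) auto
    also have "\<dots> = L1_norm N d (T r (\<lambda>i x. ?q t i x - \<psi> i x))"
      by (rule bounded_operator_diff[OF C0_semigroup_bounded[OF T r] qL \<psi>, symmetric])
    also have "\<dots> \<le> C * L1_dist N d (?q t) \<psi>"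
      unfolding L1_dist_def by (intro C L1S_diff qL \<psi>)
    finally show ?case .
  qed
  ultimately have "((\<lambda>t. L1_dist N d (?p t) (T r \<psi>)) \<longlongrightarrow> 0) (at_right 0)"
    by (rule tendsto_zero_dominated) (simp_all add: L1_dist_nonneg)
  then show ?thesis using TL[OF r \<psi>] by (simp add: has_generator_value_def)
qed

lemma has_generator_value_lincomb:
  assumes T: "C0_semigroup N d T" and \<phi>: "\<phi> \<in> L1S N d" "has_generator_value N d T \<phi> \<psi>"
    and \<phi>': "\<phi>' \<in> L1S N d" "has_generator_value N d T \<phi>' \<psi>'"
  shows "has_generator_value N d T (\<lambda>i x. a * \<phi> i x + b * \<phi>' i x) (\<lambda>i x. a * \<psi> i x + b * \<psi>' i x)"
proof -
  note TL = C0_semigroup_closed[OF T]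
  have \<psi>: "\<psi> \<in> L1S N d" "\<psi>' \<in> L1S N d" using assms by (auto simp: has_generator_value_def)
  let ?f = "\<lambda>i x. a * \<phi> i x + b * \<phi>' i x"
  let ?g = "\<lambda>i x. a * \<psi> i x + b * \<psi>' i x"
  let ?q = "\<lambda>\<phi> t i x. (T t \<phi> i x - \<phi> i x) / t"
  have "((\<lambda>t. \<bar>a\<bar> * L1_dist N d (?q \<phi> t) \<psi> + \<bar>b\<bar> * L1_dist N d (?q \<phi>' t) \<psi>') \<longlongrightarrow> \<bar>a\<bar> * 0 + \<bar>b\<bar> * 0) (at_right 0)"
    using assms by (intro tendsto_add tendsto_mult_left) (auto simp: has_generator_value_def)
  moreover have "eventually (\<lambda>t. L1_dist N d (?q ?f t) ?g \<le>
      \<bar>a\<bar> * L1_dist N d (?q \<phi> t) \<psi> + \<bar>b\<bar> * L1_dist N d (?q \<phi>' t) \<psi>') (at_right 0)"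
    using eventually_at_right_less
  proof eventually_elim
    case (elim t)
    then have t: "0 \<le> t" by simp
    let ?h = "\<lambda>i x. (a * T t \<phi> i x + b * T t \<phi>' i x - ?f i x) / t"
    have "L1_dist N d (?q ?f t) ?h = L1_norm N d (\<lambda>i x. 1/t * (T t ?f i x - (a * T t \<phi> i x + b * T t \<phi>' i x)))"
      unfolding L1_dist_def
      by (rule arg_cong[where f="L1_norm N d"]) (simp add: fun_eq_iff diff_divide_distrib)
    also have "\<dots> = 0"
      unfolding L1_norm_scale
      using bounded_operator_lincomb[OF C0_semigroup_bounded[OF T t] \<phi>(1) \<phi>'(1)] by (simp flip: L1_dist_def)
    finally have "L1_dist N d (?q ?f t) ?g = L1_dist N d ?h ?g"
      by (intro L1_dist_cong L1_dist_self L1S_intros TL \<phi>(1) \<phi>'(1) \<psi> t)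
    also have "\<dots> = L1_norm N d (\<lambda>i x. a * (?q \<phi> t i x - \<psi> i x) + b * (?q \<phi>' t i x - \<psi>' i x))"
      unfolding L1_dist_def by (simp add: algebra_simps diff_divide_distrib add_divide_distrib)
    also have "\<dots> \<le> \<bar>a\<bar> * L1_dist N d (?q \<phi> t) \<psi> + \<bar>b\<bar> * L1_dist N d (?q \<phi>' t) \<psi>'"
      unfolding L1_dist_def L1_norm_scale[symmetric]
      by (intro L1_norm_add_le L1S_intros TL \<phi>(1) \<phi>'(1) \<psi> t)
    finally show ?case .
  qed
  ultimately have "((\<lambda>t. L1_dist N d (?q ?f t) ?g) \<longlongrightarrow> 0) (at_right 0)"
    by (rule tendsto_zero_dominated) (simp_all add: L1_dist_nonneg)
  then show ?thesis using \<psi> by (simp add: has_generator_value_def L1S_intros)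
qed

lemma has_generator_value_sum:
  assumes T: "C0_semigroup N d T" and "finite I"
    and "\<And>k. k \<in> I \<Longrightarrow> \<phi> k \<in> L1S N d" "\<And>k. k \<in> I \<Longrightarrow> has_generator_value N d T (\<phi> k) (\<psi> k)"
  shows "has_generator_value N d T (\<lambda>i x. \<Sum>k\<in>I. a k * \<phi> k i x) (\<lambda>i x. \<Sum>k\<in>I. a k * \<psi> k i x)"
  using assms(2-)
proof (induction I)
  case empty
  have zero: "L1_norm N d (T t (\<lambda>i x. 0)) = 0" if "0 \<le> t" for t
    using bounded_operator_scale[OF C0_semigroup_bounded[OF T that] L1S_zero, of 0] by simp
  have "eventually (\<lambda>t. L1_dist N d (\<lambda>i x. (T t (\<lambda>i x. 0) i x - 0) / t) (\<lambda>i x. 0) = 0) (at_right 0)"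
  proof (rule eventually_mono[OF eventually_at_right_less[of 0]])
    fix t :: real assume "0 < t"
    then have "L1_norm N d (\<lambda>i x. 1/t * T t (\<lambda>i x. 0) i x) = 0"
      unfolding L1_norm_scale using zero by simp
    then show "L1_dist N d (\<lambda>i x. (T t (\<lambda>i x. 0) i x - 0) / t) (\<lambda>i x. 0) = 0"
      by (simp add: L1_dist_zero_right)
  qed
  then show ?case by (simp add: has_generator_value_def L1S_zero tendsto_eventually)
next
  case (insert k I)
  have "has_generator_value N d T (\<lambda>i x. a k * \<phi> k i x + 1 * (\<Sum>k\<in>I. a k * \<phi> k i x))
      (\<lambda>i x. a k * \<psi> k i x + 1 * (\<Sum>k\<in>I. a k * \<psi> k i x))"
    using insert by (intro has_generator_value_lincomb[OF T]) (auto intro!: L1S_intros)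
  then show ?case using insert by simp
qed

text \<open>For \<open>\<phi>\<close> in the domain, dissipativity is applied to backward differences of the orbit of \<open>\<phi>\<close>.\<close>

lemma dissipative_imp_contraction:
  assumes gen: "generates N d D A T"
    and diss: "\<And>\<phi> h. \<phi> \<in> D \<Longrightarrow> 0 < h \<Longrightarrow> L1_norm N d \<phi> \<le> L1_norm N d (\<lambda>i x. \<phi> i x - h * A \<phi> i x)"
    and dense: "\<And>\<phi> e. \<phi> \<in> L1S N d \<Longrightarrow> 0 < e \<Longrightarrow> \<exists>\<psi>\<in>D. L1_dist N d \<phi> \<psi> < e"
    and t: "0 \<le> t" and \<phi>: "\<phi> \<in> L1S N d"
  shows "L1_norm N d (T t \<phi>) \<le> L1_norm N d \<phi>"
proof -
  have T: "C0_semigroup N d T" using gen by (simp add: generates_def)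
  note TL = C0_semigroup_closed[OF T]
  have D: "D = {\<phi> \<in> L1S N d. \<exists>\<psi>. has_generator_value N d T \<phi> \<psi>}"
    and A: "\<And>\<phi>. \<phi> \<in> D \<Longrightarrow> has_generator_value N d T \<phi> (A \<phi>)"
    using gen by (auto simp: generates_def)
  obtain M where M: "0 < M"
    "\<And>s \<phi>. 0 \<le> s \<Longrightarrow> s \<le> t \<Longrightarrow> \<phi> \<in> L1S N d \<Longrightarrow> L1_norm N d (T s \<phi>) \<le> M * L1_norm N d \<phi>"
    by (rule C0_semigroup_bounded_on[OF T]) blast
  have contr_D: "L1_norm N d (T t \<phi>) \<le> L1_norm N d \<phi>" if \<phi>D: "\<phi> \<in> D" for \<phi>
  proof -
    have \<phi>: "\<phi> \<in> L1S N d" using \<phi>D D by blast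
    have A\<phi>: "A \<phi> \<in> L1S N d" using A[OF \<phi>D] by (simp add: has_generator_value_def)
    \<comment> \<open>Time runs backwards and the sign is reversed, so backward differences of the
      orbit become forward differences of \<open>f\<close>, and \<open>f t \<le> f 0\<close> is the
      contraction estimate.\<close>
    define f where "f s = - L1_norm N d (T (t - s) \<phi>)" for s
    have "f t \<le> f 0"
    proof (rule nonincreasing_of_upper_right_derivative[OF t])
      show "continuous_on {0..t} f"
        unfolding continuous_on_iff
      proof (intro ballI allI impI)
        fix s e :: real assume s: "s \<in> {0..t}" and e: "0 < e"
        obtain \<delta> where \<delta>: "0 < \<delta>"
          "\<And>r. 0 \<le> r \<Longrightarrow> \<bar>r - (t - s)\<bar> < \<delta> \<Longrightarrow> L1_dist N d (T r \<phi>) (T (t - s) \<phi>) < e"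
          using C0_semigroup_orbit_continuous[OF T \<phi> _ e, of "t - s"] s by auto
        have "dist (f s') (f s) < e" if "s' \<in> {0..t}" "dist s' s < \<delta>" for s'
        proof -
          have 1: "L1_dist N d (T (t - s') \<phi>) (T (t - s) \<phi>) < e"
            using that by (intro \<delta>) (auto simp: dist_real_def)
          have "T (t - s') \<phi> \<in> L1S N d" "T (t - s) \<phi> \<in> L1S N d" using that s by (auto intro!: TL \<phi>)
          then show ?thesis
            using 1 L1_norm_le_dist[of "T (t - s') \<phi>" N d "T (t - s) \<phi>"]
              L1_norm_le_dist[of "T (t - s) \<phi>" N d "T (t - s') \<phi>"] L1_dist_commute[of N d "T (t - s') \<phi>"]
            by (simp add: f_def dist_real_def)
        qed
        then show "\<exists>\<delta>>0. \<forall>s'\<in>{0..t}. dist s' s < \<delta> \<longrightarrow> dist (f s') (f s) < e" using \<delta>(1) by blast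
      qed
    next
      fix s e :: real assume s: "0 \<le> s" "s < t" and e: "0 < e"
      define r where "r = t - s"
      define y where "y = T r \<phi>"
      have r: "0 < r" "r \<le> t" using s by (auto simp: r_def)
      have yL: "y \<in> L1S N d" unfolding y_def using r by (intro TL \<phi>) auto
      have gy: "has_generator_value N d T y (T r (A \<phi>))"
        unfolding y_def using r by (intro has_generator_value_semigroup[OF T \<phi> A[OF \<phi>D]]) auto
      then have yD: "y \<in> D" using yL D by blast
      have AyL: "A y \<in> L1S N d" using A[OF yD] by (simp add: has_generator_value_def)
      have Ay: "L1_dist N d (A y) (T r (A \<phi>)) = 0"
        by (rule has_generator_value_unique[OF T yL A[OF yD] gy])
      \<comment> \<open>Two errors of this size, multiplied by \<open>h\<close> and then by the
        bound \<open>M\<close> of \<open>T (r - h)\<close>, add up to \<open>e * h\<close>.\<close>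
      have epos: "0 < e / (2 * M)" using e M(1) by simp
      have "eventually (\<lambda>h. L1_dist N d (\<lambda>i x. (T h \<phi> i x - \<phi> i x) / h) (A \<phi>) < e / (2 * M)) (at_right 0)"
        "eventually (\<lambda>h. L1_dist N d (T h (A \<phi>)) (A \<phi>) < e / (2 * M)) (at_right 0)"
        using order_tendstoD(2)[OF _ epos] A[OF \<phi>D] C0_semigroup_tendsto[OF T A\<phi>]
        unfolding has_generator_value_def by blast+
      moreover have "eventually (\<lambda>h::real. 0 < h) (at_right 0)" by (rule eventually_at_right_less)
      ultimately show "eventually (\<lambda>h. s + h \<le> t \<longrightarrow> f (s + h) \<le> f s + e * h) (at_right 0)"
      proof eventually_elim
        case (elim h)
        show ?case
        proof
          assume "s + h \<le> t"
          then have h: "0 < h" "0 \<le> r - h" using elim by (auto simp: r_def)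
          let ?z = "T (r - h) \<phi>"
          \<comment> \<open>Up to null sets \<open>y\<close> is
            \<open>T (r - h) (T h \<phi>)\<close> and \<open>A y\<close> is
            \<open>T (r - h) (T h (A \<phi>))\<close>. So \<open>y - h * A y\<close> differs from
            the earlier point \<open>?z\<close> of the orbit by the image of \<open>?v\<close> under
            \<open>T (r - h)\<close>, and \<open>?v\<close> is of smaller order than
            \<open>h\<close>.\<close>
          let ?v = "\<lambda>i x. T h \<phi> i x - \<phi> i x - h * T h (A \<phi>) i x"
          have zL: "?z \<in> L1S N d" by (intro TL \<phi> h)
          have L: "T h \<phi> \<in> L1S N d" "T h (A \<phi>) \<in> L1S N d" using h by (auto intro!: TL \<phi> A\<phi>)
          have vL: "?v \<in> L1S N d" using L \<phi> by (intro L1S_intros)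
          note B = C0_semigroup_bounded[OF T h(2)]
          have 1: "L1_dist N d y (T (r - h) (T h \<phi>)) = 0"
            using C0_semigroup_add[OF T \<phi> h(2), of h] h by (simp add: y_def)
          have 2: "L1_dist N d (A y) (T (r - h) (T h (A \<phi>))) = 0"
          proof -
            have "L1_dist N d (T r (A \<phi>)) (T (r - h) (T h (A \<phi>))) = 0"
              using C0_semigroup_add[OF T A\<phi> h(2), of h] h by simp
            then show ?thesis
              using L1_dist_triangle[OF AyL TL[OF less_imp_le[OF r(1)] A\<phi>] TL[OF h(2) L(2)]] Ay
                L1_dist_nonneg[of N d "A y" "T (r - h) (T h (A \<phi>))"] by linarith
          qed
          let ?w = "\<lambda>i x. T (r - h) (T h \<phi>) i x - ?z i x - h * T (r - h) (T h (A \<phi>)) i x"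
          have wL: "?w \<in> L1S N d" by (intro L1S_intros zL TL[OF h(2)] L)
          have 3: "L1_dist N d (\<lambda>i x. y i x - ?z i x - h * A y i x) ?w = 0"
          proof -
            have "L1_dist N d (\<lambda>i x. y i x - ?z i x - h * A y i x) ?w =
              L1_norm N d (\<lambda>i x. (y i x - T (r - h) (T h \<phi>) i x) + (- h) * (A y i x - T (r - h) (T h (A \<phi>)) i x))"
              unfolding L1_dist_def
              by (rule arg_cong[where f="L1_norm N d"]) (simp add: fun_eq_iff algebra_simps)
            also have "\<dots> \<le> L1_norm N d (\<lambda>i x. y i x - T (r - h) (T h \<phi>) i x) +
                L1_norm N d (\<lambda>i x. (- h) * (A y i x - T (r - h) (T h (A \<phi>)) i x))"
              by (intro L1_norm_add_le L1S_intros yL AyL TL[OF h(2)] L)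
            also have "\<dots> = 0" using 1 2 unfolding L1_norm_scale by (simp flip: L1_dist_def)
            finally show ?thesis using L1_dist_nonneg[of N d "\<lambda>i x. y i x - ?z i x - h * A y i x" ?w] by linarith
          qed
          have 4: "L1_dist N d (T (r - h) ?v) ?w = 0"
          proof -
            define p where "p = (\<lambda>i x. T h \<phi> i x - \<phi> i x)"
            define W where "W = (\<lambda>i x. T (r - h) p i x + (- h) * T (r - h) (T h (A \<phi>)) i x)"
            have pL: "p \<in> L1S N d" unfolding p_def by (intro L1S_intros L \<phi>)
            have WL: "W \<in> L1S N d" unfolding W_def by (intro L1S_intros TL[OF h(2)] pL L)
            have a: "L1_dist N d (T (r - h) ?v) W = 0"
              using bounded_operator_lincomb[OF B pL L(2), of 1 "- h"] by (simp add: p_def W_def)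
            have b: "L1_dist N d (T (r - h) p) (\<lambda>i x. T (r - h) (T h \<phi>) i x - ?z i x) = 0"
              using bounded_operator_lincomb[OF B L(1) \<phi>, of 1 "- 1"] by (simp add: p_def)
            have "L1_dist N d W ?w = L1_dist N d (T (r - h) p) (\<lambda>i x. T (r - h) (T h \<phi>) i x - ?z i x)"
              unfolding L1_dist_def W_def
              by (rule arg_cong[where f="L1_norm N d"]) (simp add: fun_eq_iff algebra_simps)
            then show ?thesis
              using L1_dist_triangle[OF TL[OF h(2) vL] WL wL] a b
                L1_dist_nonneg[of N d "T (r - h) ?v" ?w] by linarith
          qed
          have vb: "L1_norm N d ?v = L1_norm N d (\<lambda>i x. h * ((T h \<phi> i x - \<phi> i x) / h - A \<phi> i x) +
              (- h) * (T h (A \<phi>) i x - A \<phi> i x))"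
            using h by (intro arg_cong[where f="L1_norm N d"]) (simp add: fun_eq_iff field_simps)
          have "L1_norm N d ?v \<le> L1_norm N d (\<lambda>i x. h * ((T h \<phi> i x - \<phi> i x) / h - A \<phi> i x)) +
              L1_norm N d (\<lambda>i x. (- h) * (T h (A \<phi>) i x - A \<phi> i x))"
            unfolding vb by (intro L1_norm_add_le L1S_intros L \<phi> A\<phi>)
          also have "\<dots> \<le> h * (e / (2 * M)) + h * (e / (2 * M))"
            unfolding L1_norm_scale using h elim by (intro add_mono mult_mono) (auto simp: L1_dist_def L1_norm_nonneg)
          finally have 5: "L1_norm N d ?v \<le> h * e / M" using M(1) by (simp add: field_simps)
          have "L1_norm N d ?w = L1_norm N d (T (r - h) ?v)"
            by (rule L1_norm_cong[OF 4 TL[OF h(2) vL] wL, symmetric])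
          also have "\<dots> \<le> M * L1_norm N d ?v" using r h by (intro M(2) vL) auto
          also have "\<dots> \<le> M * (h * e / M)" using 5 M(1) by (intro mult_left_mono) auto
          also have "\<dots> = h * e" using M(1) by simp
          finally have 6: "L1_norm N d (\<lambda>i x. y i x - ?z i x - h * A y i x) \<le> h * e"
            using L1_norm_cong[OF 3 L1S_diff[OF L1S_diff[OF yL zL] L1S_scale[OF AyL]] wL] by linarith
          \<comment> \<open>Dissipativity enters only here: it replaces \<open>y\<close> by
            \<open>y - h * A y\<close>, which nearly is the orbit at the earlier time r - h.\<close>
          have "L1_norm N d y \<le> L1_norm N d (\<lambda>i x. y i x - h * A y i x)" by (rule diss[OF yD h(1)])
          also have "\<dots> \<le> L1_norm N d ?z + L1_norm N d (\<lambda>i x. y i x - ?z i x - h * A y i x)"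
            using L1_norm_add_le[OF zL L1S_diff[OF L1S_diff[OF yL zL] L1S_scale[OF AyL, of h]]] by simp
          finally have "L1_norm N d y \<le> L1_norm N d ?z + h * e" using 6 by simp
          then show "f (s + h) \<le> f s + e * h" by (simp add: f_def y_def r_def algebra_simps)
        qed
      qed
    qed
    then show ?thesis
      using L1_norm_cong[OF C0_semigroup_zero[OF T \<phi>] TL[OF _ \<phi>] \<phi>] by (simp add: f_def)
  qed
  \<comment> \<open>Extension from the domain by density; the a priori bound \<open>M\<close>
    controls the image of the approximation error, hence the factor M + 1.\<close>
  have "L1_norm N d (T t \<phi>) \<le> L1_norm N d \<phi> + e" if e: "0 < e" for e
  proof -
    obtain \<psi> where \<psi>: "\<psi> \<in> D" "L1_dist N d \<phi> \<psi> < e / (M + 1)"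
      using dense[OF \<phi>, of "e / (M + 1)"] e M(1) by auto
    have \<psi>L: "\<psi> \<in> L1S N d" using \<psi> D by blast
    have "L1_dist N d (T t \<phi>) (T t \<psi>) \<le> M * L1_dist N d \<phi> \<psi>"
      using M(2)[OF t order_refl L1S_diff[OF \<phi> \<psi>L]] bounded_operator_diff[OF C0_semigroup_bounded[OF T t] \<phi> \<psi>L]
      by (simp add: L1_dist_def)
    moreover have "L1_norm N d \<psi> \<le> L1_norm N d \<phi> + L1_dist N d \<phi> \<psi>"
      using L1_norm_le_dist[OF \<psi>L \<phi>] by (simp add: L1_dist_commute)
    moreover have "L1_norm N d (T t \<phi>) \<le> L1_norm N d (T t \<psi>) + L1_dist N d (T t \<phi>) (T t \<psi>)"
      by (intro L1_norm_le_dist TL t \<phi> \<psi>L)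
    ultimately have "L1_norm N d (T t \<phi>) \<le> L1_norm N d \<phi> + (M + 1) * L1_dist N d \<phi> \<psi>"
      using contr_D[OF \<psi>(1)] by (simp add: algebra_simps)
    also have "(M + 1) * L1_dist N d \<phi> \<psi> \<le> (M + 1) * (e / (M + 1))"
      using \<psi>(2) M(1) by (intro mult_left_mono) auto
    also have "\<dots> = e" using M(1) by simp
    finally show ?thesis by simp
  qed
  then show ?thesis by (rule field_le_epsilon)
qed

text \<open>With \<open>u s = \<Sum>k. a k s \<phi>\<^sub>k\<close>, the function \<open>s \<mapsto> T (t - s) (u s)\<close> joins \<open>T t (u 0)\<close> to \<open>u t\<close> with speed at
  most \<open>E' s\<close>.\<close>

lemma approximate_orbit:
  fixes a a' :: "'k \<Rightarrow> real \<Rightarrow> real"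
  assumes T: "C0_semigroup N d T"
    and contr: "\<And>t \<phi>. 0 \<le> t \<Longrightarrow> \<phi> \<in> L1S N d \<Longrightarrow> L1_norm N d (T t \<phi>) \<le> L1_norm N d \<phi>"
    and I: "finite I"
    and \<phi>: "\<And>k. k \<in> I \<Longrightarrow> \<phi> k \<in> L1S N d" "\<And>k. k \<in> I \<Longrightarrow> has_generator_value N d T (\<phi> k) (\<psi> k)"
    and a: "\<And>k s. k \<in> I \<Longrightarrow> (a k has_real_derivative a' k s) (at s)"
    and E: "\<And>s. (E has_real_derivative E' s) (at s)"
    and bd: "\<And>s. 0 \<le> s \<Longrightarrow> s \<le> t \<Longrightarrow>
      L1_dist N d (\<lambda>i x. \<Sum>k\<in>I. a' k s * \<phi> k i x) (\<lambda>i x. \<Sum>k\<in>I. a k s * \<psi> k i x) \<le> E' s"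
    and t: "0 \<le> t"
  shows "L1_dist N d (T t (\<lambda>i x. \<Sum>k\<in>I. a k 0 * \<phi> k i x)) (\<lambda>i x. \<Sum>k\<in>I. a k t * \<phi> k i x) \<le> E t - E 0"
proof -
  define u where "u s = (\<lambda>i x. \<Sum>k\<in>I. a k s * \<phi> k i x)" for s
  define u' where "u' s = (\<lambda>i x. \<Sum>k\<in>I. a' k s * \<phi> k i x)" for s
  define v where "v s = (\<lambda>i x. \<Sum>k\<in>I. a k s * \<psi> k i x)" for s
  have \<psi>: "\<psi> k \<in> L1S N d" if "k \<in> I" for k using \<phi>(2)[OF that] by (simp add: has_generator_value_def)
  have uL: "u s \<in> L1S N d" and u'L: "u' s \<in> L1S N d" and vL: "v s \<in> L1S N d" for s
    unfolding u_def u'_def v_def by (intro L1S_intros \<phi>(1) \<psi>; assumption)+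
  note TL = C0_semigroup_closed[OF T]
  have gen: "has_generator_value N d T (u s) (v s)" for s
    unfolding u_def v_def by (rule has_generator_value_sum[OF T I \<phi>])
  have cd: "L1_dist N d (T s \<phi>) (T s \<psi>) \<le> L1_dist N d \<phi> \<psi>"
    if "0 \<le> s" "\<phi> \<in> L1S N d" "\<psi> \<in> L1S N d" for s \<phi> \<psi>
    using contr[OF that(1) L1S_diff[OF that(2,3)]] bounded_operator_diff[OF C0_semigroup_bounded[OF T that(1)] that(2,3)]
    by (simp add: L1_dist_def)
  have quot: "((\<lambda>h. L1_dist N d (\<lambda>i x. (u (s + h) i x - u s i x) / h) (u' s)) \<longlongrightarrow> 0) (at_right 0)" for s
  proof (rule tendsto_zero_dominated)
    show "((\<lambda>h. \<Sum>k\<in>I. \<bar>(a k (s + h) - a k s) / h - a' k s\<bar> * L1_norm N d (\<phi> k)) \<longlongrightarrow>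
      (\<Sum>k\<in>I. \<bar>a' k s - a' k s\<bar> * L1_norm N d (\<phi> k))) (at_right 0)"
    proof (intro tendsto_sum tendsto_mult tendsto_const tendsto_rabs tendsto_diff)
      fix k assume "k \<in> I"
      then have "((\<lambda>h. (a k (s + h) - a k s) / h) \<longlongrightarrow> a' k s) (at 0)"
        using a by (simp add: DERIV_def)
      then show "((\<lambda>h. (a k (s + h) - a k s) / h) \<longlongrightarrow> a' k s) (at_right 0)"
        by (rule tendsto_within_subset) simp
    qed
    show "\<forall>\<^sub>F h in at_right 0. L1_dist N d (\<lambda>i x. (u (s + h) i x - u s i x) / h) (u' s) \<le>
      (\<Sum>k\<in>I. \<bar>(a k (s + h) - a k s) / h - a' k s\<bar> * L1_norm N d (\<phi> k))"
    proof (rule always_eventually, rule allI)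
      fix h
      have "L1_dist N d (\<lambda>i x. (u (s + h) i x - u s i x) / h) (u' s) =
        L1_norm N d (\<lambda>i x. \<Sum>k\<in>I. ((a k (s + h) - a k s) / h - a' k s) * \<phi> k i x)"
        unfolding L1_dist_def u_def u'_def
        by (rule arg_cong[where f="L1_norm N d"])
          (simp add: fun_eq_iff sum_subtractf[symmetric] sum_divide_distrib algebra_simps diff_divide_distrib)
      then show "L1_dist N d (\<lambda>i x. (u (s + h) i x - u s i x) / h) (u' s) \<le>
        (\<Sum>k\<in>I. \<bar>(a k (s + h) - a k s) / h - a' k s\<bar> * L1_norm N d (\<phi> k))"
        using L1_norm_sum_le[OF I \<phi>(1)] by simp
    qed
  qed (simp_all add: L1_dist_nonneg)
  have ucont: "\<exists>\<delta>>0. \<forall>s'. \<bar>s' - s\<bar> < \<delta> \<longrightarrow> L1_dist N d (u s') (u s) < e" if e: "0 < e" for s e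
  proof -
    have "((\<lambda>s'. \<Sum>k\<in>I. \<bar>a k s' - a k s\<bar> * L1_norm N d (\<phi> k)) \<longlongrightarrow>
      (\<Sum>k\<in>I. \<bar>a k s - a k s\<bar> * L1_norm N d (\<phi> k))) (at s)"
      using DERIV_isCont[OF a] by (intro tendsto_intros) (auto simp: isCont_def)
    then have "eventually (\<lambda>s'. (\<Sum>k\<in>I. \<bar>a k s' - a k s\<bar> * L1_norm N d (\<phi> k)) < e) (at s)"
      by (rule order_tendstoD(2)) (use e in simp)
    then obtain \<delta> where \<delta>: "\<delta> > 0" "\<And>s'. s' \<noteq> s \<Longrightarrow> dist s' s < \<delta> \<Longrightarrow> (\<Sum>k\<in>I. \<bar>a k s' - a k s\<bar> * L1_norm N d (\<phi> k)) < e"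
      unfolding eventually_at by auto
    have "L1_dist N d (u s') (u s) < e" if "\<bar>s' - s\<bar> < \<delta>" for s'
    proof (cases "s' = s")
      case True
      then show ?thesis using e by (simp add: L1_dist_self)
    next
      case False
      have "L1_dist N d (u s') (u s) = L1_norm N d (\<lambda>i x. \<Sum>k\<in>I. (a k s' - a k s) * \<phi> k i x)"
        unfolding L1_dist_def u_def
        by (rule arg_cong[where f="L1_norm N d"]) (simp add: fun_eq_iff sum_subtractf[symmetric] algebra_simps)
      also have "\<dots> \<le> (\<Sum>k\<in>I. \<bar>a k s' - a k s\<bar> * L1_norm N d (\<phi> k))" by (rule L1_norm_sum_le[OF I \<phi>(1)])
      also have "\<dots> < e" using \<delta>(2)[OF False] that by (simp add: dist_real_def)
      finally show ?thesis .
    qed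
    then show ?thesis using \<delta>(1) by blast
  qed
  \<comment> \<open>The distance that the connecting curve has travelled from its starting point;
    \<open>g - E\<close> is shown to be nonincreasing.\<close>
  define g where "g s = L1_dist N d (T (t - s) (u s)) (T t (u 0))" for s
  have gdiff: "g s' \<le> g s + L1_dist N d (T (t - s') (u s')) (T (t - s) (u s))" if "s \<le> t" "s' \<le> t" for s s'
    unfolding g_def using that t
    by (subst add.commute) (intro L1_dist_triangle TL uL; simp)
  have "g t - E t \<le> g 0 - E 0"
  proof (rule nonincreasing_of_upper_right_derivative[OF t])
    have cg: "continuous_on {0..t} g"
      unfolding continuous_on_iff
    proof (intro ballI allI impI)
      fix s e :: real assume s: "s \<in> {0..t}" and e: "0 < e"
      obtain \<delta>1 where \<delta>1: "0 < \<delta>1"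
        "\<And>r. 0 \<le> r \<Longrightarrow> \<bar>r - (t - s)\<bar> < \<delta>1 \<Longrightarrow> L1_dist N d (T r (u s)) (T (t - s) (u s)) < e/2"
        using C0_semigroup_orbit_continuous[OF T uL, of "t - s" "e/2" s] s e by auto
      obtain \<delta>2 where \<delta>2: "0 < \<delta>2" "\<And>s'. \<bar>s' - s\<bar> < \<delta>2 \<Longrightarrow> L1_dist N d (u s') (u s) < e/2"
        using ucont[of "e/2" s] e by auto
      have "dist (g s') (g s) < e" if s': "s' \<in> {0..t}" "dist s' s < min \<delta>1 \<delta>2" for s'
      proof -
        have "L1_dist N d (T (t - s') (u s')) (T (t - s) (u s)) \<le>
            L1_dist N d (T (t - s') (u s')) (T (t - s') (u s)) + L1_dist N d (T (t - s') (u s)) (T (t - s) (u s))"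
          using s s' by (intro L1_dist_triangle TL uL) auto
        also have "\<dots> < e/2 + e/2"
        proof (rule add_strict_mono)
          show "L1_dist N d (T (t - s') (u s')) (T (t - s') (u s)) < e/2"
            using cd[of "t - s'" "u s'" "u s"] \<delta>2(2)[of s'] s' uL by (auto simp: dist_real_def)
          show "L1_dist N d (T (t - s') (u s)) (T (t - s) (u s)) < e/2"
            using s' by (intro \<delta>1) (auto simp: dist_real_def)
        qed
        finally show ?thesis
          using gdiff[of s s'] gdiff[of s' s] s s' L1_dist_commute[of N d "T (t - s') (u s')"]
          by (simp add: dist_real_def)
      qed
      then show "\<exists>\<delta>>0. \<forall>s'\<in>{0..t}. dist s' s < \<delta> \<longrightarrow> dist (g s') (g s) < e"
        using \<delta>1(1) \<delta>2(1) by (intro exI[of _ "min \<delta>1 \<delta>2"]) auto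
    qed
    have "continuous_on {0..t} E" by (rule DERIV_continuous_on[OF has_field_derivative_at_within[OF E]])
    then show "continuous_on {0..t} (\<lambda>s. g s - E s)" using cg by (intro continuous_intros)
  next
    fix s e :: real assume s: "0 \<le> s" "s < t" and e: "0 < e"
    have "((\<lambda>h. (E (s + h) - E s) / h) \<longlongrightarrow> E' s) (at_right 0)"
      using E[of s] unfolding DERIV_def by (rule tendsto_within_subset) simp
    \<comment> \<open>Three errors of size e/4 occur: the quotient of \<open>E\<close>, the quotient
      of \<open>u\<close>, and the generator quotient at \<open>u s\<close>. Together they stay
      below \<open>e\<close>.\<close>
    then have "eventually (\<lambda>h. E' s - e/4 < (E (s + h) - E s) / h) (at_right 0)"
      by (rule order_tendstoD(1)) (use e in simp)
    moreover have "eventually (\<lambda>h. L1_dist N d (\<lambda>i x. (u (s + h) i x - u s i x) / h) (u' s) < e/4) (at_right 0)"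
      using quot by (rule order_tendstoD(2)) (use e in simp)
    moreover have "eventually (\<lambda>h. L1_dist N d (\<lambda>i x. (T h (u s) i x - u s i x) / h) (v s) < e/4) (at_right 0)"
      by (rule order_tendstoD(2)[of _ 0]) (use gen[of s] e in \<open>auto simp: has_generator_value_def\<close>)
    moreover have "eventually (\<lambda>h::real. 0 < h) (at_right 0)" by (rule eventually_at_right_less)
    ultimately show "eventually (\<lambda>h. s + h \<le> t \<longrightarrow> g (s + h) - E (s + h) \<le> g s - E s + e * h) (at_right 0)"
    proof eventually_elim
      case (elim h)
      show ?case
      proof
        assume sh: "s + h \<le> t"
        let ?p = "\<lambda>i x. (u (s + h) i x - u s i x) / h" and ?q = "\<lambda>i x. (T h (u s) i x - u s i x) / h"
        have h: "0 < h" using elim by simp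
        have ThL: "T h (u s) \<in> L1S N d" using h by (intro TL uL) auto
        \<comment> \<open>Writing \<open>T (t - s) (u s)\<close> as the image of
          \<open>T h (u s)\<close> under \<open>T (t - (s + h))\<close> puts both points of the
          curve under the same contraction; what remains is \<open>h\<close> times the distance of
          two difference quotients.\<close>
        have "L1_dist N d (T (t - (s + h)) (T h (u s))) (T (t - s) (u s)) = 0"
          using C0_semigroup_add[OF T uL, of "t - (s + h)" h s] sh h by (simp add: L1_dist_commute)
        moreover have "L1_dist N d (T (t - (s + h)) (u (s + h))) (T (t - s) (u s)) \<le>
            L1_dist N d (T (t - (s + h)) (u (s + h))) (T (t - (s + h)) (T h (u s))) +
            L1_dist N d (T (t - (s + h)) (T h (u s))) (T (t - s) (u s))"
          using sh s by (intro L1_dist_triangle TL uL ThL) auto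
        moreover have "L1_dist N d (T (t - (s + h)) (u (s + h))) (T (t - (s + h)) (T h (u s))) \<le>
            L1_dist N d (u (s + h)) (T h (u s))"
          using sh by (intro cd uL ThL) auto
        moreover have "L1_dist N d (u (s + h)) (T h (u s)) = h * L1_dist N d ?p ?q"
        proof -
          have "L1_dist N d (u (s + h)) (T h (u s)) = L1_norm N d (\<lambda>i x. h * (?p i x - ?q i x))"
            unfolding L1_dist_def using h
            by (intro arg_cong[where f="L1_norm N d"]) (simp add: fun_eq_iff field_simps)
          then show ?thesis unfolding L1_norm_scale using h by (simp add: L1_dist_def)
        qed
        moreover have "L1_dist N d ?p ?q \<le> L1_dist N d ?p (u' s) + (L1_dist N d (u' s) (v s) + L1_dist N d (v s) ?q)"
          using L1_dist_triangle[of ?p N d "u' s" ?q] L1_dist_triangle[of "u' s" N d "v s" ?q]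
            uL u'L vL ThL by (simp add: L1S_intros)
        then have "L1_dist N d ?p ?q \<le> e/4 + (E' s + e/4)"
          using elim bd[of s] s L1_dist_commute[of N d "v s"] unfolding u'_def[symmetric] v_def[symmetric] by simp
        then have "h * L1_dist N d ?p ?q \<le> h * (E' s + e/2)" using h by (intro mult_left_mono) auto
        ultimately have 1: "g (s + h) \<le> g s + h * (E' s + e/2)"
          using gdiff[of s "s + h"] s sh by linarith
        have "h * (E' s - e/4) \<le> E (s + h) - E s" using elim h by (simp add: field_simps)
        then have "g (s + h) - E (s + h) \<le> g s - E s + h * (3/4 * e)" using 1 by (simp add: algebra_simps)
        also have "h * (3/4 * e) \<le> h * e" using h e by (intro mult_left_mono) auto
        finally show "g (s + h) - E (s + h) \<le> g s - E s + e * h" by (simp add: mult.commute)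
      qed
    qed
  qed
  moreover have "g 0 = 0" by (simp add: g_def L1_dist_self)
  moreover have "g t = L1_dist N d (T t (u 0)) (u t)"
    unfolding g_def using C0_semigroup_zero[OF T uL, of t] t
    by (subst L1_dist_commute) (intro L1_dist_cong L1_dist_self TL uL, auto)
  ultimately show ?thesis by (simp add: u_def)
qed

section \<open>Functions with integrable second derivative on an interval\<close>

lemma wderiv_weak:
  assumes "has_weak_derivative 0 (d i) (\<phi> i) g"
  shows "has_weak_derivative 0 (d i) (\<phi> i) (wderiv d \<phi> i)"
  unfolding wderiv_def using assms by (rule someI[of "has_weak_derivative 0 (d i) (\<phi> i)"])

lemma wderiv_ae_eq:
  assumes "0 < d i" "has_weak_derivative 0 (d i) (\<phi> i) g"
  shows "AE x in lebesgue_on {0..d i}. wderiv d \<phi> i x = g x"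
  by (rule weak_derivative_unique[OF assms(1) wderiv_weak[of d i \<phi> g, OF assms(2)] assms(2)])

text \<open>Resolves all choices at once: the class of \<phi> has a continuously differentiable
  representative \<open>F\<close>, its derivative \<open>G\<close> is a primitive of the second weak
  derivative, and the end values are ordinary values of \<open>F\<close> and
  \<open>G\<close>.\<close>

lemma W21_representation:
  assumes \<phi>: "\<phi> \<in> W21 N d" and i: "i \<in> {1..N}" and di: "0 < d i"
  obtains F G where "\<And>x. x \<in> {0..d i} \<Longrightarrow> (F has_real_derivative G x) (at x within {0..d i})"
    "AE x in lebesgue_on {0..d i}. \<phi> i x = F x"
    "integrable (lebesgue_on {0..d i}) (wderiv d (wderiv d \<phi>) i)"
    "\<And>x. x \<in> {0..d i} \<Longrightarrow> G x = G 0 + integral {0..x} (wderiv d (wderiv d \<phi>) i)"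
    "at_left_end d \<phi> i = F 0" "at_right_end d \<phi> i = F (d i)"
    "at_left_end d (wderiv d \<phi>) i = G 0" "at_right_end d (wderiv d \<phi>) i = G (d i)"
proof -
  let ?L = "lebesgue_on {0..d i}"
  define W where "W = wderiv d \<phi> i"
  define H where "H = wderiv d (wderiv d \<phi>) i"
  obtain g h where "has_weak_derivative 0 (d i) (\<phi> i) g" "has_weak_derivative 0 (d i) (wderiv d \<phi> i) h"
    using \<phi> i unfolding W21_def by blast
  then have W: "has_weak_derivative 0 (d i) (\<phi> i) W" and H: "has_weak_derivative 0 (d i) W H"
    unfolding W_def H_def by (auto intro: wderiv_weak)
  have Wi: "integrable ?L W" and Hi: "integrable ?L H"
    using H by (auto simp: has_weak_derivative_def absolutely_integrable_iff)
  obtain c where c: "AE x in ?L. \<phi> i x = c + integral {0..x} W" by (rule weak_derivative_primitive[OF di W])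
  obtain e where e: "AE x in ?L. W x = e + integral {0..x} H" by (rule weak_derivative_primitive[OF di H])
  define F where "F x = c + integral {0..x} W" for x
  define G where "G x = e + integral {0..x} H" for x
  have cG: "continuous_on {0..d i} G" unfolding G_def by (intro continuous_intros primitive_continuous(2)[OF Hi])
  have cF: "continuous_on {0..d i} F" unfolding F_def by (intro continuous_intros primitive_continuous(2)[OF Wi])
  \<comment> \<open>The chosen derivative \<open>W\<close> need not be continuous; only after
    replacing it by \<open>G\<close> under the integral is the primitive differentiable at every
    point.\<close>
  have FG: "F x = c + integral {0..x} G" if x: "x \<in> {0..d i}" for x
  proof -
    have Gx: "integrable (lebesgue_on {0..x}) G"
      using integrable_continuous_interval_lebesgue continuous_on_subset[OF cG] x by auto
    have Wx: "integrable (lebesgue_on {0..x}) W"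
      using integrable_lebesgue_subinterval[OF Wi] x by auto
    have "AE x in lebesgue. x \<in> {0..d i} \<longrightarrow> W x = G x"
      using e by (auto simp: G_def AE_restrict_space_iff)
    then have "AE y in lebesgue. y \<in> {0..x} \<longrightarrow> W y = G y"
      by eventually_elim (use x in auto)
    then have "AE y in lebesgue_on {0..x}. W y = G y" by (auto simp: AE_restrict_space_iff)
    then have "integral\<^sup>L (lebesgue_on {0..x}) W = integral\<^sup>L (lebesgue_on {0..x}) G"
      using Wx Gx by (intro integral_cong_AE) auto
    then show ?thesis using primitive_continuous(3)[OF Wx] primitive_continuous(3)[OF Gx] by (simp add: F_def)
  qed
  have ae: "AE x in ?L. \<phi> i x = F x" "AE x in ?L. wderiv d \<phi> i x = G x"
    using c e by (auto simp: F_def G_def W_def)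
  show ?thesis
  proof (rule that)
    fix x assume x: "x \<in> {0..d i}"
    have "((\<lambda>x. integral {0..x} G) has_real_derivative G x) (at x within {0..d i})"
      using integral_has_real_derivative[OF cG x] .
    then have "((\<lambda>x. c + integral {0..x} G) has_real_derivative G x) (at x within {0..d i})"
      by (auto intro!: derivative_eq_intros)
    then show "(F has_real_derivative G x) (at x within {0..d i})"
      by (rule has_field_derivative_transform_within[OF _ zero_less_one]) (use x FG in auto)
  next
    show "at_left_end d \<phi> i = F 0" "at_right_end d \<phi> i = F (d i)"
      "at_left_end d (wderiv d \<phi>) i = G 0" "at_right_end d (wderiv d \<phi>) i = G (d i)"
      unfolding at_left_end_def at_right_end_def
      using di continuous_version_eq[OF di cF ae(1)] continuous_version_eq[OF di cG ae(2)] by simp_all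
  qed (use ae Hi in \<open>auto simp: H_def G_def\<close>)
qed

text \<open>The converse passage: for explicit smooth functions the chosen weak derivatives and end
  values are the classical ones, which is how elements of the domain are constructed.\<close>

lemma C2_function:
  assumes i: "i \<in> {1..N}" and di: "0 < d i"
    and der: "\<And>x. x \<in> {0..d i} \<Longrightarrow> (\<phi> i has_real_derivative f1 x) (at x within {0..d i})"
      "\<And>x. x \<in> {0..d i} \<Longrightarrow> (f1 has_real_derivative f2 x) (at x within {0..d i})"
    and cont: "continuous_on {0..d i} f2"
  shows "\<exists>g. has_weak_derivative 0 (d i) (\<phi> i) g" "\<exists>h. has_weak_derivative 0 (d i) (wderiv d \<phi> i) h"
    "AE x in lebesgue_on {0..d i}. wderiv d (wderiv d \<phi>) i x = f2 x"
    "at_left_end d \<phi> i = \<phi> i 0" "at_right_end d \<phi> i = \<phi> i (d i)"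
    "at_left_end d (wderiv d \<phi>) i = f1 0" "at_right_end d (wderiv d \<phi>) i = f1 (d i)"
proof -
  let ?L = "lebesgue_on {0..d i}"
  have c: "continuous_on {0..d i} (\<phi> i)" "continuous_on {0..d i} f1"
    by (rule DERIV_continuous_on[OF der(1)], assumption, rule DERIV_continuous_on[OF der(2)])
  have 1: "has_weak_derivative 0 (d i) (\<phi> i) f1" by (rule C1_has_weak_derivative[OF di der(1) c(2)])
  have 2: "has_weak_derivative 0 (d i) f1 f2" by (rule C1_has_weak_derivative[OF di der(2) cont])
  have ae: "AE x in ?L. wderiv d \<phi> i x = f1 x" by (rule wderiv_ae_eq[of d i \<phi>, OF di 1])
  have "wderiv d \<phi> i \<in> borel_measurable ?L"
    using wderiv_weak[of d i \<phi>, OF 1] by (auto simp: has_weak_derivative_def absolutely_integrable_iff)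
  then have 3: "has_weak_derivative 0 (d i) (wderiv d \<phi> i) f2"
    by (intro has_weak_derivative_cong[OF _ _ 2]) (use ae in \<open>auto elim: eventually_mono\<close>)
  show "\<exists>g. has_weak_derivative 0 (d i) (\<phi> i) g" "\<exists>h. has_weak_derivative 0 (d i) (wderiv d \<phi> i) h"
    "AE x in lebesgue_on {0..d i}. wderiv d (wderiv d \<phi>) i x = f2 x"
    using 1 3 wderiv_ae_eq[of d i "wderiv d \<phi>", OF di 3] by blast+
  show "at_left_end d \<phi> i = \<phi> i 0" "at_right_end d \<phi> i = \<phi> i (d i)"
    "at_left_end d (wderiv d \<phi>) i = f1 0" "at_right_end d (wderiv d \<phi>) i = f1 (d i)"
    unfolding at_left_end_def at_right_end_def
    using di continuous_version_eq[OF di c(1), of "\<phi> i"] continuous_version_eq[OF di c(2) ae] by simp_all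
qed

text \<open>After integration by parts the interior term is minus the integral of
  \<open>\<eta>' (F x) * (G x)\<^sup>2\<close>, which is not positive. The primitive of
  \<open>H\<close> is \<open>G - G 0\<close> rather than \<open>G\<close>; the fundamental theorem
  for \<open>\<eta> (F x)\<close> turns the extra term into the boundary term at the left
  end.\<close>

lemma second_derivative_times_increasing:
  fixes F G H \<eta> \<eta>' :: "real \<Rightarrow> real"
  assumes b: "0 \<le> b"
    and F: "\<And>x. x \<in> {0..b} \<Longrightarrow> (F has_real_derivative G x) (at x within {0..b})"
    and H: "integrable (lebesgue_on {0..b}) H"
    and G: "\<And>x. x \<in> {0..b} \<Longrightarrow> G x = G 0 + integral {0..x} H"
    and \<eta>: "\<And>s. (\<eta> has_real_derivative \<eta>' s) (at s)" "continuous_on UNIV \<eta>'" "\<And>s. 0 \<le> \<eta>' s"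
  shows "(\<integral>x. H x * \<eta> (F x) \<partial>lebesgue_on {0..b}) \<le> G b * \<eta> (F b) - G 0 * \<eta> (F 0)"
proof -
  let ?L = "lebesgue_on {0..b}"
  have "continuous_on {0..b} (\<lambda>x. G 0 + integral {0..x} H)" by (intro continuous_intros primitive_continuous(2)[OF H])
  then have cG: "continuous_on {0..b} G" by (rule continuous_on_eq) (simp add: G[symmetric])
  have cF: "continuous_on {0..b} F" by (rule DERIV_continuous_on[OF F])
  have c': "continuous_on {0..b} (\<lambda>x. \<eta>' (F x))" by (rule continuous_on_compose2[OF \<eta>(2) cF]) auto
  have der: "((\<lambda>x. \<eta> (F x)) has_real_derivative \<eta>' (F x) * G x) (at x within {0..b})" if "x \<in> {0..b}" for x
    using DERIV_chain2[OF \<eta>(1) F[OF that]] .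
  have cd: "continuous_on {0..b} (\<lambda>x. \<eta>' (F x) * G x)" by (intro continuous_intros c' cG)
  have "((\<lambda>x. \<eta>' (F x) * G x) has_integral \<eta> (F b) - \<eta> (F 0)) {0..b}"
    using b der by (intro fundamental_theorem_of_calculus) (auto simp: has_real_derivative_iff_has_vector_derivative)
  then have ftc: "(\<integral>x. \<eta>' (F x) * G x \<partial>?L) = \<eta> (F b) - \<eta> (F 0)"
    using primitive_continuous(3)[OF integrable_continuous_interval_lebesgue[OF cd]] by (simp add: integral_unique)
  have Hx: "integral {0..x} H = G x - G 0" if "x \<in> {0..b}" for x using G[OF that] by simp
  have "(\<integral>x. integral {0..x} H * (\<eta>' (F x) * G x) \<partial>?L) =
      (\<integral>x. \<eta>' (F x) * (G x)\<^sup>2 - G 0 * (\<eta>' (F x) * G x) \<partial>?L)"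
    by (rule Bochner_Integration.integral_cong) (simp_all add: Hx power2_eq_square algebra_simps)
  also have "\<dots> = (\<integral>x. \<eta>' (F x) * (G x)\<^sup>2 \<partial>?L) - (\<integral>x. G 0 * (\<eta>' (F x) * G x) \<partial>?L)"
    by (intro Bochner_Integration.integral_diff integrable_continuous_interval_lebesgue continuous_intros c' cG)
  also have "\<dots> \<ge> - (G 0 * (\<eta> (F b) - \<eta> (F 0)))"
    using \<eta>(3) ftc by (simp add: integral_nonneg_AE)
  finally have 1: "- (G 0 * (\<eta> (F b) - \<eta> (F 0))) \<le> (\<integral>x. integral {0..x} H * (\<eta>' (F x) * G x) \<partial>?L)" .
  have "(\<integral>x. H x * \<eta> (F x) \<partial>?L) = integral {0..b} H * \<eta> (F b) - (\<integral>x. integral {0..x} H * (\<eta>' (F x) * G x) \<partial>?L)"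
    by (rule integration_by_parts_primitive[OF b H der cd])
  then show ?thesis using 1 Hx[of b] b by (simp add: algebra_simps)
qed

text \<open>A continuously differentiable increasing substitute for the sign, bounded by 1 in
  absolute value, whose product with \<open>s\<close> falls short of the absolute value of
  \<open>s\<close> by at most \<epsilon>.\<close>

definition smooth_sgn :: "real \<Rightarrow> real \<Rightarrow> real" where
  "smooth_sgn \<epsilon> s = s / sqrt (s\<^sup>2 + \<epsilon>\<^sup>2)"

lemma smooth_sgn_derivative:
  assumes "0 < \<epsilon>"
  shows "(smooth_sgn \<epsilon> has_real_derivative \<epsilon>\<^sup>2 / (sqrt (s\<^sup>2 + \<epsilon>\<^sup>2) * (s\<^sup>2 + \<epsilon>\<^sup>2))) (at s)"
proof -
  define w where "w = s\<^sup>2 + \<epsilon>\<^sup>2"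
  have w: "0 < w" using assms by (simp add: w_def add_nonneg_pos)
  have "((\<lambda>s. s / sqrt (s\<^sup>2 + \<epsilon>\<^sup>2)) has_real_derivative (sqrt w - s * (inverse (sqrt w) / 2 * (2 * s))) / (sqrt w * sqrt w)) (at s)"
    using w by (auto intro!: derivative_eq_intros simp: w_def)
  moreover have "(sqrt w - s * (inverse (sqrt w) / 2 * (2 * s))) / (sqrt w * sqrt w) = \<epsilon>\<^sup>2 / (sqrt w * w)"
  proof -
    have "sqrt w - s * (inverse (sqrt w) / 2 * (2 * s)) = (sqrt w * sqrt w - s\<^sup>2) / sqrt w"
      using w by (simp add: field_simps power2_eq_square)
    also have "sqrt w * sqrt w = w" using w by simp
    finally show ?thesis using w by (simp add: w_def)
  qed
  ultimately show ?thesis unfolding smooth_sgn_def[abs_def] w_def by simp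
qed

lemma smooth_sgn_abs_le: "\<bar>smooth_sgn \<epsilon> s\<bar> \<le> 1"
proof -
  define r where "r = sqrt (s\<^sup>2 + \<epsilon>\<^sup>2)"
  have "\<bar>s\<bar> \<le> r" unfolding r_def by (rule real_le_rsqrt) simp
  moreover have "0 \<le> r" by (simp add: r_def)
  ultimately show ?thesis
    unfolding smooth_sgn_def r_def[symmetric] abs_divide by (cases "r = 0") (auto simp: divide_le_eq_1)
qed

lemma abs_le_smooth_sgn:
  assumes "0 < \<epsilon>"
  shows "\<bar>s\<bar> \<le> s * smooth_sgn \<epsilon> s + \<epsilon>"
proof -
  define r where "r = sqrt (s\<^sup>2 + \<epsilon>\<^sup>2)"
  have r: "\<bar>s\<bar> \<le> r" "r \<le> \<bar>s\<bar> + \<epsilon>" "0 < r"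
    using assms sqrt_sum_squares_le_sum_abs[of s \<epsilon>]
    by (auto simp: r_def intro!: real_le_rsqrt add_nonneg_pos)
  have "\<bar>s\<bar> * r - s\<^sup>2 \<le> \<epsilon> * r"
  proof -
    have "\<bar>s\<bar> * r - s\<^sup>2 = \<bar>s\<bar> * (r - \<bar>s\<bar>)" by (simp add: power2_eq_square algebra_simps)
    also have "\<dots> \<le> r * \<epsilon>" using r by (intro mult_mono) auto
    finally show ?thesis by (simp add: mult.commute)
  qed
  then have "\<bar>s\<bar> - s\<^sup>2 / r \<le> \<epsilon>" using r(3) by (simp add: field_simps)
  then show ?thesis by (simp add: smooth_sgn_def r_def power2_eq_square)
qed

section \<open>The transmission conditions\<close>

context graph_diffusion
begin

text \<open>The boundary functionals depend on the values \<open>p j\<close>, \<open>q j\<close> at the left and right ends only.\<close>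

definition bdry_L :: "(nat \<Rightarrow> real) \<Rightarrow> (nat \<Rightarrow> real) \<Rightarrow> nat \<Rightarrow> real" where
  "bdry_L p q i =
     (\<sigma> i * l i * p i
      - (\<Sum>j\<in>{j\<in>{1..N}. j \<noteq> i \<and> tail G j = tail G i}. \<sigma> j * lt j i * p j)
      - (\<Sum>j\<in>{j\<in>{1..N}. j \<noteq> i \<and> head G j = tail G i}. \<sigma> j * rt j i * q j)) / \<sigma> i"

definition bdry_R :: "(nat \<Rightarrow> real) \<Rightarrow> (nat \<Rightarrow> real) \<Rightarrow> nat \<Rightarrow> real" where
  "bdry_R p q i =
     ((\<Sum>j\<in>{j\<in>{1..N}. j \<noteq> i \<and> tail G j = head G i}. \<sigma> j * lt j i * p j)
      + (\<Sum>j\<in>{j\<in>{1..N}. j \<noteq> i \<and> head G j = head G i}. \<sigma> j * rt j i * q j)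
      - \<sigma> i * r i * q i) / \<sigma> i"

lemma F_L_eq_bdry: "F_L G N d \<sigma> l lt rt i \<phi> = bdry_L (at_left_end d \<phi>) (at_right_end d \<phi>) i"
  by (simp add: F_L_def bdry_L_def)

lemma F_R_eq_bdry: "F_R G N d \<sigma> r lt rt i \<phi> = bdry_R (at_left_end d \<phi>) (at_right_end d \<phi>) i"
  by (simp add: F_R_def bdry_R_def)

text \<open>The rate at which mass enters edge \<open>i\<close> from the other edges through the
  vertex \<open>v\<close>. Indicators instead of restricted index sets let the sums for the two ends
  of \<open>i\<close> be added term by term.\<close>

definition inflow :: "real ^ 3 \<Rightarrow> (nat \<Rightarrow> real) \<Rightarrow> (nat \<Rightarrow> real) \<Rightarrow> nat \<Rightarrow> real" where
  "inflow v p q i = (\<Sum>j\<in>{1..N} - {i}.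
     \<sigma> j * lt j i * p j * of_bool (tail G j = v) + \<sigma> j * rt j i * q j * of_bool (head G j = v))"

lemma bdry_eq_inflow:
  assumes i: "i \<in> {1..N}"
  shows "\<sigma> i * bdry_L p q i = \<sigma> i * l i * p i - inflow (tail G i) p q i"
    and "\<sigma> i * bdry_R p q i = inflow (head G i) p q i - \<sigma> i * r i * q i"
proof -
  have eq: "(\<Sum>j\<in>{j\<in>{1..N}. j \<noteq> i \<and> P j}. f j) = (\<Sum>j\<in>{1..N} - {i}. f j * of_bool (P j))"
    for P and f :: "nat \<Rightarrow> real"
    by (intro sum.mono_neutral_cong_left) auto
  show "\<sigma> i * bdry_L p q i = \<sigma> i * l i * p i - inflow (tail G i) p q i"
    "\<sigma> i * bdry_R p q i = inflow (head G i) p q i - \<sigma> i * r i * q i"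
    unfolding bdry_L_def bdry_R_def inflow_def eq sum.distrib using sigma_pos[OF i] by simp_all
qed

lemma ends_distinct: "i \<in> {1..N} \<Longrightarrow> tail G i \<noteq> head G i"
  using no_loops[of i] by (simp add: arcs_eq)

text \<open>An end of edge j at a vertex of edge i meets exactly one of its two ends, since these
  are distinct vertices; if it meets neither, the incidence condition makes the coefficient zero. So
  every term is counted once.\<close>

lemma inflow_both_ends:
  assumes i: "i \<in> {1..N}"
  shows "inflow (tail G i) p q i + inflow (head G i) p q i =
    (\<Sum>j\<in>{1..N} - {i}. \<sigma> j * (lt j i * p j + rt j i * q j))"
  unfolding inflow_def sum.distrib[symmetric]
proof (rule sum.cong)
  fix j assume j: "j \<in> {1..N} - {i}"
  have "lt j i = 0" if "tail G j \<noteq> tail G i" "tail G j \<noteq> head G i"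
    using lt_incident[of j i] i j that by (auto simp: incident_def)
  then have 1: "lt j i * of_bool (tail G j = tail G i) + lt j i * of_bool (tail G j = head G i) = lt j i"
    using ends_distinct[OF i] by auto
  have "rt j i = 0" if "head G j \<noteq> tail G i" "head G j \<noteq> head G i"
    using rt_incident[of j i] i j that by (auto simp: incident_def)
  then have 2: "rt j i * of_bool (head G j = tail G i) + rt j i * of_bool (head G j = head G i) = rt j i"
    using ends_distinct[OF i] by auto
  have "\<sigma> j * (lt j i * p j + rt j i * q j) =
    \<sigma> j * ((lt j i * of_bool (tail G j = tail G i) + lt j i * of_bool (tail G j = head G i)) * p j
     + (rt j i * of_bool (head G j = tail G i) + rt j i * of_bool (head G j = head G i)) * q j)"
    unfolding 1 2 ..
  then show "\<sigma> j * lt j i * p j * of_bool (tail G j = tail G i) + \<sigma> j * rt j i * q j * of_bool (head G j = tail G i) +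
    (\<sigma> j * lt j i * p j * of_bool (tail G j = head G i) + \<sigma> j * rt j i * q j * of_bool (head G j = head G i)) =
    \<sigma> j * (lt j i * p j + rt j i * q j)"
    by (simp add: algebra_simps)
qed simp

lemma inflow_abs_le:
  assumes i: "i \<in> {1..N}"
  shows "\<bar>inflow v p q i\<bar> \<le> inflow v (\<lambda>j. \<bar>p j\<bar>) (\<lambda>j. \<bar>q j\<bar>) i"
  unfolding inflow_def
proof (rule order_trans[OF sum_abs sum_mono])
  fix j assume "j \<in> {1..N} - {i}"
  then have "0 \<le> \<sigma> j" "0 \<le> lt j i" "0 \<le> rt j i"
    using sigma_pos[of j] lt_nonneg[of j i] rt_nonneg[of j i] i by auto
  then show "\<bar>\<sigma> j * lt j i * p j * of_bool (tail G j = v) + \<sigma> j * rt j i * q j * of_bool (head G j = v)\<bar>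
    \<le> \<sigma> j * lt j i * \<bar>p j\<bar> * of_bool (tail G j = v) + \<sigma> j * rt j i * \<bar>q j\<bar> * of_bool (head G j = v)"
    by (intro order_trans[OF abs_triangle_ineq]) (simp add: abs_mult)
qed

text \<open>Exchanging the sums regroups the inflows by the edge of origin; there
  \<open>lt_sum\<close> and \<open>rt_sum\<close> say that no more mass is distributed than
  leaves.\<close>

lemma outflow_bound:
  assumes p: "\<And>j. 0 \<le> p j" and q: "\<And>j. 0 \<le> q j"
  shows "(\<Sum>i=1..N. \<Sum>j\<in>{1..N} - {i}. \<sigma> j * (lt j i * p j + rt j i * q j)) \<le>
    (\<Sum>j=1..N. \<sigma> j * (l j * p j + r j * q j))"
proof -
  let ?g = "\<lambda>i j. \<sigma> j * (lt j i * p j + rt j i * q j)"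
  have off: "(\<Sum>j\<in>{1..N} - {i}. f j) = (\<Sum>j=1..N. f j * of_bool (j \<noteq> i))" for i and f :: "nat \<Rightarrow> real"
    by (intro sum.mono_neutral_cong_left) auto
  have "(\<Sum>i=1..N. \<Sum>j\<in>{1..N} - {i}. ?g i j) = (\<Sum>i=1..N. \<Sum>j=1..N. ?g i j * of_bool (j \<noteq> i))"
    unfolding off ..
  also have "\<dots> = (\<Sum>j=1..N. \<Sum>i=1..N. ?g i j * of_bool (j \<noteq> i))"
    by (rule sum.swap)
  also have "\<dots> = (\<Sum>j=1..N. \<Sum>i=1..N. ?g i j * of_bool (i \<noteq> j))"
    by (intro sum.cong refl) (auto simp: of_bool_def)
  also have "\<dots> = (\<Sum>j=1..N. \<Sum>i\<in>{1..N} - {j}. ?g i j)"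
    unfolding off ..
  also have "\<dots> = (\<Sum>j=1..N. \<sigma> j * ((\<Sum>i\<in>{1..N} - {j}. lt j i) * p j + (\<Sum>i\<in>{1..N} - {j}. rt j i) * q j))"
    by (simp add: sum_distrib_left sum_distrib_right sum.distrib algebra_simps)
  also have "\<dots> \<le> (\<Sum>j=1..N. \<sigma> j * (l j * p j + r j * q j))"
    using sigma_pos p q lt_sum rt_sum
    by (intro sum_mono mult_left_mono add_mono mult_right_mono) (auto intro: less_imp_le)
  finally show ?thesis .
qed

text \<open>\<open>x\<close> and \<open>y\<close> stand for smoothed signs of the end values
  \<open>p\<close> and \<open>q\<close>. Inflow terms are estimated with signs bounded by 1, whereas
  each outflow term carries the sign of its own end value and keeps its full size up to \<epsilon>;
  \<open>outflow_bound\<close> then compares the two.\<close>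

lemma boundary_dissipative:
  assumes x: "\<And>i. \<bar>x i\<bar> \<le> 1" and y: "\<And>i. \<bar>y i\<bar> \<le> 1"
    and px: "\<And>i. \<bar>p i\<bar> \<le> p i * x i + \<epsilon>" and qy: "\<And>i. \<bar>q i\<bar> \<le> q i * y i + \<epsilon>"
  shows "(\<Sum>i=1..N. \<sigma> i * (bdry_R p q i * y i - bdry_L p q i * x i)) \<le> \<epsilon> * (\<Sum>i=1..N. \<sigma> i * (l i + r i))"
proof -
  let ?p = "\<lambda>j. \<bar>p j\<bar>" and ?q = "\<lambda>j. \<bar>q j\<bar>"
  have summand: "\<sigma> i * (bdry_R p q i * y i - bdry_L p q i * x i) \<le>
      (\<Sum>j\<in>{1..N} - {i}. \<sigma> j * (lt j i * ?p j + rt j i * ?q j)) - \<sigma> i * (l i * ?p i + r i * ?q i) + \<epsilon> * (\<sigma> i * (l i + r i))"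
    if i: "i \<in> {1..N}" for i
  proof -
    have s: "0 \<le> \<sigma> i * l i" "0 \<le> \<sigma> i * r i" using sigma_pos[OF i] l_nonneg[OF i] r_nonneg[OF i] by auto
    have ab: "a * b \<le> c" if "\<bar>a\<bar> \<le> c" "\<bar>b\<bar> \<le> 1" for a b c :: real
    proof -
      have "a * b \<le> \<bar>a\<bar> * \<bar>b\<bar>" by (simp flip: abs_mult)
      also have "\<dots> \<le> c * 1" using that by (intro mult_mono) auto
      finally show ?thesis by simp
    qed
    have "\<sigma> i * (bdry_R p q i * y i - bdry_L p q i * x i) =
        (\<sigma> i * bdry_R p q i) * y i - (\<sigma> i * bdry_L p q i) * x i" by (simp add: algebra_simps)
    also have "\<dots> = inflow (head G i) p q i * y i + inflow (tail G i) p q i * x i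
        - \<sigma> i * r i * (q i * y i) - \<sigma> i * l i * (p i * x i)"
      unfolding bdry_eq_inflow[OF i] by (simp add: algebra_simps)
    also have "\<dots> \<le> inflow (head G i) ?p ?q i + inflow (tail G i) ?p ?q i
        - \<sigma> i * r i * (?q i - \<epsilon>) - \<sigma> i * l i * (?p i - \<epsilon>)"
      using x[of i] y[of i] px[of i] qy[of i]
      by (intro diff_mono add_mono ab inflow_abs_le i mult_left_mono s) auto
    finally show ?thesis using inflow_both_ends[OF i, of ?p ?q] by (simp add: algebra_simps)
  qed
  have "(\<Sum>i=1..N. \<sigma> i * (bdry_R p q i * y i - bdry_L p q i * x i)) \<le>
      (\<Sum>i=1..N. (\<Sum>j\<in>{1..N} - {i}. \<sigma> j * (lt j i * ?p j + rt j i * ?q j)) - \<sigma> i * (l i * ?p i + r i * ?q i) + \<epsilon> * (\<sigma> i * (l i + r i)))"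
    by (rule sum_mono[OF summand])
  also have "\<dots> \<le> \<epsilon> * (\<Sum>i=1..N. \<sigma> i * (l i + r i))"
    using outflow_bound[of ?p ?q] by (simp add: sum.distrib sum_subtractf sum_distrib_left)
  finally show ?thesis .
qed

text \<open>Tests \<open>\<phi> - c * \<phi>''\<close> against the smoothed sign of \<phi>. The
  second derivative contributes at most boundary terms, and replacing the absolute value by the
  product with the smoothed sign costs \<epsilon> at each point of the edge.\<close>

lemma edge_dissipative:
  assumes \<phi>: "\<phi> \<in> W21 N d" and i: "i \<in> {1..N}" and c: "0 \<le> c" and \<epsilon>: "0 < \<epsilon>"
  shows "(\<integral>x. \<bar>\<phi> i x\<bar> \<partial>lebesgue_on {0..d i}) \<le>
    (\<integral>x. \<bar>\<phi> i x - c * wderiv d (wderiv d \<phi>) i x\<bar> \<partial>lebesgue_on {0..d i}) +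
    c * (at_right_end d (wderiv d \<phi>) i * smooth_sgn \<epsilon> (at_right_end d \<phi> i)
       - at_left_end d (wderiv d \<phi>) i * smooth_sgn \<epsilon> (at_left_end d \<phi> i)) + \<epsilon> * d i"
proof -
  let ?L = "lebesgue_on {0..d i}"
  let ?\<eta> = "smooth_sgn \<epsilon>"
  define H where "H = wderiv d (wderiv d \<phi>) i"
  have di: "0 < d i" by (rule length_pos[OF i])
  obtain F G where F: "\<And>x. x \<in> {0..d i} \<Longrightarrow> (F has_real_derivative G x) (at x within {0..d i})"
    and ae: "AE x in ?L. \<phi> i x = F x" and H: "integrable ?L H"
    and G: "\<And>x. x \<in> {0..d i} \<Longrightarrow> G x = G 0 + integral {0..x} H"
    and ends: "at_left_end d \<phi> i = F 0" "at_right_end d \<phi> i = F (d i)"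
      "at_left_end d (wderiv d \<phi>) i = G 0" "at_right_end d (wderiv d \<phi>) i = G (d i)"
    by (rule W21_representation[OF \<phi> i di, folded H_def]) (rule that; assumption)
  have cF: "continuous_on {0..d i} F" by (rule DERIV_continuous_on[OF F])
  have \<phi>i: "integrable ?L (\<phi> i)" using \<phi> i by (auto simp: W21_def L1S_iff)
  note Fi = integrable_continuous_interval_lebesgue[OF cF]
  have s: "0 < s\<^sup>2 + \<epsilon>\<^sup>2" for s using \<epsilon> by (simp add: add_nonneg_pos)
  have c\<eta>: "continuous_on {0..d i} (\<lambda>x. ?\<eta> (F x))"
    unfolding smooth_sgn_def using s by (intro continuous_intros cF) (metis less_irrefl real_sqrt_eq_zero_cancel_iff)
  have HF: "(\<integral>x. H x * ?\<eta> (F x) \<partial>?L) \<le> G (d i) * ?\<eta> (F (d i)) - G 0 * ?\<eta> (F 0)"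
  proof (rule second_derivative_times_increasing[OF less_imp_le[OF di] F H G smooth_sgn_derivative[OF \<epsilon>]])
    show "continuous_on UNIV (\<lambda>s. \<epsilon>\<^sup>2 / (sqrt (s\<^sup>2 + \<epsilon>\<^sup>2) * (s\<^sup>2 + \<epsilon>\<^sup>2)))"
      using s by (intro continuous_intros) (metis less_irrefl mult_eq_0_iff real_sqrt_eq_zero_cancel_iff)
    show "0 \<le> \<epsilon>\<^sup>2 / (sqrt (s\<^sup>2 + \<epsilon>\<^sup>2) * (s\<^sup>2 + \<epsilon>\<^sup>2))" for s by simp
  qed auto
  have i1: "integrable ?L (\<lambda>x. H x * ?\<eta> (F x))" by (rule integrable_mult_continuous[OF H c\<eta>])
  have "(\<integral>x. \<bar>\<phi> i x\<bar> \<partial>?L) = (\<integral>x. \<bar>F x\<bar> \<partial>?L)"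
    using ae \<phi>i Fi by (intro integral_cong_AE) (auto elim: eventually_mono)
  also have "\<dots> \<le> (\<integral>x. \<bar>F x - c * H x\<bar> + c * (H x * ?\<eta> (F x)) + \<epsilon> \<partial>?L)"
  proof (rule integral_mono)
    show "integrable ?L (\<lambda>x. \<bar>F x - c * H x\<bar> + c * (H x * ?\<eta> (F x)) + \<epsilon>)"
      using Fi H i1 finite_measure_interval[of 0 "d i"] by (auto intro: finite_measure.integrable_const)
    fix x
    have "(F x - c * H x) * ?\<eta> (F x) \<le> \<bar>F x - c * H x\<bar> * \<bar>?\<eta> (F x)\<bar>" by (simp flip: abs_mult)
    also have "\<dots> \<le> \<bar>F x - c * H x\<bar> * 1" by (intro mult_left_mono smooth_sgn_abs_le) auto
    finally show "\<bar>F x\<bar> \<le> \<bar>F x - c * H x\<bar> + c * (H x * ?\<eta> (F x)) + \<epsilon>"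
      using abs_le_smooth_sgn[OF \<epsilon>, of "F x"] by (simp add: algebra_simps)
  qed (use Fi in auto)
  also have "\<dots> = (\<integral>x. \<bar>F x - c * H x\<bar> \<partial>?L) + c * (\<integral>x. H x * ?\<eta> (F x) \<partial>?L) + \<epsilon> * d i"
    using Fi H i1 finite_measure.integrable_const[OF finite_measure_interval[of 0 "d i"], of \<epsilon>] measure_interval[of 0 "d i"] di
    by simp
  also have "(\<integral>x. \<bar>F x - c * H x\<bar> \<partial>?L) = (\<integral>x. \<bar>\<phi> i x - c * H x\<bar> \<partial>?L)"
    using ae \<phi>i Fi H by (intro integral_cong_AE) (auto elim: eventually_mono)
  finally show ?thesis using mult_left_mono[OF HF c] unfolding ends H_def[symmetric] by linarith
qed

text \<open>With \<open>c = h * (k * \<sigma> i)\<close> on edge \<open>i\<close> the transmission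
  conditions convert the end slopes in \<open>edge_dissipative\<close> into boundary functionals,
  whose sum over the edges is of order \<epsilon>; then \<epsilon> tends to 0.\<close>

lemma A_star_dissipative:
  assumes \<phi>: "\<phi> \<in> A_star_dom G N d \<sigma> l r lt rt k" and k: "0 < k" and h: "0 < h"
  shows "L1_norm N d \<phi> \<le> L1_norm N d (\<lambda>i x. \<phi> i x - h * A_star d \<sigma> k \<phi> i x)"
proof -
  have W: "\<phi> \<in> W21 N d" using \<phi> by (simp add: A_star_dom_def)
  let ?p = "at_left_end d \<phi>" and ?q = "at_right_end d \<phi>"
  have bc: "k * at_left_end d (wderiv d \<phi>) i = bdry_L ?p ?q i"
     "k * at_right_end d (wderiv d \<phi>) i = bdry_R ?p ?q i" if "i \<in> {1..N}" for i
    using \<phi> that unfolding A_star_dom_def F_L_eq_bdry F_R_eq_bdry by auto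
  define K where "K = h * (\<Sum>i=1..N. \<sigma> i * (l i + r i)) + (\<Sum>i=1..N. d i)"
  have K: "0 \<le> K" unfolding K_def using h length_pos sigma_pos l_nonneg r_nonneg
    by (intro add_nonneg_nonneg mult_nonneg_nonneg sum_nonneg) (auto intro: less_imp_le)
  have est: "L1_norm N d \<phi> \<le> L1_norm N d (\<lambda>i x. \<phi> i x - h * A_star d \<sigma> k \<phi> i x) + \<epsilon> * K" if \<epsilon>: "0 < \<epsilon>" for \<epsilon>
  proof -
    let ?x = "\<lambda>i. smooth_sgn \<epsilon> (?p i)" and ?y = "\<lambda>i. smooth_sgn \<epsilon> (?q i)"
    have "L1_norm N d \<phi> \<le> (\<Sum>i=1..N. (\<integral>x. \<bar>\<phi> i x - h * A_star d \<sigma> k \<phi> i x\<bar> \<partial>lebesgue_on {0..d i}) +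
       h * (\<sigma> i * (bdry_R ?p ?q i * ?y i - bdry_L ?p ?q i * ?x i)) + \<epsilon> * d i)"
      unfolding L1_norm_eq
    proof (rule sum_mono)
      fix i assume i: "i \<in> {1..N}"
      have c: "0 \<le> h * (k * \<sigma> i)" using h k sigma_pos[OF i] by simp
      show "(\<integral>x. \<bar>\<phi> i x\<bar> \<partial>lebesgue_on {0..d i}) \<le> (\<integral>x. \<bar>\<phi> i x - h * A_star d \<sigma> k \<phi> i x\<bar> \<partial>lebesgue_on {0..d i}) +
       h * (\<sigma> i * (bdry_R ?p ?q i * ?y i - bdry_L ?p ?q i * ?x i)) + \<epsilon> * d i"
        using edge_dissipative[OF W i c \<epsilon>] unfolding A_star_def bc[OF i, symmetric] by (simp add: algebra_simps)
    qed
    also have "\<dots> = L1_norm N d (\<lambda>i x. \<phi> i x - h * A_star d \<sigma> k \<phi> i x) +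
       h * (\<Sum>i=1..N. \<sigma> i * (bdry_R ?p ?q i * ?y i - bdry_L ?p ?q i * ?x i)) + \<epsilon> * (\<Sum>i=1..N. d i)"
      unfolding L1_norm_eq by (simp add: sum.distrib sum_distrib_left)
    also have "\<dots> \<le> L1_norm N d (\<lambda>i x. \<phi> i x - h * A_star d \<sigma> k \<phi> i x) +
       h * (\<epsilon> * (\<Sum>i=1..N. \<sigma> i * (l i + r i))) + \<epsilon> * (\<Sum>i=1..N. d i)"
      using boundary_dissipative[of ?x ?y ?p \<epsilon> ?q] smooth_sgn_abs_le abs_le_smooth_sgn[OF \<epsilon>] h \<epsilon>
      by (intro add_mono mult_left_mono) auto
    finally show ?thesis by (simp add: K_def algebra_simps)
  qed
  show ?thesis
  proof (rule field_le_epsilon)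
    fix e :: real assume e: "0 < e"
    have "e / (K + 1) * K \<le> e" using K e by (simp add: field_simps)
    then show "L1_norm N d \<phi> \<le> L1_norm N d (\<lambda>i x. \<phi> i x - h * A_star d \<sigma> k \<phi> i x) + e"
      using est[of "e / (K + 1)"] e K by simp
  qed
qed

end

section \<open>Correcting the boundary slopes\<close>

text \<open>Adding multiples of \<open>hump n b x\<close> and \<open>hump n b (b - x)\<close> to a function on \<open>[0, b]\<close> prescribes its slopes
  at the ends without changing its values there; a large \<open>n\<close> makes the change small in \<open>L\<^sup>1\<close>.\<close>

definition hump :: "nat \<Rightarrow> real \<Rightarrow> real \<Rightarrow> real" where
  "hump n b x = x * (1 - x / b) ^ Suc (Suc n)"

definition hump1 :: "nat \<Rightarrow> real \<Rightarrow> real \<Rightarrow> real" where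
  "hump1 n b x = (1 - x / b) ^ Suc (Suc n) - (real n + 2) / b * (x * (1 - x / b) ^ Suc n)"

definition hump2 :: "nat \<Rightarrow> real \<Rightarrow> real \<Rightarrow> real" where
  "hump2 n b x = (real n + 2) * (real n + 1) / b\<^sup>2 * (x * (1 - x / b) ^ n) - 2 * (real n + 2) / b * (1 - x / b) ^ Suc n"

lemma power_affine_derivative:
  fixes b x :: real
  assumes "b \<noteq> 0"
  shows "((\<lambda>x. (1 - x / b) ^ Suc m) has_real_derivative (real m + 1) * (1 - x / b) ^ m * (- (1 / b))) (at x)"
proof -
  have "((\<lambda>x. 1 - x / b) has_real_derivative - (1 / b)) (at x)"
    using assms by (auto intro!: derivative_eq_intros)
  from DERIV_power[OF this, of "Suc m"] show ?thesis by (rule DERIV_cong) simp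
qed

lemma hump_derivative:
  assumes b: "b \<noteq> 0"
  shows "(hump n b has_real_derivative hump1 n b x) (at x)"
proof -
  have "(hump n b has_real_derivative
      1 * (1 - x / b) ^ Suc (Suc n) + (real (Suc n) + 1) * (1 - x / b) ^ Suc n * (- (1 / b)) * x) (at x)"
    unfolding hump_def[abs_def] by (rule DERIV_mult[OF DERIV_ident power_affine_derivative[OF b]])
  then show ?thesis
    by (rule DERIV_cong) (simp add: hump1_def algebra_simps add_divide_distrib)
qed

lemma hump1_derivative:
  assumes b: "b \<noteq> 0"
  shows "(hump1 n b has_real_derivative hump2 n b x) (at x)"
proof -
  define z where "z = 1 - x / b"
  have "(hump1 n b has_real_derivative (real (Suc n) + 1) * z ^ Suc n * (- (1 / b)) -
      (real n + 2) / b * (1 * z ^ Suc n + (real n + 1) * z ^ n * (- (1 / b)) * x)) (at x)"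
    unfolding hump1_def[abs_def] z_def
    by (rule DERIV_diff[OF power_affine_derivative[OF b] DERIV_cmult[OF DERIV_mult[OF DERIV_ident power_affine_derivative[OF b]]]])
  then show ?thesis
    by (rule DERIV_cong)
      (simp add: hump2_def algebra_simps power2_eq_square add_divide_distrib flip: z_def)
qed

lemma hump_ends: "b \<noteq> 0 \<Longrightarrow> hump n b 0 = 0" "b \<noteq> 0 \<Longrightarrow> hump n b b = 0"
  "b \<noteq> 0 \<Longrightarrow> hump1 n b 0 = 1" "b \<noteq> 0 \<Longrightarrow> hump1 n b b = 0"
  by (simp_all add: hump_def hump1_def)

text \<open>With y = x / b and m = n + 2, Bernoulli's inequality gives (1 + m y) (1 - y)^m \<le> (1
  - y^2)^m \<le> 1, hence m y (1 - y)^m \<le> 1.\<close>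

lemma hump_bound:
  assumes b: "0 < b" and x: "x \<in> {0..b}"
  shows "\<bar>hump n b x\<bar> \<le> b / (real n + 2)"
proof -
  define y where "y = x / b"
  have y: "0 \<le> y" "y \<le> 1" using x b by (auto simp: y_def)
  let ?m = "Suc (Suc n)"
  have "(1 + real ?m * y) * (1 - y) ^ ?m \<le> (1 + y) ^ ?m * (1 - y) ^ ?m"
    using y Bernoulli_inequality[of y ?m] by (intro mult_right_mono) auto
  also have "\<dots> = (1 - y\<^sup>2) ^ ?m" by (simp add: power2_eq_square algebra_simps flip: power_mult_distrib)
  also have "\<dots> \<le> 1" using y by (intro power_le_one) (auto simp: power2_eq_square mult_le_one)
  finally have "real ?m * (y * (1 - y) ^ ?m) + (1 - y) ^ ?m \<le> 1" by (simp add: algebra_simps)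
  moreover have "0 \<le> (1 - y) ^ ?m" using y by simp
  ultimately have "real ?m * (y * (1 - y) ^ ?m) \<le> 1" by linarith
  then have 1: "y * (1 - y) ^ ?m \<le> 1 / (real n + 2)" by (simp add: field_simps)
  have "hump n b x = b * (y * (1 - y) ^ ?m)" using b by (simp add: hump_def y_def)
  moreover have "0 \<le> b * (y * (1 - y) ^ ?m)" using y b by simp
  moreover have "b * (y * (1 - y) ^ ?m) \<le> b / (real n + 2)" using mult_left_mono[OF 1, of b] b by simp
  ultimately show ?thesis by linarith
qed

text \<open>The price of a steep hump. Both terms of the second derivative are bounded by their
  coefficients, and (n + 2)(n + 1) + 2 (n + 2) = (n + 2)(n + 3).\<close>

lemma hump2_bound:
  assumes b: "0 < b" and x: "x \<in> {0..b}"
  shows "\<bar>hump2 n b x\<bar> \<le> (real n + 2) * (real n + 3) / b"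
proof -
  define y where "y = x / b"
  have y: "0 \<le> y" "y \<le> 1" using x b by (auto simp: y_def)
  have p: "0 \<le> (1 - y) ^ m" "(1 - y) ^ m \<le> 1" for m using y by (auto intro: power_le_one)
  have yp: "0 \<le> y * (1 - y) ^ n" "y * (1 - y) ^ n \<le> 1" using y p[of n] by (auto intro: mult_le_one)
  have eq: "hump2 n b x = (real n + 2) * (real n + 1) / b * (y * (1 - y) ^ n) - 2 * (real n + 2) / b * (1 - y) ^ Suc n"
    using b by (simp add: hump2_def y_def power2_eq_square)
  have tri: "\<bar>u - v\<bar> \<le> u + v" if "0 \<le> u" "0 \<le> v" for u v :: real using that by linarith
  have c: "0 \<le> (real n + 2) * (real n + 1) / b" "0 \<le> 2 * (real n + 2) / b" using b by simp_all
  have "0 \<le> (real n + 2) * (real n + 1) / b * (y * (1 - y) ^ n)" "0 \<le> 2 * (real n + 2) / b * (1 - y) ^ Suc n"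
    by (rule mult_nonneg_nonneg[OF c(1) yp(1)], rule mult_nonneg_nonneg[OF c(2) p(1)])
  then have "\<bar>hump2 n b x\<bar> \<le> (real n + 2) * (real n + 1) / b * (y * (1 - y) ^ n) + 2 * (real n + 2) / b * (1 - y) ^ Suc n"
    unfolding eq by (rule tri)
  also have "\<dots> \<le> (real n + 2) * (real n + 1) / b * 1 + 2 * (real n + 2) / b * 1"
    using b yp p[of "Suc n"] by (intro add_mono mult_left_mono) auto
  also have "\<dots> = (real n + 2) * (real n + 3) / b" using b by (simp add: field_simps)
  finally show ?thesis .
qed

lemma polynomial_dense_L1:
  fixes f :: "real \<Rightarrow> real"
  assumes b: "0 \<le> b" and f: "integrable (lebesgue_on {0..b}) f" and e: "0 < e"
  shows "\<exists>p. real_polynomial_function p \<and> (\<integral>x. \<bar>f x - p x\<bar> \<partial>lebesgue_on {0..b}) < e"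
proof -
  let ?L = "lebesgue_on {0..b}"
  obtain g where g: "continuous_on UNIV g" "(\<integral>x. \<bar>f x - g x\<bar> \<partial>?L) < e/2"
    using continuous_dense_L1[OF f, of "e/2"] e by auto
  have g': "continuous_on {0..b} g" using g(1) continuous_on_subset by blast
  have e': "0 < e / (2 * (b + 1))" using e b by simp
  obtain p where p: "real_polynomial_function p" "\<And>x. x \<in> {0..b} \<Longrightarrow> \<bar>g x - p x\<bar> < e / (2 * (b + 1))"
    using Stone_Weierstrass_real_polynomial_function[OF compact_Icc g' e'] by blast
  have p': "continuous_on {0..b} p" by (rule continuous_on_real_polynomial[OF p(1)])
  note gi = integrable_continuous_interval_lebesgue[OF g'] and pi = integrable_continuous_interval_lebesgue[OF p']
  have "(\<integral>x. \<bar>g x - p x\<bar> \<partial>?L) \<le> e / (2 * (b + 1)) * (b - 0)"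
    using p(2) gi pi b by (intro integral_abs_le_bound) (auto intro: less_imp_le)
  also have "\<dots> \<le> e / 2" using b e by (simp add: field_simps)
  finally have 1: "(\<integral>x. \<bar>g x - p x\<bar> \<partial>?L) \<le> e / 2" .
  have "(\<integral>x. \<bar>f x - p x\<bar> \<partial>?L) \<le> (\<integral>x. \<bar>f x - g x\<bar> + \<bar>g x - p x\<bar> \<partial>?L)"
    using f gi pi by (intro integral_mono) auto
  also have "\<dots> = (\<integral>x. \<bar>f x - g x\<bar> \<partial>?L) + (\<integral>x. \<bar>g x - p x\<bar> \<partial>?L)"
    using f gi pi by (intro Bochner_Integration.integral_add) auto
  finally show ?thesis using p(1) g(2) 1 by (intro exI[of _ p]) auto
qed

lemma L1_norm_le_bound:
  assumes "\<And>i. i \<in> {1..N} \<Longrightarrow> 0 \<le> d i" "\<phi> \<in> L1S N d"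
    and "\<And>i x. i \<in> {1..N} \<Longrightarrow> x \<in> {0..d i} \<Longrightarrow> \<bar>\<phi> i x\<bar> \<le> B i"
  shows "L1_norm N d \<phi> \<le> (\<Sum>i=1..N. B i * d i)"
  unfolding L1_norm_eq
proof (rule sum_mono)
  fix i assume i: "i \<in> {1..N}"
  have "integrable (lebesgue_on {0..d i}) (\<phi> i)" using assms(2) i by (auto simp: L1S_iff)
  from integral_abs_le_bound[OF assms(1)[OF i] this assms(3)[OF i]]
  show "(\<integral>x. \<bar>\<phi> i x\<bar> \<partial>lebesgue_on {0..d i}) \<le> B i * d i" by simp
qed

context graph_diffusion
begin

lemma A_star_L1S:
  assumes "\<phi> \<in> W21 N d"
  shows "A_star d \<sigma> k \<phi> \<in> L1S N d"
proof -
  have "integrable (lebesgue_on {0..d i}) (wderiv d (wderiv d \<phi>) i)" if i: "i \<in> {1..N}" for i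
    by (rule W21_representation[OF assms i length_pos[OF i]])
  then show ?thesis by (simp add: L1S_iff A_star_def)
qed

text \<open>\<alpha> and \<beta> are the slope defects of \<open>f\<close> at the left and right
  ends. As humps vanish at both ends, the correction leaves the boundary functionals unchanged and
  the conditions need not be solved simultaneously. Increasing \<open>n\<close> lowers the cost in
  L^1 and raises the cost for the operator: density uses large \<open>n\<close>, the approximate
  solutions use n = 0 with small defects.\<close>

lemma boundary_correction:
  fixes f f1 f2 :: edge_fun
  assumes k: "0 < k"
    and f: "\<And>i x. i \<in> {1..N} \<Longrightarrow> (f i has_real_derivative f1 i x) (at x)"
    and f1: "\<And>i x. i \<in> {1..N} \<Longrightarrow> (f1 i has_real_derivative f2 i x) (at x)"
    and f2: "\<And>i. i \<in> {1..N} \<Longrightarrow> continuous_on UNIV (f2 i)"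
    and \<alpha>: "\<And>i. i \<in> {1..N} \<Longrightarrow> \<alpha> i = bdry_L (\<lambda>j. f j 0) (\<lambda>j. f j (d j)) i / k - f1 i 0"
    and \<beta>: "\<And>i. i \<in> {1..N} \<Longrightarrow> \<beta> i = bdry_R (\<lambda>j. f j 0) (\<lambda>j. f j (d j)) i / k - f1 i (d i)"
  obtains \<psi> where "\<psi> \<in> A_star_dom G N d \<sigma> l r lt rt k"
    "L1_dist N d \<psi> f \<le> (\<Sum>i=1..N. (\<bar>\<alpha> i\<bar> + \<bar>\<beta> i\<bar>) * (d i)\<^sup>2) / (real n + 2)"
    "L1_dist N d (A_star d \<sigma> k \<psi>) (\<lambda>i x. k * \<sigma> i * f2 i x) \<le>
      k * ((real n + 2) * (real n + 3) * (\<Sum>i=1..N. \<sigma> i * (\<bar>\<alpha> i\<bar> + \<bar>\<beta> i\<bar>)))"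
proof -
  \<comment> \<open>Reflection reverses the slope, so the minus sign gives slope
    \<open>\<beta> i\<close> at the right end.\<close>
  let ?v = "\<lambda>i x. \<alpha> i * hump n (d i) x - \<beta> i * hump n (d i) (d i - x)"
  let ?v2 = "\<lambda>i x. \<alpha> i * hump2 n (d i) x - \<beta> i * hump2 n (d i) (d i - x)"
  define \<psi> where "\<psi> i x = f i x + ?v i x" for i x
  define \<psi>1 where "\<psi>1 i x = f1 i x + (\<alpha> i * hump1 n (d i) x + \<beta> i * hump1 n (d i) (d i - x))" for i x
  define \<psi>2 where "\<psi>2 i x = f2 i x + ?v2 i x" for i x
  have dp: "0 < d i" "d i \<noteq> 0" if "i \<in> {1..N}" for i using length_pos[OF that] by auto
  have refl_der: "((\<lambda>x. g (b - x)) has_real_derivative - g') (at x)"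
    if "(g has_real_derivative g') (at (b - x))" for g :: "real \<Rightarrow> real" and b g' x
  proof -
    have "((\<lambda>x. b - x) has_real_derivative - 1) (at x)" by (auto intro!: derivative_eq_intros)
    from DERIV_chain2[where f=g and g="\<lambda>x. b - x" and x=x, OF that this] show ?thesis by simp
  qed
  have D1: "(\<psi> i has_real_derivative \<psi>1 i x) (at x)" if i: "i \<in> {1..N}" for i x
    unfolding \<psi>_def[abs_def] \<psi>1_def
    by (rule DERIV_cong[OF DERIV_add[OF f[OF i] DERIV_diff[OF DERIV_cmult[OF hump_derivative[OF dp(2)[OF i]]]
            DERIV_cmult[OF refl_der[OF hump_derivative[OF dp(2)[OF i]]]]]]]) simp
  have D2: "(\<psi>1 i has_real_derivative \<psi>2 i x) (at x)" if i: "i \<in> {1..N}" for i x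
    unfolding \<psi>1_def[abs_def] \<psi>2_def
    by (rule DERIV_cong[OF DERIV_add[OF f1[OF i] DERIV_add[OF DERIV_cmult[OF hump1_derivative[OF dp(2)[OF i]]]
            DERIV_cmult[OF refl_der[OF hump1_derivative[OF dp(2)[OF i]]]]]]]) simp
  have cv2: "continuous_on UNIV (?v2 i)" if "i \<in> {1..N}" for i
    unfolding hump2_def using dp[OF that] by (intro continuous_intros) auto
  have cv: "continuous_on UNIV (?v i)" if "i \<in> {1..N}" for i
    unfolding hump_def using dp[OF that] by (intro continuous_intros) auto
  have C2: "continuous_on S (\<psi>2 i)" if "i \<in> {1..N}" for i S
  proof -
    have "continuous_on UNIV (\<psi>2 i)" unfolding \<psi>2_def[abs_def] by (intro continuous_on_add f2 cv2 that)
    then show ?thesis by (rule continuous_on_subset) simp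
  qed
  note C2F = C2_function[where \<phi>=\<psi> and d=d, OF _ dp(1) has_field_derivative_at_within[OF D1] has_field_derivative_at_within[OF D2] C2]
  have ends: "at_left_end d \<psi> i = f i 0" "at_right_end d \<psi> i = f i (d i)"
    "at_left_end d (wderiv d \<psi>) i = f1 i 0 + \<alpha> i" "at_right_end d (wderiv d \<psi>) i = f1 i (d i) + \<beta> i"
    if i: "i \<in> {1..N}" for i
    using C2F(4-7)[OF i i i i i] hump_ends[OF dp(2)[OF i]] by (simp_all add: \<psi>_def \<psi>1_def)
  have cont: "continuous_on S (\<psi> i)" if "i \<in> {1..N}" for i S
    using D1[OF that] DERIV_isCont by (blast intro: continuous_at_imp_continuous_on)
  have \<psi>L: "\<psi> \<in> L1S N d"
    unfolding L1S_iff using cont integrable_continuous_interval_lebesgue by blast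
  have W: "\<psi> \<in> W21 N d"
    unfolding W21_def using \<psi>L C2F(1,2) by blast
  have bdry_cong: "bdry_L (at_left_end d \<psi>) (at_right_end d \<psi>) i = bdry_L (\<lambda>j. f j 0) (\<lambda>j. f j (d j)) i"
    "bdry_R (at_left_end d \<psi>) (at_right_end d \<psi>) i = bdry_R (\<lambda>j. f j 0) (\<lambda>j. f j (d j)) i" if i: "i \<in> {1..N}" for i
    unfolding bdry_L_def bdry_R_def using i ends
    by (intro arg_cong2[where f="(/)"] arg_cong2[where f="(-)"] arg_cong2[where f="(+)"] sum.cong refl; simp)+
  have dom: "\<psi> \<in> A_star_dom G N d \<sigma> l r lt rt k"
    unfolding A_star_dom_def F_L_eq_bdry F_R_eq_bdry using W ends(3,4) \<alpha> \<beta> k bdry_cong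
    by (auto simp: field_simps)
  have v: "\<bar>?v i x\<bar> \<le> (\<bar>\<alpha> i\<bar> + \<bar>\<beta> i\<bar>) * (d i / (real n + 2))" if i: "i \<in> {1..N}" and x: "x \<in> {0..d i}" for i x
  proof -
    have "\<bar>?v i x\<bar> \<le> \<bar>\<alpha> i\<bar> * \<bar>hump n (d i) x\<bar> + \<bar>\<beta> i\<bar> * \<bar>hump n (d i) (d i - x)\<bar>"
      unfolding abs_mult[symmetric] by (rule abs_triangle_ineq4)
    also have "\<dots> \<le> \<bar>\<alpha> i\<bar> * (d i / (real n + 2)) + \<bar>\<beta> i\<bar> * (d i / (real n + 2))"
      using x by (intro add_mono mult_left_mono hump_bound dp[OF i]) auto
    finally show ?thesis by (simp only: distrib_right)
  qed
  have v2: "\<bar>?v2 i x\<bar> \<le> (\<bar>\<alpha> i\<bar> + \<bar>\<beta> i\<bar>) * ((real n + 2) * (real n + 3) / d i)" if i: "i \<in> {1..N}" and x: "x \<in> {0..d i}" for i x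
  proof -
    have "\<bar>?v2 i x\<bar> \<le> \<bar>\<alpha> i\<bar> * \<bar>hump2 n (d i) x\<bar> + \<bar>\<beta> i\<bar> * \<bar>hump2 n (d i) (d i - x)\<bar>"
      unfolding abs_mult[symmetric] by (rule abs_triangle_ineq4)
    also have "\<dots> \<le> \<bar>\<alpha> i\<bar> * ((real n + 2) * (real n + 3) / d i) + \<bar>\<beta> i\<bar> * ((real n + 2) * (real n + 3) / d i)"
      using x by (intro add_mono mult_left_mono hump2_bound dp[OF i]) auto
    finally show ?thesis by (simp only: distrib_right)
  qed
  show ?thesis
  proof (rule that[OF dom])
    have "L1_dist N d \<psi> f = L1_norm N d ?v" unfolding L1_dist_def \<psi>_def by simp
    also have "\<dots> \<le> (\<Sum>i=1..N. (\<bar>\<alpha> i\<bar> + \<bar>\<beta> i\<bar>) * (d i / (real n + 2)) * d i)"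
    proof (rule L1_norm_le_bound)
      show "?v \<in> L1S N d"
        unfolding L1S_iff using continuous_on_subset[OF cv] by (auto intro!: integrable_continuous_interval_lebesgue)
    qed (use v dp in \<open>auto intro: less_imp_le\<close>)
    also have "\<dots> = (\<Sum>i=1..N. (\<bar>\<alpha> i\<bar> + \<bar>\<beta> i\<bar>) * (d i)\<^sup>2) / (real n + 2)"
      by (simp add: sum_divide_distrib power2_eq_square mult.assoc)
    finally show "L1_dist N d \<psi> f \<le> (\<Sum>i=1..N. (\<bar>\<alpha> i\<bar> + \<bar>\<beta> i\<bar>) * (d i)\<^sup>2) / (real n + 2)" .
  next
    let ?u = "\<lambda>i x. k * \<sigma> i * ?v2 i x"
    have "L1_dist N d (A_star d \<sigma> k \<psi>) (\<lambda>i x. k * \<sigma> i * f2 i x) = L1_norm N d ?u"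
      unfolding L1_dist_def L1_norm_eq
    proof (rule sum.cong)
      fix i assume i: "i \<in> {1..N}"
      have 1: "integrable (lebesgue_on {0..d i}) (A_star d \<sigma> k \<psi> i)" using A_star_L1S[OF W] i by (auto simp: L1S_iff)
      have 2: "integrable (lebesgue_on {0..d i}) (f2 i)" "integrable (lebesgue_on {0..d i}) (?v2 i)"
        by (rule integrable_continuous_interval_lebesgue[OF continuous_on_subset[OF f2[OF i] subset_UNIV]],
            rule integrable_continuous_interval_lebesgue[OF continuous_on_subset[OF cv2[OF i] subset_UNIV]])
      show "(\<integral>x. \<bar>A_star d \<sigma> k \<psi> i x - k * \<sigma> i * f2 i x\<bar> \<partial>lebesgue_on {0..d i}) =
        (\<integral>x. \<bar>k * \<sigma> i * ?v2 i x\<bar> \<partial>lebesgue_on {0..d i})"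
      proof (rule integral_cong_AE)
        show "AE x in lebesgue_on {0..d i}. \<bar>A_star d \<sigma> k \<psi> i x - k * \<sigma> i * f2 i x\<bar> = \<bar>k * \<sigma> i * ?v2 i x\<bar>"
          using C2F(3)[OF i i i i i]
        proof eventually_elim
          case (elim x)
          have "A_star d \<sigma> k \<psi> i x - k * \<sigma> i * f2 i x = k * \<sigma> i * ?v2 i x"
            unfolding A_star_def elim \<psi>2_def by (simp add: algebra_simps)
          then show ?case by simp
        qed
      qed (use 1 2 in auto)
    qed simp
    also have "\<dots> \<le> (\<Sum>i=1..N. k * \<sigma> i * ((\<bar>\<alpha> i\<bar> + \<bar>\<beta> i\<bar>) * ((real n + 2) * (real n + 3) / d i)) * d i)"
    proof (rule L1_norm_le_bound)
      show "?u \<in> L1S N d"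
        unfolding L1S_iff using continuous_on_subset[OF cv2]
        by (intro ballI integrable_mult_right) (auto intro!: integrable_continuous_interval_lebesgue)
      fix i x assume i: "i \<in> {1..N}" and x: "x \<in> {0..d i}"
      have "0 \<le> k * \<sigma> i" using k sigma_pos[OF i] by simp
      then show "\<bar>?u i x\<bar> \<le> k * \<sigma> i * ((\<bar>\<alpha> i\<bar> + \<bar>\<beta> i\<bar>) * ((real n + 2) * (real n + 3) / d i))"
        unfolding abs_mult[of "k * \<sigma> i"] using v2[OF i x] by (simp only: abs_of_nonneg mult_left_mono)
    qed (use dp in \<open>auto intro: less_imp_le\<close>)
    also have "\<dots> = k * ((real n + 2) * (real n + 3) * (\<Sum>i=1..N. \<sigma> i * (\<bar>\<alpha> i\<bar> + \<bar>\<beta> i\<bar>)))"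
      unfolding sum_distrib_left
    proof (rule sum.cong)
      fix i assume "i \<in> {1..N}"
      then show "k * \<sigma> i * ((\<bar>\<alpha> i\<bar> + \<bar>\<beta> i\<bar>) * ((real n + 2) * (real n + 3) / d i)) * d i =
        k * ((real n + 2) * (real n + 3) * (\<sigma> i * (\<bar>\<alpha> i\<bar> + \<bar>\<beta> i\<bar>)))"
        using dp(2)[of i] by simp
    qed simp
    finally show "L1_dist N d (A_star d \<sigma> k \<psi>) (\<lambda>i x. k * \<sigma> i * f2 i x) \<le>
      k * ((real n + 2) * (real n + 3) * (\<Sum>i=1..N. \<sigma> i * (\<bar>\<alpha> i\<bar> + \<bar>\<beta> i\<bar>)))" .
  qed
qed

text \<open>Polynomials on the edges are dense in L^1; their slope defects are fixed numbers, so
  correcting them with sufficiently steep humps costs arbitrarily little.\<close>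

lemma A_star_dom_dense:
  assumes k: "0 < k" and \<phi>: "\<phi> \<in> L1S N d" and e: "0 < e"
  shows "\<exists>\<psi>\<in>A_star_dom G N d \<sigma> l r lt rt k. L1_dist N d \<phi> \<psi> < e"
proof -
  \<comment> \<open>Half of \<open>e\<close> is shared among the edges; the other half is left for
    the boundary correction. Adding 1 keeps the denominator positive even without edges.\<close>
  define e' where "e' = e / (2 * (real N + 1))"
  have e': "0 < e'" using e by (simp add: e'_def)
  have "\<forall>i. \<exists>p p' p''. i \<in> {1..N} \<longrightarrow> (\<integral>x. \<bar>\<phi> i x - p x\<bar> \<partial>lebesgue_on {0..d i}) < e' \<and>
      (\<forall>x. (p has_real_derivative p' x) (at x)) \<and> (\<forall>x. (p' has_real_derivative p'' x) (at x)) \<and> continuous_on UNIV p''"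
  proof
    fix i
    show "\<exists>p p' p''. i \<in> {1..N} \<longrightarrow> (\<integral>x. \<bar>\<phi> i x - p x\<bar> \<partial>lebesgue_on {0..d i}) < e' \<and>
      (\<forall>x. (p has_real_derivative p' x) (at x)) \<and> (\<forall>x. (p' has_real_derivative p'' x) (at x)) \<and> continuous_on UNIV p''"
    proof (cases "i \<in> {1..N}")
      case True
      then have "integrable (lebesgue_on {0..d i}) (\<phi> i)" using \<phi> by (auto simp: L1S_iff)
      then obtain p where p: "real_polynomial_function p" "(\<integral>x. \<bar>\<phi> i x - p x\<bar> \<partial>lebesgue_on {0..d i}) < e'"
        using polynomial_dense_L1[OF less_imp_le[OF length_pos[OF True]] _ e'] by blast
      obtain p' where p': "real_polynomial_function p'" "\<And>x. (p has_real_derivative p' x) (at x)"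
        using real_polynomial_has_derivative[OF p(1)] by blast
      obtain p'' where p'': "real_polynomial_function p''" "\<And>x. (p' has_real_derivative p'' x) (at x)"
        using real_polynomial_has_derivative[OF p'(1)] by blast
      show ?thesis using p p' p'' continuous_on_real_polynomial by blast
    qed blast
  qed
  then obtain f f1 f2 where f: "\<And>i. i \<in> {1..N} \<Longrightarrow> (\<integral>x. \<bar>\<phi> i x - f i x\<bar> \<partial>lebesgue_on {0..d i}) < e'"
    "\<And>i x. i \<in> {1..N} \<Longrightarrow> (f i has_real_derivative f1 i x) (at x)"
    "\<And>i x. i \<in> {1..N} \<Longrightarrow> (f1 i has_real_derivative f2 i x) (at x)"
    "\<And>i. i \<in> {1..N} \<Longrightarrow> continuous_on UNIV (f2 i)"
    unfolding choice_iff by blast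
  have fL: "f \<in> L1S N d"
    unfolding L1S_iff
    by (intro ballI integrable_continuous_interval_lebesgue DERIV_continuous_on[OF has_field_derivative_at_within[OF f(2)]])
  have "L1_dist N d \<phi> f \<le> (\<Sum>i=1..N. e')"
    unfolding L1_dist_def L1_norm_eq using f(1) by (intro sum_mono less_imp_le) auto
  also have "\<dots> \<le> e / 2" using e by (simp add: e'_def field_simps)
  finally have 1: "L1_dist N d \<phi> f \<le> e / 2" .
  define \<alpha> where "\<alpha> i = bdry_L (\<lambda>j. f j 0) (\<lambda>j. f j (d j)) i / k - f1 i 0" for i
  define \<beta> where "\<beta> i = bdry_R (\<lambda>j. f j 0) (\<lambda>j. f j (d j)) i / k - f1 i (d i)" for i
  define K where "K = (\<Sum>i=1..N. (\<bar>\<alpha> i\<bar> + \<bar>\<beta> i\<bar>) * (d i)\<^sup>2)"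
  obtain n where n: "2 * K / e < real n" using reals_Archimedean2 by blast
  obtain \<psi> where \<psi>: "\<psi> \<in> A_star_dom G N d \<sigma> l r lt rt k" "L1_dist N d \<psi> f \<le> K / (real n + 2)"
    using boundary_correction[where \<alpha>=\<alpha> and \<beta>=\<beta> and n=n, OF k f(2-4) \<alpha>_def \<beta>_def] unfolding K_def by blast
  have "K < (real n + 2) * (e / 2)" using n e by (simp add: field_simps)
  then have "K / (real n + 2) < e / 2" by (simp add: field_simps)
  moreover have "L1_dist N d \<phi> \<psi> \<le> L1_dist N d \<phi> f + L1_dist N d f \<psi>"
    using \<psi>(1) by (intro L1_dist_triangle \<phi> fL) (simp add: A_star_dom_def W21_def)
  ultimately have "L1_dist N d \<phi> \<psi> < e"
    using 1 \<psi>(2) L1_dist_commute[of N d f \<psi>] by linarith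
  then show ?thesis using \<psi>(1) by blast
qed

lemma generated_contraction:
  assumes "0 < k" and "generates N d (A_star_dom G N d \<sigma> l r lt rt k) (A_star d \<sigma> k) S"
    and "0 \<le> t" "\<phi> \<in> L1S N d"
  shows "L1_norm N d (S t \<phi>) \<le> L1_norm N d \<phi>"
  by (rule dissipative_imp_contraction[OF assms(2) A_star_dissipative[OF _ assms(1)] A_star_dom_dense[OF assms(1)] assms(3,4)])

end

lemma L1_norm_cong_on:
  assumes "\<And>i x. i \<in> {1..N} \<Longrightarrow> \<phi> i x = \<psi> i x"
  shows "L1_norm N d \<phi> = L1_norm N d \<psi>"
  unfolding L1_norm_eq using assms by (intro sum.cong refl) simp

lemma half_le: "0 \<le> y \<Longrightarrow> y / 2 \<le> y" for y :: real
  by simp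

section \<open>Approximate solutions from constants and approximate eigenfunctions\<close>

context graph_diffusion
begin

lemma bdry_add_scale:
  "bdry_L (\<lambda>j. p j + s * p' j) (\<lambda>j. q j + s * q' j) i = bdry_L p q i + s * bdry_L p' q' i"
  "bdry_R (\<lambda>j. p j + s * p' j) (\<lambda>j. q j + s * q' j) i = bdry_R p q i + s * bdry_R p' q' i"
proof -
  have eq: "(\<Sum>j\<in>J. a j * (u j + s * v j)) = (\<Sum>j\<in>J. a j * u j) + s * (\<Sum>j\<in>J. a j * v j)"
    for J :: "nat set" and a u v :: "nat \<Rightarrow> real"
    by (simp add: sum.distrib sum_distrib_left algebra_simps)
  show "bdry_L (\<lambda>j. p j + s * p' j) (\<lambda>j. q j + s * q' j) i = bdry_L p q i + s * bdry_L p' q' i"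
    "bdry_R (\<lambda>j. p j + s * p' j) (\<lambda>j. q j + s * q' j) i = bdry_R p q i + s * bdry_R p' q' i"
    unfolding bdry_L_def bdry_R_def eq
    by (simp_all add: algebra_simps add_divide_distrib diff_divide_distrib)
qed

text \<open>The solvability condition behind Q: a function with constant second derivative
  \<open>Q c / \<sigma>\<close> and left end slope \<open>bdry_L c c\<close> has right end slope
  \<open>bdry_R c c\<close>.\<close>

lemma Q_op_eq_flux:
  assumes i: "i \<in> {1..N}"
  shows "bdry_R c c i - bdry_L c c i = d i * (Q_op N (q_coeff d \<sigma> l r lt rt) c i / \<sigma> i)"
proof -
  have s: "0 < \<sigma> i" and di: "0 < d i" using sigma_pos[OF i] length_pos[OF i] by auto
  have "\<sigma> i * (bdry_R c c i - bdry_L c c i) =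
      (\<Sum>j\<in>{1..N} - {i}. \<sigma> j * (lt j i * c j + rt j i * c j)) - \<sigma> i * (l i + r i) * c i"
    using inflow_both_ends[OF i, of c c] by (simp add: right_diff_distrib bdry_eq_inflow[OF i] algebra_simps)
  also have "(\<Sum>j\<in>{1..N} - {i}. \<sigma> j * (lt j i * c j + rt j i * c j)) =
      d i * (\<Sum>j\<in>{1..N} - {i}. q_coeff d \<sigma> l r lt rt i j * c j)"
    unfolding sum_distrib_left using di by (intro sum.cong refl) (auto simp: q_coeff_def field_simps)
  also have "\<sigma> i * (l i + r i) * c i = - (d i * (q_coeff d \<sigma> l r lt rt i i * c i))"
    using di by (simp add: q_coeff_def)
  finally have "\<sigma> i * (bdry_R c c i - bdry_L c c i) = d i * Q_op N (q_coeff d \<sigma> l r lt rt) c i"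
    by (simp add: Q_op_def distrib_left)
  then show ?thesis using s by (simp add: field_simps)
qed

text \<open>The approximate solution is \<open>c + w / k\<close> with \<open>w'' = Q c / \<sigma>\<close> on each edge, after a correction of the
  boundary slopes of order \<open>1 / k\<^sup>2\<close>.\<close>

lemma constant_approximation:
  obtains K where "0 \<le> K" "\<And>k. 1 \<le> k \<Longrightarrow> \<exists>\<psi>\<in>A_star_dom G N d \<sigma> l r lt rt k.
     L1_dist N d \<psi> (edge_const c) \<le> K / k \<and>
     L1_dist N d (A_star d \<sigma> k \<psi>) (edge_const (Q_op N (q_coeff d \<sigma> l r lt rt) c)) \<le> K / k"
proof -
  let ?Q = "Q_op N (q_coeff d \<sigma> l r lt rt) c"
  define a where "a i = bdry_L c c i" for i
  define b where "b i = ?Q i / \<sigma> i" for i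
  \<comment> \<open>The corrector: its left slope is \<open>a\<close>, its second derivative is
    \<open>b\<close>, and by \<open>Q_op_eq_flux\<close> its right slope is
    \<open>bdry_R c c\<close>. Thus \<open>c + w / k\<close> violates the transmission conditions
    only through the boundary functionals of \<open>w\<close>.\<close>
  define w where "w i x = a i * x + b i * x\<^sup>2 / 2" for i x
  \<comment> \<open>\<open>w\<close> vanishes at the left ends, hence the zero function. The
    remaining slope defects are \<open>P i / k\<^sup>2\<close> and
    \<open>R i / k\<^sup>2\<close>.\<close>
  define P where "P i = bdry_L (\<lambda>j. 0) (\<lambda>j. w j (d j)) i" for i
  define R where "R i = bdry_R (\<lambda>j. 0) (\<lambda>j. w j (d j)) i" for i
  define K1 where "K1 = (\<Sum>i=1..N. (\<bar>P i\<bar> + \<bar>R i\<bar>) * (d i)\<^sup>2)"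
  \<comment> \<open>6 is (n + 2)(n + 3) at n = 0: with defects of order 1 / k^2 the least steep hump
    already leaves an operator error of order 1 / k.\<close>
  define K2 where "K2 = 6 * (\<Sum>i=1..N. \<sigma> i * (\<bar>P i\<bar> + \<bar>R i\<bar>))"
  define K3 where "K3 = L1_norm N d w"
  have nn: "0 \<le> K1" "0 \<le> K2" "0 \<le> K3"
    unfolding K1_def K2_def K3_def using sigma_pos
    by (auto intro!: sum_nonneg mult_nonneg_nonneg add_nonneg_nonneg L1_norm_nonneg intro: less_imp_le)
  have wL: "w \<in> L1S N d"
    unfolding L1S_iff w_def by (intro ballI integrable_continuous_interval_lebesgue continuous_intros) auto
  show ?thesis
  proof (rule that)
    show "0 \<le> K1 + K2 + K3" using nn by simp
    fix k :: real assume k: "1 \<le> k"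
    define f where "f i x = c i + 1 / k * w i x" for i x
    define f1 where "f1 i x = 1 / k * (a i + b i * x)" for i x
    define f2 where "f2 i x = 1 / k * b i" for i and x :: real
    have D1: "(f i has_real_derivative f1 i x) (at x)" for i x
      unfolding f_def[abs_def] w_def f1_def using k by (auto intro!: derivative_eq_intros simp: field_simps)
    have D2: "(f1 i has_real_derivative f2 i x) (at x)" for i x
      unfolding f1_def[abs_def] f2_def using k by (auto intro!: derivative_eq_intros)
    have bc: "bdry_L (\<lambda>j. f j 0) (\<lambda>j. f j (d j)) i = a i + P i / k"
      "bdry_R (\<lambda>j. f j 0) (\<lambda>j. f j (d j)) i = bdry_R c c i + R i / k" for i
      using bdry_add_scale[of c "1/k" "\<lambda>j. 0" c "\<lambda>j. w j (d j)" i] by (simp_all add: f_def w_def a_def P_def R_def)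
    have \<alpha>: "P i / k\<^sup>2 = bdry_L (\<lambda>j. f j 0) (\<lambda>j. f j (d j)) i / k - f1 i 0" for i
      unfolding bc using k by (simp add: f1_def field_simps power2_eq_square)
    have \<beta>: "R i / k\<^sup>2 = bdry_R (\<lambda>j. f j 0) (\<lambda>j. f j (d j)) i / k - f1 i (d i)" if "i \<in> {1..N}" for i
    proof -
      have "bdry_R c c i = a i + b i * d i" using Q_op_eq_flux[OF that, of c] by (simp add: a_def b_def mult.commute)
      then show ?thesis unfolding bc using k by (simp add: f1_def field_simps power2_eq_square)
    qed
    have sum_eq: "(\<Sum>i=1..N. g i * (\<bar>P i / k\<^sup>2\<bar> + \<bar>R i / k\<^sup>2\<bar>)) = (\<Sum>i=1..N. g i * (\<bar>P i\<bar> + \<bar>R i\<bar>)) / k\<^sup>2" for g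
      unfolding sum_divide_distrib by (intro sum.cong refl) (simp flip: add_divide_distrib)
    obtain \<psi> where dom: "\<psi> \<in> A_star_dom G N d \<sigma> l r lt rt k"
      and 1: "L1_dist N d \<psi> f \<le> (\<Sum>i=1..N. (\<bar>P i / k\<^sup>2\<bar> + \<bar>R i / k\<^sup>2\<bar>) * (d i)\<^sup>2) / (real 0 + 2)"
      and 2: "L1_dist N d (A_star d \<sigma> k \<psi>) (\<lambda>i x. k * \<sigma> i * f2 i x) \<le>
        k * ((real 0 + 2) * (real 0 + 3) * (\<Sum>i=1..N. \<sigma> i * (\<bar>P i / k\<^sup>2\<bar> + \<bar>R i / k\<^sup>2\<bar>)))"
    proof (rule boundary_correction[where f=f and ?f1.0=f1 and ?f2.0=f2 and k=k and n=0 and \<alpha>="\<lambda>i. P i / k\<^sup>2" and \<beta>="\<lambda>i. R i / k\<^sup>2"])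
      show "continuous_on UNIV (f2 i)" for i unfolding f2_def by (intro continuous_intros)
    qed (use k D1 D2 \<alpha> \<beta> in auto)
    have \<psi>L: "\<psi> \<in> L1S N d" using dom by (simp add: A_star_dom_def W21_def)
    have cL: "edge_const c \<in> L1S N d"
      unfolding L1S_iff edge_const_def by (intro ballI integrable_continuous_interval_lebesgue continuous_intros)
    have "(\<lambda>i x. edge_const c i x + 1 / k * w i x) \<in> L1S N d" by (intro L1S_intros cL wL)
    then have fL: "f \<in> L1S N d" "edge_const c \<in> L1S N d" using cL by (simp_all add: f_def[abs_def] edge_const_def)
    have kk: "x / k\<^sup>2 \<le> x / k" if "0 \<le> x" for x :: real
      using that k by (intro divide_left_mono) (auto simp: power2_eq_square)
    have "L1_dist N d \<psi> f \<le> (K1 / k\<^sup>2) / 2"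
      using 1 sum_eq[of "\<lambda>i. (d i)\<^sup>2"] by (simp add: K1_def mult.commute)
    also have "\<dots> \<le> K1 / k\<^sup>2" using nn(1) by (intro half_le) simp
    also have "\<dots> \<le> K1 / k" by (rule kk[OF nn(1)])
    finally have 3: "L1_dist N d \<psi> f \<le> K1 / k" .
    have "L1_dist N d f (edge_const c) = L1_norm N d (\<lambda>i x. 1 / k * w i x)"
      unfolding L1_dist_def f_def edge_const_def by simp
    then have 4: "L1_dist N d f (edge_const c) = K3 / k" unfolding L1_norm_scale using k by (simp add: K3_def)
    have "L1_dist N d \<psi> (edge_const c) \<le> (K1 + K3) / k"
      using L1_dist_triangle[OF \<psi>L fL] 3 4 by (simp add: add_divide_distrib)
    also have "\<dots> \<le> (K1 + K2 + K3) / k" using nn k by (intro divide_right_mono) auto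
    finally have 5: "L1_dist N d \<psi> (edge_const c) \<le> (K1 + K2 + K3) / k" .
    have "L1_dist N d (A_star d \<sigma> k \<psi>) (edge_const ?Q) = L1_dist N d (A_star d \<sigma> k \<psi>) (\<lambda>i x. k * \<sigma> i * f2 i x)"
      unfolding L1_dist_def
    proof (rule L1_norm_cong_on)
      fix i x assume "i \<in> {1..N}"
      then show "A_star d \<sigma> k \<psi> i x - edge_const ?Q i x = A_star d \<sigma> k \<psi> i x - k * \<sigma> i * f2 i x"
        using sigma_pos[of i] k by (simp add: edge_const_def f2_def b_def)
    qed
    also have "\<dots> \<le> K2 / k"
      using 2 sum_eq[of \<sigma>] k by (simp add: K2_def power2_eq_square)
    also have "\<dots> \<le> (K1 + K2 + K3) / k" using nn k by (intro divide_right_mono) auto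
    finally show "\<exists>\<psi>\<in>A_star_dom G N d \<sigma> l r lt rt k. L1_dist N d \<psi> (edge_const c) \<le> (K1 + K2 + K3) / k \<and>
     L1_dist N d (A_star d \<sigma> k \<psi>) (edge_const ?Q) \<le> (K1 + K2 + K3) / k"
      using dom 5 by blast
  qed
qed

text \<open>The cosine has zero slope at both ends, so its slope defects are its boundary
  functionals divided by \<open>k\<close>. The correction is therefore of order 1 / k, while its
  image under the operator, which contains the factor \<open>k\<close>, is only bounded.\<close>

lemma cosine_approximation:
  assumes i0: "i0 \<in> {1..N}" and m: "1 \<le> m"
  defines "f \<equiv> \<lambda>i x. if i = i0 then cos (real m * (pi * x / d i0)) else 0"
  obtains K \<mu> where "0 \<le> K" "0 < \<mu>" "f \<in> L1S N d" "\<And>k. 1 \<le> k \<Longrightarrow> \<exists>\<psi>\<in>A_star_dom G N d \<sigma> l r lt rt k.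
     L1_dist N d \<psi> f \<le> K / k \<and> L1_dist N d (A_star d \<sigma> k \<psi>) (\<lambda>i x. - (k * \<mu>) * \<psi> i x) \<le> K"
proof -
  define \<nu> where "\<nu> = real m * pi / d i0"
  define \<mu> where "\<mu> = \<sigma> i0 * \<nu>\<^sup>2"
  have d0: "0 < d i0" by (rule length_pos[OF i0])
  have "0 < \<nu>" unfolding \<nu>_def using m d0 by simp
  then have \<mu>: "0 < \<mu>" unfolding \<mu>_def using sigma_pos[OF i0] by simp
  have f: "f = (\<lambda>i x. if i = i0 then cos (\<nu> * x) else 0)" proof -
    have eq: "real m * (pi * x / d i0) = \<nu> * x" for x by (simp add: \<nu>_def)
    show ?thesis unfolding f_def eq ..
  qed
  define f1 where "f1 i x = (if i = i0 then - \<nu> * sin (\<nu> * x) else 0)" for i x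
  define f2 where "f2 i x = (if i = i0 then - \<nu>\<^sup>2 * cos (\<nu> * x) else 0)" for i x
  have D1: "(f i has_real_derivative f1 i x) (at x)" for i x
    by (cases "i = i0") (auto simp: f f1_def intro!: derivative_eq_intros)
  have D2: "(f1 i has_real_derivative f2 i x) (at x)" for i x
    by (cases "i = i0") (auto simp: f1_def[abs_def] f2_def power2_eq_square intro!: derivative_eq_intros)
  have f2c: "continuous_on S (f2 i)" for i S
    by (cases "i = i0") (auto simp: f2_def[abs_def] intro!: continuous_intros)
  have fL: "f \<in> L1S N d"
    unfolding L1S_iff
    by (intro ballI integrable_continuous_interval_lebesgue DERIV_continuous_on[OF has_field_derivative_at_within[OF D1]])
  have ends: "f1 i 0 = 0" "f1 i (d i) = 0" for i
    using d0 sin_npi[of m] by (auto simp: f1_def \<nu>_def)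
  define P where "P = bdry_L (\<lambda>j. f j 0) (\<lambda>j. f j (d j))"
  define R where "R = bdry_R (\<lambda>j. f j 0) (\<lambda>j. f j (d j))"
  define K1 where "K1 = (\<Sum>i=1..N. (\<bar>P i\<bar> + \<bar>R i\<bar>) * (d i)\<^sup>2)"
  define K2 where "K2 = 6 * (\<Sum>i=1..N. \<sigma> i * (\<bar>P i\<bar> + \<bar>R i\<bar>))"
  have nn: "0 \<le> K1" "0 \<le> K2"
    unfolding K1_def K2_def using sigma_pos
    by (auto intro!: sum_nonneg mult_nonneg_nonneg add_nonneg_nonneg intro: less_imp_le)
  \<comment> \<open>\<open>K1\<close> bounds the correction times \<open>k\<close>,
    \<open>K2\<close> bounds the operator applied to the correction, and \<open>\<mu> * K1\<close>
    arises from replacing the cosine by \<psi> in the eigenvalue term.\<close>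
  define K where "K = K1 + K2 + \<mu> * K1"
  have K0: "0 \<le> K" "K1 \<le> K" "0 \<le> \<mu> * K1" unfolding K_def using nn \<mu> by auto
  show ?thesis
  proof (rule that[OF K0(1) \<mu> fL])
    fix k :: real assume k: "1 \<le> k"
    have sum_eq: "(\<Sum>i=1..N. g i * (\<bar>P i / k\<bar> + \<bar>R i / k\<bar>)) = (\<Sum>i=1..N. g i * (\<bar>P i\<bar> + \<bar>R i\<bar>)) / k" for g
      unfolding sum_divide_distrib using k by (intro sum.cong refl) (simp flip: add_divide_distrib)
    obtain \<psi> where dom: "\<psi> \<in> A_star_dom G N d \<sigma> l r lt rt k"
      and 1: "L1_dist N d \<psi> f \<le> (\<Sum>i=1..N. (\<bar>P i / k\<bar> + \<bar>R i / k\<bar>) * (d i)\<^sup>2) / (real 0 + 2)"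
      and 2: "L1_dist N d (A_star d \<sigma> k \<psi>) (\<lambda>i x. k * \<sigma> i * f2 i x) \<le>
        k * ((real 0 + 2) * (real 0 + 3) * (\<Sum>i=1..N. \<sigma> i * (\<bar>P i / k\<bar> + \<bar>R i / k\<bar>)))"
      by (rule boundary_correction[where f=f and ?f1.0=f1 and ?f2.0=f2 and k=k and n=0 and \<alpha>="\<lambda>i. P i / k" and \<beta>="\<lambda>i. R i / k"])
        (use k D1 D2 f2c ends P_def R_def in auto)
    have \<psi>L: "\<psi> \<in> L1S N d" and W: "\<psi> \<in> W21 N d" using dom by (auto simp: A_star_dom_def W21_def)
    have "L1_dist N d \<psi> f \<le> K1 / k / 2"
      using 1 sum_eq[of "\<lambda>i. (d i)\<^sup>2"] by (simp add: K1_def mult.commute)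
    also have "\<dots> \<le> K1 / k" using nn(1) k by (intro half_le) simp
    finally have 3: "L1_dist N d \<psi> f \<le> K1 / k" .
    have 4: "L1_dist N d (A_star d \<sigma> k \<psi>) (\<lambda>i x. k * \<sigma> i * f2 i x) \<le> K2"
      using 2 sum_eq[of \<sigma>] k by (simp add: K2_def)
    have "L1_dist N d (\<lambda>i x. k * \<sigma> i * f2 i x) (\<lambda>i x. - (k * \<mu>) * \<psi> i x) = L1_norm N d (\<lambda>i x. (k * \<mu>) * (\<psi> i x - f i x))"
      unfolding L1_dist_def by (rule L1_norm_cong_on) (simp add: f f2_def \<mu>_def algebra_simps)
    also have "\<dots> = k * \<mu> * L1_dist N d \<psi> f" unfolding L1_norm_scale using k \<mu> by (simp add: L1_dist_def)
    also have "\<dots> \<le> k * \<mu> * (K1 / k)" using k \<mu> by (intro mult_left_mono 3) auto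
    also have "\<dots> = \<mu> * K1" using k by simp
    finally have 5: "L1_dist N d (\<lambda>i x. k * \<sigma> i * f2 i x) (\<lambda>i x. - (k * \<mu>) * \<psi> i x) \<le> \<mu> * K1" .
    have f2L: "(\<lambda>i x. k * \<sigma> i * f2 i x) \<in> L1S N d"
      unfolding L1S_iff by (intro ballI integrable_mult_right integrable_continuous_interval_lebesgue f2c)
    have "L1_dist N d (A_star d \<sigma> k \<psi>) (\<lambda>i x. - (k * \<mu>) * \<psi> i x) \<le> K2 + \<mu> * K1"
      using L1_dist_triangle[OF A_star_L1S[OF W] f2L L1S_scale[OF \<psi>L]] 4 5 by (meson add_mono order_trans)
    also have "\<dots> \<le> K" using nn by (simp add: K_def)
    finally have 6: "L1_dist N d (A_star d \<sigma> k \<psi>) (\<lambda>i x. - (k * \<mu>) * \<psi> i x) \<le> K" .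
    have "L1_dist N d \<psi> f \<le> K / k" using 3 K0(2) k by (meson divide_right_mono order_trans zero_le_one)
    then show "\<exists>\<psi>\<in>A_star_dom G N d \<sigma> l r lt rt k.
     L1_dist N d \<psi> f \<le> K / k \<and> L1_dist N d (A_star d \<sigma> k \<psi>) (\<lambda>i x. - (k * \<mu>) * \<psi> i x) \<le> K"
      using 6 dom by blast
  qed
qed

end

section \<open>The exponential of the limit generator\<close>

lemma Q_op_eq_sum: "i \<in> {1..N} \<Longrightarrow> Q_op N q c i = (\<Sum>j=1..N. q i j * c j)"
  unfolding Q_op_def using sum.remove[of "{1..N}" i "\<lambda>j. q i j * c j"] by simp

text \<open>For fixed \<open>c\<close> and \<open>i\<close> the exponential is a power series in t
  with coefficients from the iterates of Q on \<open>c\<close>; differentiating it termwise shifts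
  them to the iterates on \<open>Q c\<close>.\<close>

lemma exp_Q_derivative:
  assumes i: "i \<in> {1..N}"
  shows "((\<lambda>t. exp_Q N q t c i) has_real_derivative exp_Q N q t (Q_op N q c) i) (at t)"
proof -
  define C where "C k = (Q_op N q ^^ k) c i / fact k" for k
  have eq: "exp_Q N q t c i = (\<Sum>k. C k * t ^ k)" for t
    unfolding exp_Q_def C_def by (simp add: mult.commute)
  have sm: "summable (\<lambda>k. C k * t ^ k)" for t
    using exp_Q_summable[OF i, of t q c] unfolding C_def by (simp add: mult.commute)
  have "diffs C = (\<lambda>k. (Q_op N q ^^ k) (Q_op N q c) i / fact k)"
    unfolding diffs_def C_def by (rule ext) (simp add: funpow_swap1 del: of_nat_Suc)
  then have "exp_Q N q t (Q_op N q c) i = (\<Sum>k. diffs C k * t ^ k)"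
    unfolding exp_Q_def by (simp add: mult.commute)
  then show ?thesis
    using termdiffs_strong_converges_everywhere[OF sm, of t] by (simp add: eq)
qed

text \<open>Each entry of Q applied to a vector is a finite sum, which may be exchanged with the
  series. Together with \<open>exp_Q_derivative\<close> this is the differential equation of the
  limit orbit.\<close>

lemma exp_Q_commute:
  assumes i: "i \<in> {1..N}"
  shows "exp_Q N q t (Q_op N q c) i = Q_op N q (exp_Q N q t c) i"
proof -
  have "exp_Q N q t (Q_op N q c) i = (\<Sum>k. \<Sum>j=1..N. q i j * (t ^ k / fact k * (Q_op N q ^^ k) c j))"
    unfolding exp_Q_def
  proof (rule suminf_cong)
    fix k
    have "(Q_op N q ^^ k) (Q_op N q c) i = Q_op N q ((Q_op N q ^^ k) c) i" by (simp add: funpow_swap1)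
    also have "\<dots> = (\<Sum>j=1..N. q i j * (Q_op N q ^^ k) c j)" by (rule Q_op_eq_sum[OF i])
    finally show "t ^ k / fact k * (Q_op N q ^^ k) (Q_op N q c) i =
      (\<Sum>j=1..N. q i j * (t ^ k / fact k * (Q_op N q ^^ k) c j))"
      by (simp add: sum_distrib_left mult_ac)
  qed
  also have "\<dots> = (\<Sum>j=1..N. \<Sum>k. q i j * (t ^ k / fact k * (Q_op N q ^^ k) c j))"
    by (intro suminf_sum summable_mult exp_Q_summable)
  also have "\<dots> = (\<Sum>j=1..N. q i j * exp_Q N q t c j)"
    unfolding exp_Q_def by (intro sum.cong refl suminf_mult exp_Q_summable)
  finally show ?thesis by (simp add: Q_op_eq_sum[OF i])
qed

lemma exp_Q_zero: "exp_Q N q 0 c i = c i"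
proof -
  have "(\<lambda>k. 0 ^ k / fact k * (Q_op N q ^^ k) c i) = (\<lambda>k. if k = 0 then c i else 0)"
    by (auto simp: fun_eq_iff)
  then show ?thesis unfolding exp_Q_def using suminf_finite[of "{0}" "\<lambda>k. if k = 0 then c i else 0"] by simp
qed

section \<open>Density of cosine polynomials\<close>

definition cosine_polynomial :: "(real \<Rightarrow> real) \<Rightarrow> bool" where
  "cosine_polynomial h \<longleftrightarrow> (\<exists>M b. \<forall>\<theta>. h \<theta> = (\<Sum>m\<le>M. b m * cos (real m * \<theta>)))"

lemma cosine_polynomialI:
  "(\<And>\<theta>. h \<theta> = (\<Sum>m\<le>M. b m * cos (real m * \<theta>))) \<Longrightarrow> cosine_polynomial h"
  unfolding cosine_polynomial_def by blast

lemma cosine_polynomial_cos: "cosine_polynomial (\<lambda>\<theta>. cos (real m * \<theta>))"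
  unfolding cosine_polynomial_def
proof (intro exI allI)
  fix \<theta>
  have "(\<Sum>j\<le>m. (if j = m then 1 else 0) * cos (real j * \<theta>)) = (\<Sum>j\<le>m. if j = m then cos (real j * \<theta>) else 0)"
    by (intro sum.cong) auto
  then show "cos (real m * \<theta>) = (\<Sum>j\<le>m. (if j = m then 1 else 0) * cos (real j * \<theta>))" by simp
qed

lemma cosine_polynomial_add:
  assumes "cosine_polynomial g" "cosine_polynomial h"
  shows "cosine_polynomial (\<lambda>\<theta>. g \<theta> + h \<theta>)"
proof -
  obtain M b M' b' where g: "\<And>\<theta>. g \<theta> = (\<Sum>m\<le>M. b m * cos (real m * \<theta>))"
    and h: "\<And>\<theta>. h \<theta> = (\<Sum>m\<le>M'. b' m * cos (real m * \<theta>))"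
    using assms unfolding cosine_polynomial_def by blast
  have ext: "(\<Sum>m\<le>L. u m * cos (real m * \<theta>)) = (\<Sum>m\<le>max M M'. (if m \<le> L then u m else 0) * cos (real m * \<theta>))"
    if "L \<le> max M M'" for L u \<theta>
    by (rule sum.mono_neutral_cong_left) (use that in auto)
  have "g \<theta> + h \<theta> = (\<Sum>m\<le>max M M'. ((if m \<le> M then b m else 0) + (if m \<le> M' then b' m else 0)) * cos (real m * \<theta>))" for \<theta>
    unfolding g h by (subst (1 2) ext) (simp_all only: max.cobounded1 max.cobounded2 distrib_right sum.distrib)
  then show ?thesis by (rule cosine_polynomialI)
qed

lemma cosine_polynomial_scale:
  assumes "cosine_polynomial h"
  shows "cosine_polynomial (\<lambda>\<theta>. a * h \<theta>)"
proof -
  obtain M b where h: "\<And>\<theta>. h \<theta> = (\<Sum>m\<le>M. b m * cos (real m * \<theta>))"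
    using assms unfolding cosine_polynomial_def by blast
  have "a * h \<theta> = (\<Sum>m\<le>M. (a * b m) * cos (real m * \<theta>))" for \<theta>
    unfolding h by (simp add: sum_distrib_left mult.assoc)
  then show ?thesis by (rule cosine_polynomialI)
qed

lemma cosine_polynomial_sum:
  assumes "finite I" "\<And>i. i \<in> I \<Longrightarrow> cosine_polynomial (h i)"
  shows "cosine_polynomial (\<lambda>\<theta>. \<Sum>i\<in>I. h i \<theta>)"
  using assms
proof (induction I)
  case empty
  then show ?case using cosine_polynomial_scale[OF cosine_polynomial_cos, of 0 0] by simp
next
  case (insert i I)
  then show ?case using cosine_polynomial_add[of "h i" "\<lambda>\<theta>. \<Sum>i\<in>I. h i \<theta>"] by simp
qed

text \<open>The product formula expresses cos \<theta> cos (m \<theta>) as the mean of the cosines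
  with frequencies m + 1 and m - 1; m = 0 is treated apart because frequencies are natural
  numbers.\<close>

lemma cosine_polynomial_mult_cos:
  assumes "cosine_polynomial h"
  shows "cosine_polynomial (\<lambda>\<theta>. cos \<theta> * h \<theta>)"
proof -
  obtain M b where h: "\<And>\<theta>. h \<theta> = (\<Sum>m\<le>M. b m * cos (real m * \<theta>))"
    using assms unfolding cosine_polynomial_def by blast
  have "cosine_polynomial (\<lambda>\<theta>. cos \<theta> * cos (real m * \<theta>))" for m
  proof (cases m)
    case 0
    then show ?thesis using cosine_polynomial_cos[of 1] by simp
  next
    case (Suc n)
    have eq: "cos \<theta> * cos (real m * \<theta>) = 1/2 * cos (real (Suc m) * \<theta>) + 1/2 * cos (real n * \<theta>)" for \<theta>
      using cos_times_cos[of \<theta> "real m * \<theta>"] cos_minus[of "\<theta> - real m * \<theta>"] Suc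
      by (simp add: algebra_simps)
    show ?thesis
      unfolding eq
      by (rule cosine_polynomial_add[OF cosine_polynomial_scale[OF cosine_polynomial_cos] cosine_polynomial_scale[OF cosine_polynomial_cos]])
  qed
  then have "cosine_polynomial (\<lambda>\<theta>. \<Sum>m\<le>M. b m * (cos \<theta> * cos (real m * \<theta>)))"
    by (intro cosine_polynomial_sum cosine_polynomial_scale) auto
  then show ?thesis unfolding h by (simp add: sum_distrib_left mult_ac)
qed

lemma cosine_polynomial_power: "cosine_polynomial (\<lambda>\<theta>. cos \<theta> ^ n)"
proof (induction n)
  case 0
  then show ?case using cosine_polynomial_cos[of 0] by simp
next
  case (Suc n)
  then show ?case using cosine_polynomial_mult_cos by simp
qed

text \<open>The substitution y = cos (\<pi> x / b) maps [0, b] bijectively onto [-1, 1] and turns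
  polynomials in y into cosine polynomials, so Weierstrass approximation applies after composing
  with \<open>arccos\<close>.\<close>

lemma cosine_polynomials_dense_L1:
  fixes f :: "real \<Rightarrow> real"
  assumes b: "0 < b" and f: "integrable (lebesgue_on {0..b}) f" and e: "0 < e"
  obtains M a where "(\<integral>x. \<bar>f x - (\<Sum>m\<le>M. a m * cos (real m * (pi * x / b)))\<bar> \<partial>lebesgue_on {0..b}) < e"
proof -
  let ?L = "lebesgue_on {0..b}"
  obtain g where g: "continuous_on UNIV g" "(\<integral>x. \<bar>f x - g x\<bar> \<partial>?L) < e/2"
    using continuous_dense_L1[OF f, of "e/2"] e by auto
  have g': "continuous_on {0..b} g" using g(1) continuous_on_subset by blast
  define e' where "e' = e / (2 * (b + 1))"
  have e': "0 < e'" using e b by (simp add: e'_def)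
  have "continuous_on {-1..1} (\<lambda>y. g (b / pi * arccos y))"
    by (rule continuous_on_compose2[OF g(1)]) (auto intro!: continuous_intros)
  then obtain p where p: "real_polynomial_function p" "\<And>y. y \<in> {-1..1} \<Longrightarrow> \<bar>g (b / pi * arccos y) - p y\<bar> < e'"
    using Stone_Weierstrass_real_polynomial_function[OF compact_Icc _ e'] by blast
  obtain c n where c: "p = (\<lambda>x. \<Sum>i\<le>n. c i * x ^ i)" using p(1) real_polynomial_function_iff_sum by blast
  have "cosine_polynomial (\<lambda>\<theta>. p (cos \<theta>))"
    unfolding c by (intro cosine_polynomial_sum cosine_polynomial_scale cosine_polynomial_power) auto
  then obtain M a where a: "\<And>\<theta>. p (cos \<theta>) = (\<Sum>m\<le>M. a m * cos (real m * \<theta>))"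
    unfolding cosine_polynomial_def by blast
  define h where "h x = (\<Sum>m\<le>M. a m * cos (real m * (pi * x / b)))" for x
  have h': "continuous_on {0..b} h" unfolding h_def using b by (intro continuous_intros) auto
  note gi = integrable_continuous_interval_lebesgue[OF g'] and hi = integrable_continuous_interval_lebesgue[OF h']
  have gh: "\<bar>g x - h x\<bar> \<le> e'" if x: "x \<in> {0..b}" for x
  proof -
    have "0 \<le> pi * x / b" "pi * x / b \<le> pi" using x b by (auto simp: field_simps)
    then have "arccos (cos (pi * x / b)) = pi * x / b" by (rule arccos_cos)
    then have "g (b / pi * arccos (cos (pi * x / b))) = g x" using b by simp
    then show ?thesis using p(2)[of "cos (pi * x / b)"] a[of "pi * x / b"] by (simp add: h_def)
  qed
  have "(\<integral>x. \<bar>g x - h x\<bar> \<partial>?L) \<le> e' * (b - 0)"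
    using gh gi hi b by (intro integral_abs_le_bound) auto
  also have "\<dots> \<le> e / 2" using b e by (simp add: e'_def field_simps)
  finally have 1: "(\<integral>x. \<bar>g x - h x\<bar> \<partial>?L) \<le> e / 2" .
  have "(\<integral>x. \<bar>f x - h x\<bar> \<partial>?L) \<le> (\<integral>x. \<bar>f x - g x\<bar> + \<bar>g x - h x\<bar> \<partial>?L)"
    using f gi hi by (intro integral_mono) auto
  also have "\<dots> = (\<integral>x. \<bar>f x - g x\<bar> \<partial>?L) + (\<integral>x. \<bar>g x - h x\<bar> \<partial>?L)"
    using f gi hi by (intro Bochner_Integration.integral_add) auto
  finally show ?thesis using that[of a M] g(2) 1 by (simp add: h_def)
qed

lemma integral_cosine_zero:
  assumes b: "0 < b" and m: "1 \<le> m"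
  shows "(\<integral>x. cos (real m * (pi * x / b)) \<partial>lebesgue_on {0..b}) = 0"
proof -
  define \<nu> where "\<nu> = real m * pi / b"
  have \<nu>: "\<nu> \<noteq> 0" unfolding \<nu>_def using b m by simp
  have eq: "cos (real m * (pi * x / b)) = cos (\<nu> * x)" for x by (simp add: \<nu>_def mult.assoc)
  have "((\<lambda>x. cos (\<nu> * x)) has_integral (sin (\<nu> * b) / \<nu> - sin (\<nu> * 0) / \<nu>)) {0..b}"
  proof (rule fundamental_theorem_of_calculus)
    fix x assume "x \<in> {0..b}"
    show "((\<lambda>x. sin (\<nu> * x) / \<nu>) has_vector_derivative cos (\<nu> * x)) (at x within {0..b})"
      unfolding has_real_derivative_iff_has_vector_derivative[symmetric]
      using \<nu> by (auto intro!: derivative_eq_intros)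
  qed (use b in auto)
  moreover have "sin (\<nu> * b) = 0" using b sin_npi[of m] by (simp add: \<nu>_def)
  ultimately have "integral {0..b} (\<lambda>x. cos (\<nu> * x)) = 0" by (simp add: integral_unique)
  then show ?thesis
    unfolding eq by (subst primitive_continuous(3)) (auto intro!: integrable_continuous_interval_lebesgue continuous_intros)
qed

section \<open>Convergence\<close>

lemma edge_const_L1S: "edge_const c \<in> L1S N d"
  unfolding L1S_iff edge_const_def by (intro ballI integrable_continuous_interval_lebesgue continuous_intros)

locale graph_semigroups = graph_diffusion +
  fixes \<kappa> :: "nat \<Rightarrow> real" and T :: "nat \<Rightarrow> real \<Rightarrow> edge_fun \<Rightarrow> edge_fun"
  assumes kappa_pos: "\<And>n. n \<ge> 1 \<Longrightarrow> \<kappa> n > 0"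
    and kappa_lim: "filterlim \<kappa> at_top sequentially"
    and semigroups: "\<And>n. n \<ge> 1 \<Longrightarrow>
      generates N d (A_star_dom G N d \<sigma> l r lt rt (\<kappa> n)) (A_star d \<sigma> (\<kappa> n)) (T n)"
begin

lemma T_C0: "n \<ge> 1 \<Longrightarrow> C0_semigroup N d (T n)"
  using semigroups by (auto simp: generates_def)

lemma T_closed: "n \<ge> 1 \<Longrightarrow> 0 \<le> t \<Longrightarrow> \<phi> \<in> L1S N d \<Longrightarrow> T n t \<phi> \<in> L1S N d"
  using C0_semigroup_closed[OF T_C0] .

lemma T_contraction: "n \<ge> 1 \<Longrightarrow> 0 \<le> t \<Longrightarrow> \<phi> \<in> L1S N d \<Longrightarrow> L1_norm N d (T n t \<phi>) \<le> L1_norm N d \<phi>"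
  by (rule generated_contraction[OF kappa_pos semigroups])

lemma T_diff:
  assumes "n \<ge> 1" "0 \<le> t" "\<phi> \<in> L1S N d" "\<psi> \<in> L1S N d"
  shows "L1_norm N d (T n t (\<lambda>i x. \<phi> i x - \<psi> i x)) = L1_dist N d (T n t \<phi>) (T n t \<psi>)"
  by (rule bounded_operator_diff[OF C0_semigroup_bounded[OF T_C0]]) (use assms in auto)

lemma T_dist_le:
  assumes "n \<ge> 1" "0 \<le> t" "\<phi> \<in> L1S N d" "\<psi> \<in> L1S N d"
  shows "L1_dist N d (T n t \<phi>) (T n t \<psi>) \<le> L1_dist N d \<phi> \<psi>"
  using T_contraction[OF assms(1,2) L1S_diff[OF assms(3,4)]] T_diff[OF assms] by (simp add: L1_dist_def)

lemma eventually_kappa: "eventually (\<lambda>n. n \<ge> 1 \<and> b \<le> \<kappa> n) sequentially"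
  using kappa_lim eventually_ge_at_top[of "1::nat"]
  by (auto simp: filterlim_at_top intro: eventually_conj)

section \<open>Initial values whose orbits tend to zero uniformly away from time zero\<close>

definition vanishing :: "edge_fun \<Rightarrow> bool" where
  "vanishing \<phi> \<longleftrightarrow> (\<forall>\<delta>>0. \<forall>e>0. \<forall>\<^sub>F n in sequentially. \<forall>t\<ge>\<delta>. L1_norm N d (T n t \<phi>) \<le> e)"

lemma vanishingD:
  "vanishing \<phi> \<Longrightarrow> 0 < \<delta> \<Longrightarrow> 0 < e \<Longrightarrow> \<forall>\<^sub>F n in sequentially. \<forall>t\<ge>\<delta>. L1_norm N d (T n t \<phi>) \<le> e"
  unfolding vanishing_def by blast

text \<open>Contractivity makes the approximation error along the orbits no larger than at the
  start, uniformly in \<open>n\<close> and t.\<close>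

lemma vanishing_closure:
  assumes \<phi>: "\<phi> \<in> L1S N d"
    and approx: "\<And>e. 0 < e \<Longrightarrow> \<exists>\<psi>\<in>L1S N d. vanishing \<psi> \<and> L1_dist N d \<phi> \<psi> \<le> e"
  shows "vanishing \<phi>"
  unfolding vanishing_def
proof (intro allI impI)
  fix \<delta> e :: real assume \<delta>: "0 < \<delta>" and e: "0 < e"
  obtain \<psi> where \<psi>: "\<psi> \<in> L1S N d" "vanishing \<psi>" "L1_dist N d \<phi> \<psi> \<le> e/2"
    using approx[of "e/2"] e by auto
  have "\<forall>\<^sub>F n in sequentially. \<forall>t\<ge>\<delta>. L1_norm N d (T n t \<psi>) \<le> e/2"
    using e by (intro vanishingD \<psi>(2) \<delta>) simp
  then show "\<forall>\<^sub>F n in sequentially. \<forall>t\<ge>\<delta>. L1_norm N d (T n t \<phi>) \<le> e"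
    using eventually_ge_at_top[of 1]
  proof eventually_elim
    case (elim n)
    show ?case
    proof (intro allI impI)
      fix t assume t: "\<delta> \<le> t"
      have "L1_norm N d (T n t \<phi>) \<le> L1_norm N d (T n t \<psi>) + L1_dist N d (T n t \<phi>) (T n t \<psi>)"
        using elim t \<delta> by (intro L1_norm_le_dist T_closed \<phi> \<psi>(1)) auto
      moreover have "L1_dist N d (T n t \<phi>) (T n t \<psi>) \<le> L1_dist N d \<phi> \<psi>"
        using elim t \<delta> by (intro T_dist_le \<phi> \<psi>(1)) auto
      moreover have "L1_norm N d (T n t \<psi>) \<le> e/2" using elim t by blast
      ultimately show "L1_norm N d (T n t \<phi>) \<le> e" using \<psi>(3) by linarith
    qed
  qed
qed

lemma vanishing_zero: "vanishing (\<lambda>i x. 0)"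
  unfolding vanishing_def
proof (intro allI impI)
  fix \<delta> e :: real assume pos: "0 < \<delta>" "0 < e"
  have "L1_norm N d (T n t (\<lambda>i x. 0)) \<le> e" if "n \<ge> 1" "\<delta> \<le> t" for n t
    using T_contraction[OF that(1) _ L1S_zero, of t] L1_norm_zero[of N d] pos that(2) by simp
  then show "\<forall>\<^sub>F n in sequentially. \<forall>t\<ge>\<delta>. L1_norm N d (T n t (\<lambda>i x. 0)) \<le> e"
    by (intro eventually_mono[OF eventually_ge_at_top[of 1]]) blast
qed

lemma vanishing_lincomb:
  assumes \<phi>: "\<phi> \<in> L1S N d" "vanishing \<phi>" and \<psi>: "\<psi> \<in> L1S N d" "vanishing \<psi>"
  shows "vanishing (\<lambda>i x. a * \<phi> i x + \<psi> i x)"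
  unfolding vanishing_def
proof (intro allI impI)
  fix \<delta> e :: real assume \<delta>: "0 < \<delta>" and e: "0 < e"
  define e1 where "e1 = e / (2 * (\<bar>a\<bar> + 1))"
  have e1: "0 < e1" using e by (simp add: e1_def)
  have "\<forall>\<^sub>F n in sequentially. \<forall>t\<ge>\<delta>. L1_norm N d (T n t \<phi>) \<le> e1"
    "\<forall>\<^sub>F n in sequentially. \<forall>t\<ge>\<delta>. L1_norm N d (T n t \<psi>) \<le> e/2"
    using e by (intro vanishingD \<phi>(2) \<psi>(2) \<delta> e1; simp)+
  then show "\<forall>\<^sub>F n in sequentially. \<forall>t\<ge>\<delta>. L1_norm N d (T n t (\<lambda>i x. a * \<phi> i x + \<psi> i x)) \<le> e"
    using eventually_ge_at_top[of 1]
  proof eventually_elim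
    case (elim n)
    show ?case
    proof (intro allI impI)
      fix t assume t: "\<delta> \<le> t"
      have t0: "0 \<le> t" using t \<delta> by simp
      note TL = T_closed[OF elim(3) t0]
      have "L1_dist N d (T n t (\<lambda>i x. a * \<phi> i x + \<psi> i x)) (\<lambda>i x. a * T n t \<phi> i x + T n t \<psi> i x) = 0"
        using bounded_operator_lincomb[OF C0_semigroup_bounded[OF T_C0[OF elim(3)] t0] \<phi>(1) \<psi>(1), of a 1] by simp
      then have "L1_norm N d (T n t (\<lambda>i x. a * \<phi> i x + \<psi> i x)) = L1_norm N d (\<lambda>i x. a * T n t \<phi> i x + T n t \<psi> i x)"
        by (intro L1_norm_cong TL L1S_intros \<phi>(1) \<psi>(1))
      also have "\<dots> \<le> \<bar>a\<bar> * L1_norm N d (T n t \<phi>) + L1_norm N d (T n t \<psi>)"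
        unfolding L1_norm_scale[symmetric] by (intro L1_norm_add_le TL L1S_intros \<phi>(1) \<psi>(1))
      also have "\<dots> \<le> \<bar>a\<bar> * e1 + e/2"
        using elim t by (intro add_mono mult_left_mono) auto
      also have "\<bar>a\<bar> * e1 \<le> e/2" using e by (simp add: e1_def field_simps)
      finally show "L1_norm N d (T n t (\<lambda>i x. a * \<phi> i x + \<psi> i x)) \<le> e" by simp
    qed
  qed
qed

lemma vanishing_sum:
  assumes "finite I" "\<And>k. k \<in> I \<Longrightarrow> \<phi> k \<in> L1S N d" "\<And>k. k \<in> I \<Longrightarrow> vanishing (\<phi> k)"
  shows "vanishing (\<lambda>i x. \<Sum>k\<in>I. a k * \<phi> k i x)"
  using assms
proof (induction I)
  case empty
  then show ?case by (simp add: vanishing_zero)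
next
  case (insert k I)
  then have "vanishing (\<lambda>i x. a k * \<phi> k i x + (\<Sum>k\<in>I. a k * \<phi> k i x))"
    by (intro vanishing_lincomb) (auto intro!: L1S_intros)
  then show ?case using insert by simp
qed

text \<open>The orbit of the corrected cosine \<psi> is compared with
  \<open>exp (- (k * \<mu>) * s)\<close> times \<psi>. The error rate at time s is at most
  \<open>K\<close> times the same exponential, so the total error is at most
  \<open>K / (k * \<mu>)\<close> although \<open>K\<close> itself is not small.\<close>

lemma vanishing_cosine:
  assumes i0: "i0 \<in> {1..N}" and m: "1 \<le> m"
  shows "vanishing (\<lambda>i x. if i = i0 then cos (real m * (pi * x / d i0)) else 0)" (is "vanishing ?f")
    and "(\<lambda>i x. if i = i0 then cos (real m * (pi * x / d i0)) else 0) \<in> L1S N d"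
proof -
  obtain K \<mu> where K: "0 \<le> K" and \<mu>: "0 < \<mu>" and fL: "?f \<in> L1S N d"
    and approx: "\<And>k. 1 \<le> k \<Longrightarrow> \<exists>\<psi>\<in>A_star_dom G N d \<sigma> l r lt rt k.
     L1_dist N d \<psi> ?f \<le> K / k \<and> L1_dist N d (A_star d \<sigma> k \<psi>) (\<lambda>i x. - (k * \<mu>) * \<psi> i x) \<le> K"
    by (rule cosine_approximation[OF i0 m]) blast
  show "?f \<in> L1S N d" by (rule fL)
  show "vanishing ?f"
    unfolding vanishing_def
  proof (intro allI impI)
    fix \<delta> e :: real assume \<delta>: "0 < \<delta>" and e: "0 < e"
    define F where "F = L1_norm N d ?f"
    \<comment> \<open>The three terms: replacing the cosine by \<psi>, the accumulated error, and
      the size of the comparison orbit at times from \<delta> on, where \<open>F + K\<close> bounds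
      the norm of \<psi> for k \<ge> 1.\<close>
    define B where "B k = K / k + K / (k * \<mu>) + exp (- (k * \<mu>) * \<delta>) * (F + K)" for k
    have lim: "(\<lambda>n. B (\<kappa> n)) \<longlonglongrightarrow> 0"
    proof -
      have "((\<lambda>k. K / k + K / \<mu> / k + exp (- (k * (\<mu> * \<delta>))) * (F + K)) \<longlongrightarrow> 0 + 0 + 0 * (F + K)) at_top"
      proof (intro tendsto_add tendsto_mult tendsto_const)
        show "((\<lambda>k. K / k) \<longlongrightarrow> 0) at_top" "((\<lambda>k. K / \<mu> / k) \<longlongrightarrow> 0) at_top"
          by (intro tendsto_divide_0[OF tendsto_const] filterlim_at_top_imp_at_infinity filterlim_ident)+
        have "filterlim (\<lambda>k. k * (\<mu> * \<delta>)) at_top at_top"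
          using \<mu> \<delta> by (intro filterlim_at_top_mult_tendsto_pos[OF tendsto_const] filterlim_ident) auto
        then show "((\<lambda>k. exp (- (k * (\<mu> * \<delta>)))) \<longlongrightarrow> 0) at_top"
          by (intro filterlim_compose[OF exp_at_bot] filterlim_compose[OF filterlim_uminus_at_bot_at_top])
      qed
      moreover have "B = (\<lambda>k. K / k + K / \<mu> / k + exp (- (k * (\<mu> * \<delta>))) * (F + K))"
        by (rule ext) (simp add: B_def ac_simps)
      ultimately have "(B \<longlongrightarrow> 0) at_top" by simp
      then show ?thesis using kappa_lim by (rule filterlim_compose)
    qed
    then have "\<forall>\<^sub>F n in sequentially. B (\<kappa> n) < e" using e by (rule order_tendstoD(2))
    then show "\<forall>\<^sub>F n in sequentially. \<forall>t\<ge>\<delta>. L1_norm N d (T n t ?f) \<le> e"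
      using eventually_kappa[of 1]
    proof eventually_elim
      case (elim n)
      define k where "k = \<kappa> n"
      have n: "n \<ge> 1" and k: "1 \<le> k" using elim by (auto simp: k_def)
      obtain \<psi> where \<psi>: "\<psi> \<in> A_star_dom G N d \<sigma> l r lt rt k" "L1_dist N d \<psi> ?f \<le> K / k"
        "L1_dist N d (A_star d \<sigma> k \<psi>) (\<lambda>i x. - (k * \<mu>) * \<psi> i x) \<le> K"
        using approx[OF k] by blast
      have \<psi>L: "\<psi> \<in> L1S N d" and W: "\<psi> \<in> W21 N d" using \<psi>(1) by (auto simp: A_star_dom_def W21_def)
      have gen: "has_generator_value N d (T n) \<psi> (A_star d \<sigma> k \<psi>)"
        using semigroups[OF n] \<psi>(1) unfolding generates_def k_def by blast
      show ?case
      proof (intro allI impI)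
        fix t assume t: "\<delta> \<le> t"
        have t0: "0 \<le> t" using t \<delta> by simp
        define a where "a s = exp (- (k * \<mu>) * s)" for s
        have km: "0 < k * \<mu>" using k \<mu> by simp
        \<comment> \<open>\<open>approximate_orbit\<close> with a single summand, indexed by the
          unit type. The error function is \<open>- (K / (k * \<mu>)) * a s\<close>, an
          antiderivative of \<open>K * a s\<close>.\<close>
        have "L1_dist N d (T n t (\<lambda>i x. \<Sum>j\<in>{()}. a 0 * \<psi> i x)) (\<lambda>i x. \<Sum>j\<in>{()}. a t * \<psi> i x) \<le>
            - (K / (k * \<mu>)) * a t - (- (K / (k * \<mu>)) * a 0)"
        proof (rule approximate_orbit[OF T_C0[OF n] T_contraction[OF n], where \<psi>="\<lambda>_. A_star d \<sigma> k \<psi>"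
              and a'="\<lambda>_ s. - (k * \<mu>) * a s" and E'="\<lambda>s. K * a s"])
          show "((\<lambda>s. a s) has_real_derivative - (k * \<mu>) * a s) (at s)" for s
            unfolding a_def by (auto intro!: derivative_eq_intros)
          then show "((\<lambda>s. - (K / (k * \<mu>)) * a s) has_real_derivative K * a s) (at s)" for s
            using km by (auto intro!: derivative_eq_intros)
          fix s :: real assume "0 \<le> s"
          have "L1_dist N d (\<lambda>i x. - (k * \<mu>) * a s * \<psi> i x) (\<lambda>i x. a s * A_star d \<sigma> k \<psi> i x) =
            L1_norm N d (\<lambda>i x. a s * (- (k * \<mu>) * \<psi> i x - A_star d \<sigma> k \<psi> i x))"
            unfolding L1_dist_def by (rule arg_cong[where f="L1_norm N d"]) (simp add: fun_eq_iff algebra_simps)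
          also have "\<dots> = a s * L1_dist N d (A_star d \<sigma> k \<psi>) (\<lambda>i x. - (k * \<mu>) * \<psi> i x)"
            unfolding L1_norm_scale by (simp add: a_def L1_dist_def[symmetric] L1_dist_commute)
          also have "\<dots> \<le> a s * K" by (intro mult_left_mono \<psi>) (simp add: a_def)
          finally show "L1_dist N d (\<lambda>i x. \<Sum>j\<in>{()}. - (k * \<mu>) * a s * \<psi> i x) (\<lambda>i x. \<Sum>j\<in>{()}. a s * A_star d \<sigma> k \<psi> i x) \<le> K * a s"
            by (simp add: mult.commute)
        qed (use \<psi>L gen t0 in auto)
        then have 1: "L1_dist N d (T n t \<psi>) (\<lambda>i x. a t * \<psi> i x) \<le> K / (k * \<mu>) - K / (k * \<mu>) * a t"
          by (simp add: a_def)
        also have "\<dots> \<le> K / (k * \<mu>)" using K km by (simp add: a_def)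
        finally have 1: "L1_dist N d (T n t \<psi>) (\<lambda>i x. a t * \<psi> i x) \<le> K / (k * \<mu>)" .
        have "K / k \<le> K" using mult_left_mono[OF k K] k by (simp add: divide_le_eq)
        then have "L1_norm N d \<psi> \<le> F + K"
          using L1_norm_le_dist[OF \<psi>L fL] \<psi>(2) by (simp add: F_def)
        moreover have "a t \<le> exp (- (k * \<mu>) * \<delta>)" using mult_left_mono[OF t less_imp_le[OF km]] by (simp add: a_def)
        ultimately have 2: "L1_norm N d (\<lambda>i x. a t * \<psi> i x) \<le> exp (- (k * \<mu>) * \<delta>) * (F + K)"
          unfolding L1_norm_scale by (intro mult_mono) (auto simp: a_def L1_norm_nonneg)
        have 3: "L1_dist N d (T n t ?f) (T n t \<psi>) \<le> K / k"
          using T_dist_le[OF n t0 fL \<psi>L] \<psi>(2) L1_dist_commute[of N d \<psi>] by simp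
        have TL: "T n t \<psi> \<in> L1S N d" "T n t ?f \<in> L1S N d" by (intro T_closed n t0 \<psi>L fL)+
        have "L1_norm N d (T n t ?f) \<le> L1_norm N d (\<lambda>i x. a t * \<psi> i x) + K / (k * \<mu>) + K / k"
          using L1_norm_le_dist[OF TL(2,1)] L1_norm_le_dist[OF TL(1) L1S_scale[OF \<psi>L], of "a t"] 1 3 by linarith
        also have "\<dots> \<le> B k" using 2 by (simp add: B_def)
        finally show "L1_norm N d (T n t ?f) \<le> e" using elim by (simp add: k_def)
      qed
    qed
  qed
qed

text \<open>The constant term has to be dropped from the approximating cosine polynomial. All other
  cosines and the given function have mean zero, so that term times the length is bounded by the
  approximation error, and dropping it at most doubles the error.\<close>

lemma vanishing_mean_zero:
  assumes \<phi>: "\<phi> \<in> L1S N d" and mean: "\<And>i. i \<in> {1..N} \<Longrightarrow> integral\<^sup>L (lebesgue_on {0..d i}) (\<phi> i) = 0"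
  shows "vanishing \<phi>"
proof (rule vanishing_closure[OF \<phi>])
  fix e :: real assume e: "0 < e"
  define e1 where "e1 = e / (2 * (real N + 1))"
  have e1: "0 < e1" using e by (simp add: e1_def)
  define P where "P i M a \<longleftrightarrow> (i \<in> {1..N} \<longrightarrow>
      (\<integral>x. \<bar>\<phi> i x - (\<Sum>m\<le>M. a m * cos (real m * (pi * x / d i)))\<bar> \<partial>lebesgue_on {0..d i}) < e1)"
    for i and M :: nat and a :: "nat \<Rightarrow> real"
  have "\<exists>M a. P i M a" for i
  proof (cases "i \<in> {1..N}")
    case True
    then have "integrable (lebesgue_on {0..d i}) (\<phi> i)" using \<phi> by (auto simp: L1S_iff)
    from cosine_polynomials_dense_L1[OF length_pos[OF True] this e1] show ?thesis unfolding P_def by metis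
  next
    case False
    then show ?thesis unfolding P_def by blast
  qed
  then obtain M a where "\<And>i. P i (M i) (a i)" by metis
  then have a: "(\<integral>x. \<bar>\<phi> i x - (\<Sum>m\<le>M i. a i m * cos (real m * (pi * x / d i)))\<bar> \<partial>lebesgue_on {0..d i}) < e1"
    if "i \<in> {1..N}" for i
    using that unfolding P_def by blast
  \<comment> \<open>Pairs of an edge and a frequency; frequencies start at 1, which leaves out the
    constant term.\<close>
  define I where "I = (SIGMA i:{1..N}. {1..M i})"
  define c where "c p = (\<lambda>i x. if i = fst p then cos (real (snd p) * (pi * x / d (fst p))) else 0)" for p :: "nat \<times> nat"
  define \<psi> where "\<psi> = (\<lambda>i x. \<Sum>p\<in>I. a (fst p) (snd p) * c p i x)"
  have cL: "c p \<in> L1S N d" and cv: "vanishing (c p)" if "p \<in> I" for p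
    using that vanishing_cosine[of "fst p" "snd p"] unfolding c_def I_def by auto
  have fin: "finite I" by (simp add: I_def)
  have \<psi>i: "\<psi> i x = (\<Sum>m=1..M i. a i m * cos (real m * (pi * x / d i)))" if i: "i \<in> {1..N}" for i x
  proof -
    have "\<psi> i x = (\<Sum>j=1..N. \<Sum>m=1..M j. a j m * c (j, m) i x)"
      unfolding \<psi>_def I_def by (subst sum.Sigma) (auto simp: split_def)
    also have "\<dots> = (\<Sum>j=1..N. if i = j then (\<Sum>m=1..M i. a i m * cos (real m * (pi * x / d i))) else 0)"
      by (intro sum.cong refl) (auto simp: c_def)
    finally show ?thesis using i by simp
  qed
  have "L1_dist N d \<phi> \<psi> \<le> (\<Sum>i=1..N. 2 * e1)"
    unfolding L1_dist_def L1_norm_eq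
  proof (rule sum_mono)
    fix i assume i: "i \<in> {1..N}"
    let ?L = "lebesgue_on {0..d i}"
    let ?g = "\<lambda>x. \<Sum>m\<le>M i. a i m * cos (real m * (pi * x / d i))"
    have di: "0 < d i" by (rule length_pos[OF i])
    have g: "?g x = a i 0 + \<psi> i x" for x
      unfolding \<psi>i[OF i] by (subst sum.atMost_shift) (simp add: sum.atLeast1_atMost_eq lessThan_Suc_atMost)
    have cosi: "integrable ?L (\<lambda>x. cos (real m * (pi * x / d i)))" for m
      using di by (intro integrable_continuous_interval_lebesgue continuous_intros) auto
    have \<psi>int: "integrable ?L (\<psi> i)"
      unfolding \<psi>i[OF i, abs_def] by (intro Bochner_Integration.integrable_sum integrable_mult_right cosi)
    have \<phi>int: "integrable ?L (\<phi> i)" using \<phi> i by (auto simp: L1S_iff)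
    have const: "integrable ?L (\<lambda>x. a i 0)" by (intro integrable_continuous_interval_lebesgue continuous_intros)
    have "(\<integral>x. \<psi> i x \<partial>?L) = (\<Sum>m=1..M i. a i m * (\<integral>x. cos (real m * (pi * x / d i)) \<partial>?L))"
      unfolding \<psi>i[OF i] using cosi by (subst Bochner_Integration.integral_sum) auto
    also have "\<dots> = 0" using integral_cosine_zero[OF di] by (intro sum.neutral) auto
    finally have \<psi>0: "(\<integral>x. \<psi> i x \<partial>?L) = 0" .
    \<comment> \<open>Integrating the approximation error isolates the constant coefficient.\<close>
    have "(\<integral>x. \<phi> i x - (a i 0 + \<psi> i x) \<partial>?L) = - (a i 0 * d i)"
      using \<phi>int \<psi>int const mean[OF i] \<psi>0 measure_interval[of 0 "d i"] di by simp
    then have "\<bar>a i 0\<bar> * d i \<le> (\<integral>x. \<bar>\<phi> i x - ?g x\<bar> \<partial>?L)"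
      unfolding g using integral_abs_bound[of ?L "\<lambda>x. \<phi> i x - (a i 0 + \<psi> i x)"] di by (simp add: abs_mult)
    then have 1: "\<bar>a i 0\<bar> * d i \<le> e1" using a[OF i] by simp
    have "(\<integral>x. \<bar>\<phi> i x - \<psi> i x\<bar> \<partial>?L) \<le> (\<integral>x. \<bar>\<phi> i x - ?g x\<bar> + \<bar>a i 0\<bar> \<partial>?L)"
      unfolding g using \<phi>int \<psi>int const by (intro integral_mono) auto
    also have "\<dots> = (\<integral>x. \<bar>\<phi> i x - ?g x\<bar> \<partial>?L) + \<bar>a i 0\<bar> * d i"
      unfolding g using \<phi>int \<psi>int const measure_interval[of 0 "d i"] di
      by (subst Bochner_Integration.integral_add) auto
    finally show "(\<integral>x. \<bar>\<phi> i x - \<psi> i x\<bar> \<partial>?L) \<le> 2 * e1" using 1 a[OF i] by simp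
  qed
  also have "\<dots> \<le> e" using e by (simp add: e1_def field_simps)
  finally have "L1_dist N d \<phi> \<psi> \<le> e" .
  moreover have "vanishing \<psi>" unfolding \<psi>_def by (rule vanishing_sum[OF fin cL cv])
  moreover have "\<psi> \<in> L1S N d" unfolding \<psi>_def by (intro L1S_intros cL)
  ultimately show "\<exists>\<psi>\<in>L1S N d. vanishing \<psi> \<and> L1_dist N d \<phi> \<psi> \<le> e" by blast
qed

text \<open>The limit orbit is expanded in unit vectors, \<open>a j s\<close> being its j-th
  coordinate, and each unit vector is replaced by its approximation \<open>\<psi> j\<close> in the
  domain. Since the approximations do not depend on s, the combination fits
  \<open>approximate_orbit\<close>; the coordinates have to be bounded, whence the restriction to
  \<open>{0..\<tau>}\<close>.\<close>

lemma constants_converge: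
  assumes \<tau>: "0 \<le> \<tau>" and e: "0 < e"
  shows "\<forall>\<^sub>F n in sequentially. \<forall>t\<in>{0..\<tau>}.
    L1_dist N d (T n t (edge_const c)) (edge_const (exp_Q N (q_coeff d \<sigma> l r lt rt) t c)) \<le> e"
proof -
  let ?q = "q_coeff d \<sigma> l r lt rt"
  let ?I = "{1..N}"
  define u where "u j = (\<lambda>i. if i = j then 1 else 0 :: real)" for j :: nat
  define a where "a j s = exp_Q N ?q s c j" for j s
  define a' where "a' j s = exp_Q N ?q s (Q_op N ?q c) j" for j s
  have "\<forall>j. \<exists>K\<ge>0. \<forall>k\<ge>1. \<exists>\<psi>\<in>A_star_dom G N d \<sigma> l r lt rt k.
     L1_dist N d \<psi> (edge_const (u j)) \<le> K / k \<and> L1_dist N d (A_star d \<sigma> k \<psi>) (edge_const (Q_op N ?q (u j))) \<le> K / k"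
    using constant_approximation by metis
  then obtain K where K: "\<And>j. 0 \<le> K j" and approx: "\<And>j k. 1 \<le> k \<Longrightarrow> \<exists>\<psi>\<in>A_star_dom G N d \<sigma> l r lt rt k.
     L1_dist N d \<psi> (edge_const (u j)) \<le> K j / k \<and> L1_dist N d (A_star d \<sigma> k \<psi>) (edge_const (Q_op N ?q (u j))) \<le> K j / k"
    by metis
  have der: "(a j has_real_derivative a' j s) (at s)" if "j \<in> ?I" for j s
    unfolding a_def[abs_def] a'_def by (rule exp_Q_derivative[OF that])
  have ca: "continuous_on {0..\<tau>} (a j)" "continuous_on {0..\<tau>} (a' j)" if "j \<in> ?I" for j
    unfolding a_def[abs_def] a'_def[abs_def]
    by (rule DERIV_continuous_on[OF has_field_derivative_at_within[OF exp_Q_derivative[OF that]]])+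
  have "\<exists>B. \<forall>s\<in>{0..\<tau>}. j \<in> ?I \<longrightarrow> \<bar>a j s\<bar> \<le> B \<and> \<bar>a' j s\<bar> \<le> B" for j
  proof (cases "j \<in> ?I")
    case True
    obtain B1 where "\<And>s. s \<in> {0..\<tau>} \<Longrightarrow> \<bar>a j s\<bar> \<le> B1" by (rule continuous_interval_bounded[OF ca(1)[OF True]]) blast
    moreover obtain B2 where "\<And>s. s \<in> {0..\<tau>} \<Longrightarrow> \<bar>a' j s\<bar> \<le> B2" by (rule continuous_interval_bounded[OF ca(2)[OF True]]) blast
    ultimately show ?thesis by (intro exI[of _ "max B1 B2"]) (auto simp: le_max_iff_disj)
  qed blast
  then obtain B where B: "\<And>j s. s \<in> {0..\<tau>} \<Longrightarrow> j \<in> ?I \<Longrightarrow> \<bar>a j s\<bar> \<le> B j \<and> \<bar>a' j s\<bar> \<le> B j" by metis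
  \<comment> \<open>\<open>C / k\<close> bounds the norm of any combination of the approximation
    errors whose coefficients are bounded by \<open>B\<close>.\<close>
  define C where "C = (\<Sum>j\<in>?I. B j * K j)"
  \<comment> \<open>The first term is the error accumulated up to time \<tau>; the second covers the
    exchange between constants and approximations at times 0 and t.\<close>
  define \<beta> where "\<beta> k = (2 * C / k) * \<tau> + 2 * C / k" for k
  have "((\<lambda>k. 2 * C / k * \<tau> + 2 * C / k) \<longlongrightarrow> 0 * \<tau> + 0) at_top"
    by (intro tendsto_add tendsto_mult tendsto_const tendsto_divide_0[OF tendsto_const] filterlim_at_top_imp_at_infinity filterlim_ident)
  then have "(\<beta> \<longlongrightarrow> 0) at_top" unfolding \<beta>_def[abs_def] by simp
  then have "(\<lambda>n. \<beta> (\<kappa> n)) \<longlonglongrightarrow> 0" using kappa_lim by (rule filterlim_compose)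
  then have "\<forall>\<^sub>F n in sequentially. \<beta> (\<kappa> n) < e" using e by (rule order_tendstoD(2))
  then show ?thesis using eventually_kappa[of 1]
  proof eventually_elim
    case (elim n)
    define k where "k = \<kappa> n"
    have n: "n \<ge> 1" and k: "1 \<le> k" using elim by (auto simp: k_def)
    obtain \<psi> where \<psi>: "\<And>j. \<psi> j \<in> A_star_dom G N d \<sigma> l r lt rt k"
      "\<And>j. L1_dist N d (\<psi> j) (edge_const (u j)) \<le> K j / k"
      "\<And>j. L1_dist N d (A_star d \<sigma> k (\<psi> j)) (edge_const (Q_op N ?q (u j))) \<le> K j / k"
      using approx[OF k] by metis
    have \<psi>L: "\<psi> j \<in> L1S N d" and AL: "A_star d \<sigma> k (\<psi> j) \<in> L1S N d" for j
      using \<psi>(1)[of j] A_star_L1S by (auto simp: A_star_dom_def W21_def)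
    have gen: "has_generator_value N d (T n) (\<psi> j) (A_star d \<sigma> k (\<psi> j))" for j
      using semigroups[OF n] \<psi>(1) unfolding generates_def k_def by blast
    have bound: "L1_norm N d (\<lambda>i x. \<Sum>j\<in>?I. b j * \<xi> j i x) \<le> C / k"
      if b: "\<And>j. j \<in> ?I \<Longrightarrow> \<bar>b j\<bar> \<le> B j" and \<xi>: "\<And>j. \<xi> j \<in> L1S N d" "\<And>j. L1_norm N d (\<xi> j) \<le> K j / k" for b \<xi>
    proof -
      have "L1_norm N d (\<lambda>i x. \<Sum>j\<in>?I. b j * \<xi> j i x) \<le> (\<Sum>j\<in>?I. \<bar>b j\<bar> * L1_norm N d (\<xi> j))"
        by (rule L1_norm_sum_le) (use \<xi> in auto)
      also have "\<dots> \<le> (\<Sum>j\<in>?I. B j * (K j / k))"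
        using b \<xi>(2) by (intro sum_mono mult_mono) (auto simp: L1_norm_nonneg intro: order_trans[OF abs_ge_zero])
      also have "\<dots> = C / k" by (simp add: C_def sum_divide_distrib)
      finally show ?thesis .
    qed
    have dL: "(\<lambda>i x. \<psi> j i x - edge_const (u j) i x) \<in> L1S N d"
      "(\<lambda>i x. A_star d \<sigma> k (\<psi> j) i x - edge_const (Q_op N ?q (u j)) i x) \<in> L1S N d" for j
      by (intro L1S_intros \<psi>L AL edge_const_L1S)+
    have near: "L1_dist N d (\<lambda>i x. \<Sum>j\<in>?I. a j s * \<psi> j i x) (edge_const (\<lambda>j. a j s)) \<le> C / k" if s: "s \<in> {0..\<tau>}" for s
    proof -
      have "L1_dist N d (\<lambda>i x. \<Sum>j\<in>?I. a j s * \<psi> j i x) (edge_const (\<lambda>j. a j s)) =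
          L1_norm N d (\<lambda>i x. \<Sum>j\<in>?I. a j s * (\<psi> j i x - edge_const (u j) i x))"
        unfolding L1_dist_def
      proof (rule L1_norm_cong_on)
        fix i x assume i: "i \<in> ?I"
        have "(\<Sum>j\<in>?I. a j s * edge_const (u j) i x) = (\<Sum>j\<in>?I. if i = j then a j s else 0)"
          by (intro sum.cong) (auto simp: edge_const_def u_def)
        also have "\<dots> = a i s" using i by simp
        finally show "(\<Sum>j\<in>?I. a j s * \<psi> j i x) - edge_const (\<lambda>j. a j s) i x = (\<Sum>j\<in>?I. a j s * (\<psi> j i x - edge_const (u j) i x))"
          by (simp add: right_diff_distrib sum_subtractf edge_const_def[of "\<lambda>j. a j s"])
      qed
      also have "\<dots> \<le> C / k" using B[OF s] \<psi>(2) by (intro bound dL) (auto simp: L1_dist_def)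
      finally show ?thesis .
    qed
    show ?case
    proof
      fix t assume t: "t \<in> {0..\<tau>}"
      have t0: "0 \<le> t" "t \<le> \<tau>" using t by auto
      have "L1_dist N d (T n t (\<lambda>i x. \<Sum>j\<in>?I. a j 0 * \<psi> j i x)) (\<lambda>i x. \<Sum>j\<in>?I. a j t * \<psi> j i x) \<le>
          (2 * C / k) * t - (2 * C / k) * 0"
      \<comment> \<open>The error rate is constant: one \<open>C / k\<close> for replacing
        \<open>\<psi> j\<close> by the unit vector in the derivative, one for replacing
        \<open>A_star\<close> at \<open>\<psi> j\<close> by Q at the unit vector.\<close>
      proof (rule approximate_orbit[OF T_C0[OF n] T_contraction[OF n], where \<psi>="\<lambda>j. A_star d \<sigma> k (\<psi> j)" and a'=a' and E'="\<lambda>_. 2 * C / k"])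
        show "((\<lambda>s. 2 * C / k * s) has_real_derivative 2 * C / k) (at s)" for s
          using DERIV_cmult_Id[of "2 * C / k"] .
        fix s assume "0 \<le> s" "s \<le> t"
        then have s: "s \<in> {0..\<tau>}" using t by auto
        let ?d1 = "\<lambda>i x. \<Sum>j\<in>?I. a' j s * (\<psi> j i x - edge_const (u j) i x)"
        let ?d2 = "\<lambda>i x. \<Sum>j\<in>?I. (- a j s) * (A_star d \<sigma> k (\<psi> j) i x - edge_const (Q_op N ?q (u j)) i x)"
        have "L1_dist N d (\<lambda>i x. \<Sum>j\<in>?I. a' j s * \<psi> j i x) (\<lambda>i x. \<Sum>j\<in>?I. a j s * A_star d \<sigma> k (\<psi> j) i x) =
            L1_norm N d (\<lambda>i x. ?d1 i x + ?d2 i x)"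
          unfolding L1_dist_def
        proof (rule L1_norm_cong_on)
          fix i x assume i: "i \<in> ?I"
          \<comment> \<open>With the exact unit vectors the two combinations coincide: this chain is
            the equation of the limit orbit in coordinates, so only the deviations
            \<open>?d1\<close> and \<open>?d2\<close> survive.\<close>
          have "(\<Sum>j\<in>?I. a' j s * edge_const (u j) i x) = (\<Sum>j\<in>?I. if i = j then a' j s else 0)"
            by (intro sum.cong) (auto simp: edge_const_def u_def)
          also have "\<dots> = a' i s" using i by simp
          also have "\<dots> = Q_op N ?q (\<lambda>j. a j s) i" unfolding a'_def a_def by (rule exp_Q_commute[OF i])
          also have "\<dots> = (\<Sum>j\<in>?I. ?q i j * a j s)" by (rule Q_op_eq_sum[OF i])
          also have "\<dots> = (\<Sum>j\<in>?I. a j s * edge_const (Q_op N ?q (u j)) i x)"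
          proof (rule sum.cong)
            fix j assume j: "j \<in> ?I"
            have "Q_op N ?q (u j) i = (\<Sum>m\<in>?I. if j = m then ?q i m else 0)"
              unfolding Q_op_eq_sum[OF i] by (intro sum.cong) (auto simp: u_def)
            also have "\<dots> = ?q i j" using j by simp
            finally show "?q i j * a j s = a j s * edge_const (Q_op N ?q (u j)) i x" by (simp add: edge_const_def)
          qed simp
          finally show "(\<Sum>j\<in>?I. a' j s * \<psi> j i x) - (\<Sum>j\<in>?I. a j s * A_star d \<sigma> k (\<psi> j) i x) = ?d1 i x + ?d2 i x"
            by (simp add: right_diff_distrib sum_subtractf sum_negf)
        qed
        also have "\<dots> \<le> L1_norm N d ?d1 + L1_norm N d ?d2"
          by (intro L1_norm_add_le L1S_intros \<psi>L AL edge_const_L1S)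
        also have "\<dots> \<le> C / k + C / k"
          using B[OF s] \<psi>(2,3) by (intro add_mono bound dL) (auto simp: L1_dist_def)
        finally show "L1_dist N d (\<lambda>i x. \<Sum>j\<in>?I. a' j s * \<psi> j i x) (\<lambda>i x. \<Sum>j\<in>?I. a j s * A_star d \<sigma> k (\<psi> j) i x) \<le> 2 * C / k"
          by simp
      qed (use \<psi>L gen t0 der in auto)
      moreover have "(2 * C / k) * t \<le> (2 * C / k) * \<tau>"
      proof (rule mult_left_mono[OF t0(2)])
        \<comment> \<open>The sign is read off from the fact that \<open>C / k\<close> bounds a
          distance.\<close>
        have "0 \<le> C / k" using near[of 0] \<tau> L1_dist_nonneg by (meson atLeastAtMost_iff order_refl order_trans)
        then show "0 \<le> 2 * C / k" by simp
      qed
      moreover have sL: "(\<lambda>i x. \<Sum>j\<in>?I. a j s * \<psi> j i x) \<in> L1S N d" for s by (intro L1S_intros \<psi>L)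
      moreover have a0: "(\<lambda>j. a j 0) = c" by (simp add: a_def exp_Q_zero)
      have "L1_dist N d (T n t (edge_const c)) (T n t (\<lambda>i x. \<Sum>j\<in>?I. a j 0 * \<psi> j i x)) \<le> C / k"
        using T_dist_le[OF n t0(1) edge_const_L1S sL] near[of 0] \<tau> unfolding a0
        by (subst (asm) (2) L1_dist_commute) (auto intro: order_trans)
      moreover have "L1_dist N d (\<lambda>i x. \<Sum>j\<in>?I. a j t * \<psi> j i x) (edge_const (exp_Q N ?q t c)) \<le> C / k"
        using near[OF t] by (simp add: a_def)
      moreover have "L1_dist N d (T n t (edge_const c)) (edge_const (exp_Q N ?q t c)) \<le>
          L1_dist N d (T n t (edge_const c)) (T n t (\<lambda>i x. \<Sum>j\<in>?I. a j 0 * \<psi> j i x)) +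
          (L1_dist N d (T n t (\<lambda>i x. \<Sum>j\<in>?I. a j 0 * \<psi> j i x)) (\<lambda>i x. \<Sum>j\<in>?I. a j t * \<psi> j i x) +
           L1_dist N d (\<lambda>i x. \<Sum>j\<in>?I. a j t * \<psi> j i x) (edge_const (exp_Q N ?q t c)))"
        by (intro order_trans[OF L1_dist_triangle add_left_mono[OF L1_dist_triangle]] T_closed n t0 edge_const_L1S sL)
      ultimately have "L1_dist N d (T n t (edge_const c)) (edge_const (exp_Q N ?q t c)) \<le> \<beta> k"
        unfolding \<beta>_def by simp
      then show "L1_dist N d (T n t (edge_const c)) (edge_const (exp_Q N ?q t c)) \<le> e" using elim by (simp add: k_def)
    qed
  qed
qed

section \<open>Splitting an initial value into its averages and a remainder of mean zero\<close>

lemma avg_remainder: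
  assumes \<phi>: "\<phi> \<in> L1S N d" and i: "i \<in> {1..N}"
  shows "(\<integral>x. \<phi> i x - edge_const (avg d \<phi>) i x \<partial>lebesgue_on {0..d i}) = 0"
proof -
  have int: "integrable (lebesgue_on {0..d i}) (\<phi> i)" using \<phi> i by (auto simp: L1S_iff)
  have const: "integrable (lebesgue_on {0..d i}) (\<lambda>x. avg d \<phi> i)"
    by (intro integrable_continuous_interval_lebesgue continuous_intros)
  show ?thesis
    unfolding edge_const_def using int const measure_interval[of 0 "d i"] length_pos[OF i]
    by (simp add: avg_def LINT_eq)
qed

text \<open>Linearity, valid up to null sets, separates the part that disappears from the part that
  follows the limit dynamics.\<close>

lemma dist_limit_le:
  assumes "n \<ge> 1" "0 \<le> t" "\<phi> \<in> L1S N d"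
  shows "L1_dist N d (T n t \<phi>) (edge_const c) \<le>
    L1_norm N d (T n t (\<lambda>i x. \<phi> i x - edge_const (avg d \<phi>) i x)) + L1_dist N d (T n t (edge_const (avg d \<phi>))) (edge_const c)"
  unfolding T_diff[OF assms edge_const_L1S]
  by (intro L1_dist_triangle T_closed assms edge_const_L1S)

lemma converges_away_from_zero:
  assumes \<phi>: "\<phi> \<in> L1S N d" and \<delta>: "0 < \<delta>" and e: "0 < e"
  shows "\<forall>\<^sub>F n in sequentially. \<forall>t\<in>{\<delta>..\<tau>}.
    L1_dist N d (T n t \<phi>) (edge_const (exp_Q N (q_coeff d \<sigma> l r lt rt) t (avg d \<phi>))) < e"
proof -
  have "vanishing (\<lambda>i x. \<phi> i x - edge_const (avg d \<phi>) i x)"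
    using avg_remainder[OF \<phi>] by (intro vanishing_mean_zero L1S_intros \<phi> edge_const_L1S)
  then have "\<forall>\<^sub>F n in sequentially. \<forall>t\<ge>\<delta>. L1_norm N d (T n t (\<lambda>i x. \<phi> i x - edge_const (avg d \<phi>) i x)) \<le> e/4"
    using e by (intro vanishingD \<delta>) simp_all
  \<comment> \<open>The maximum provides a nonnegative end point also for negative \<tau>, where the
    interval in the claim is empty.\<close>
  moreover have "\<forall>\<^sub>F n in sequentially. \<forall>t\<in>{0..max 0 \<tau>}.
    L1_dist N d (T n t (edge_const (avg d \<phi>))) (edge_const (exp_Q N (q_coeff d \<sigma> l r lt rt) t (avg d \<phi>))) \<le> e/4"
    using e by (intro constants_converge) auto
  ultimately show ?thesis using eventually_ge_at_top[of 1]
  proof eventually_elim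
    case (elim n)
    show ?case
    proof
      fix t assume t: "t \<in> {\<delta>..\<tau>}"
      then have t': "\<delta> \<le> t" "0 \<le> t" "t \<in> {0..max 0 \<tau>}" using \<delta> by auto
      let ?c = "exp_Q N (q_coeff d \<sigma> l r lt rt) t (avg d \<phi>)"
      have "L1_norm N d (T n t (\<lambda>i x. \<phi> i x - edge_const (avg d \<phi>) i x)) \<le> e/4" using elim(1) t'(1) by blast
      moreover have "L1_dist N d (T n t (edge_const (avg d \<phi>))) (edge_const ?c) \<le> e/4" using elim(2) t'(3) by blast
      ultimately show "L1_dist N d (T n t \<phi>) (edge_const ?c) < e"
        using dist_limit_le[OF elim(3) t'(2) \<phi>, of ?c] e by linarith
    qed
  qed
qed

text \<open>Here the remainder has norm zero, so contractivity removes it at every time, including t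
  = 0, about which \<open>vanishing\<close> says nothing.\<close>

lemma converges_L10:
  assumes \<phi>: "\<phi> \<in> L10 N d" and e: "0 < e"
  shows "\<forall>\<^sub>F n in sequentially. \<forall>t\<in>{0..\<tau>}.
    L1_dist N d (T n t \<phi>) (edge_const (exp_Q N (q_coeff d \<sigma> l r lt rt) t (avg d \<phi>))) < e"
proof -
  have \<phi>L: "\<phi> \<in> L1S N d" using \<phi> by (simp add: L10_def)
  obtain c where c: "L1_eq N d \<phi> (edge_const c)" using \<phi> by (auto simp: L10_def)
  have avg: "avg d \<phi> i = c i" if i: "i \<in> {1..N}" for i
  proof -
    have const: "integrable (lebesgue_on {0..d i}) (\<lambda>x. c i)"
      by (intro integrable_continuous_interval_lebesgue continuous_intros)
    have "(\<integral>x. \<phi> i x \<partial>lebesgue_on {0..d i}) = (\<integral>x. c i \<partial>lebesgue_on {0..d i})"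
      using c i \<phi>L const by (intro integral_cong_AE) (auto simp: L1_eq_def ae_eq_on_iff edge_const_def L1S_iff)
    then show ?thesis
      using measure_interval[of 0 "d i"] length_pos[OF i] by (simp add: avg_def LINT_eq)
  qed
  have "L1_norm N d (\<lambda>i x. \<phi> i x - edge_const (avg d \<phi>) i x) = L1_dist N d \<phi> (edge_const c)"
    unfolding L1_dist_def by (rule L1_norm_cong_on) (simp add: edge_const_def avg)
  also have "\<dots> = 0" using c \<phi>L edge_const_L1S by (simp flip: L1_eq_iff_dist)
  finally have zero: "L1_norm N d (\<lambda>i x. \<phi> i x - edge_const (avg d \<phi>) i x) = 0" .
  have "\<forall>\<^sub>F n in sequentially. \<forall>t\<in>{0..max 0 \<tau>}.
    L1_dist N d (T n t (edge_const (avg d \<phi>))) (edge_const (exp_Q N (q_coeff d \<sigma> l r lt rt) t (avg d \<phi>))) \<le> e/2"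
    using e by (intro constants_converge) auto
  then show ?thesis using eventually_ge_at_top[of 1]
  proof eventually_elim
    case (elim n)
    show ?case
    proof
      fix t assume t: "t \<in> {0..\<tau>}"
      then have t': "0 \<le> t" "t \<in> {0..max 0 \<tau>}" by auto
      let ?c = "exp_Q N (q_coeff d \<sigma> l r lt rt) t (avg d \<phi>)"
      have "L1_norm N d (T n t (\<lambda>i x. \<phi> i x - edge_const (avg d \<phi>) i x)) \<le> 0"
        using T_contraction[OF elim(2) t'(1) L1S_diff[OF \<phi>L edge_const_L1S[of "avg d \<phi>"]]] zero by simp
      moreover have "L1_dist N d (T n t (edge_const (avg d \<phi>))) (edge_const ?c) \<le> e/2" using elim(1) t'(2) by blast
      ultimately show "L1_dist N d (T n t \<phi>) (edge_const ?c) < e"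
        using dist_limit_le[OF elim(2) t'(1) \<phi>L, of ?c] e by linarith
    qed
  qed
qed

end

theorem theorem2p11:
  fixes G :: "(real ^ 3, nat) pre_digraph" and N :: nat and d :: "nat \<Rightarrow> real"
    and \<gamma> :: "nat \<Rightarrow> real \<Rightarrow> real ^ 3"
    and \<sigma> l r :: "nat \<Rightarrow> real" and lt rt :: "nat \<Rightarrow> nat \<Rightarrow> real"
    and \<kappa> :: "nat \<Rightarrow> real" and T :: "nat \<Rightarrow> real \<Rightarrow> edge_fun \<Rightarrow> edge_fun"
  assumes graph: "graph_diffusion G N d \<gamma> \<sigma> l r lt rt"
    and kappa_pos: "\<And>n. n \<ge> 1 \<Longrightarrow> \<kappa> n > 0"
    and kappa_mono: "mono_on {1..} \<kappa>"
    and kappa_lim: "filterlim \<kappa> at_top sequentially"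
    and semigroups: "\<And>n. n \<ge> 1 \<Longrightarrow>
          generates N d (A_star_dom G N d \<sigma> l r lt rt (\<kappa> n)) (A_star d \<sigma> (\<kappa> n)) (T n)"
  defines "lim_sg \<equiv> \<lambda>t \<phi>. edge_const (exp_Q N (q_coeff d \<sigma> l r lt rt) t (avg d \<phi>))"
  shows "(\<forall>\<phi>\<in>L1S N d.
            (\<forall>t>0. (\<lambda>n. L1_dist N d (T n t \<phi>) (lim_sg t \<phi>)) \<longlonglongrightarrow> 0) \<and>
            (\<forall>K. compact K \<and> K \<subseteq> {0<..} \<longrightarrow>
               uniform_limit K (\<lambda>n t. L1_dist N d (T n t \<phi>) (lim_sg t \<phi>)) (\<lambda>t. 0) sequentially)) \<and>
         (\<forall>\<phi>\<in>L10 N d.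
            (\<lambda>n. L1_dist N d (T n 0 \<phi>) (lim_sg 0 \<phi>)) \<longlonglongrightarrow> 0 \<and>
            (\<forall>K. compact K \<and> K \<subseteq> {0..} \<longrightarrow>
               uniform_limit K (\<lambda>n t. L1_dist N d (T n t \<phi>) (lim_sg t \<phi>)) (\<lambda>t. 0) sequentially))"
proof -
  interpret graph_semigroups G N d \<gamma> \<sigma> l r lt rt \<kappa> T
    using graph kappa_pos kappa_lim semigroups
    by (simp add: graph_semigroups_def graph_semigroups_axioms_def)
  let ?D = "\<lambda>\<phi> n t. L1_dist N d (T n t \<phi>) (lim_sg t \<phi>)"
  have unif: "uniform_limit K (?D \<phi>) (\<lambda>t. 0) sequentially"
    if "\<And>e. 0 < e \<Longrightarrow> \<forall>\<^sub>F n in sequentially. \<forall>t\<in>{a..b}. ?D \<phi> n t < e" "K \<subseteq> {a..b}" for K a b \<phi>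
    unfolding uniform_limit_iff
  proof (intro allI impI)
    fix e :: real assume "0 < e"
    from that(1)[OF this] show "\<forall>\<^sub>F n in sequentially. \<forall>t\<in>K. dist (?D \<phi> n t) 0 < e"
      by eventually_elim (use that(2) in \<open>auto simp: L1_dist_nonneg\<close>)
  qed
  \<comment> \<open>Pointwise statements are the uniform ones on the compact set consisting of the
    single point t.\<close>
  have point: "(\<lambda>n. ?D \<phi> n t) \<longlonglongrightarrow> 0" if "uniform_limit {t} (?D \<phi>) (\<lambda>t. 0) sequentially" for \<phi> t
    using tendsto_uniform_limitI[OF that] by simp
  have 1: "uniform_limit K (?D \<phi>) (\<lambda>t. 0) sequentially" if \<phi>: "\<phi> \<in> L1S N d" and K: "compact K" "K \<subseteq> {0<..}" for \<phi> K
  proof (cases "K = {}")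
    case False
    \<comment> \<open>The least element of \<open>K\<close> is attained in \<open>K\<close> and
      hence positive; it is the distance from time 0 that the convergence result requires.\<close>
    obtain a b where ab: "a \<in> K" "\<And>t. t \<in> K \<Longrightarrow> a \<le> t" "\<And>t. t \<in> K \<Longrightarrow> t \<le> b"
      using compact_attains_inf[OF K(1) False] compact_attains_sup[OF K(1) False] by blast
    show ?thesis
    proof (rule unif)
      show "\<forall>\<^sub>F n in sequentially. \<forall>t\<in>{a..b}. ?D \<phi> n t < e" if "0 < e" for e
        unfolding lim_sg_def using ab(1) K(2) \<phi> that by (intro converges_away_from_zero) auto
    qed (use ab in auto)
  qed simp
  have 2: "uniform_limit K (?D \<phi>) (\<lambda>t. 0) sequentially" if \<phi>: "\<phi> \<in> L10 N d" and K: "compact K" "K \<subseteq> {0..}" for \<phi> K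
  proof -
    obtain b where b: "\<And>t. t \<in> K \<Longrightarrow> t \<le> b"
      using compact_imp_bounded[OF K(1)] unfolding bounded_iff by (metis abs_le_D1 real_norm_def)
    show ?thesis
    proof (rule unif)
      show "\<forall>\<^sub>F n in sequentially. \<forall>t\<in>{0..b}. ?D \<phi> n t < e" if "0 < e" for e
        unfolding lim_sg_def by (rule converges_L10[OF \<phi> that])
    qed (use b K(2) in auto)
  qed
  show ?thesis
    by (intro conjI ballI allI impI) (auto intro: 1 2 intro!: point)
qed

end
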